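(* Let $w_{\ell k}$, $\ell,k\ge 0$, be non-negative numbers with generating function $$G_k(z)=\frac{R_k(z)}{S_k(z)}=\sum_{\ell\ge 0}w_{\ell k}z^\ell$$ such that $w_{\ell k}$ is non-decreasing in $k$. Assume that $$R_k(z)=r_0(z)+r_1\Bigl(z,\Bigl(\frac z{a_1}\Bigr)^k,\ldots,\Bigl(\frac z{a_m}\Bigr)^k\Bigr),$$ $$S_k(z)=(1-z)s_0(z)+\Bigl(\frac z{a_1}\Bigr)^ks_1(z)+s_2\Bigl(z,\Bigl(\frac z{a_1}\Bigr)^k,\ldots,\Bigl(\frac z{a_m}\Bigr)^k\Bigr),$$ where $r_0$, $s_0$ and $s_1$ are real polynomials in $z$ (not depending on $k$). Furthermore, $r_1$ and $s_2$ are real polynomials in $z,(z/a_1)^k,\ldots,(z/a_m)^k$ for some $m\ge 2$ and some real numbers $1<a:=a_1<|a_2|\le|a_3|\le\cdots\le|a_m|$, such that each of the summands in $r_1$ is divisible by one of the terms $(z/a_1)^k,\ldots,(z/a_m)^k$ and each of the summands in $s_2$ is divisible by one of the terms $(z/a_1)^{2k},(z/a_2)^k,\ldots,(z/a_m)^k$. Define $$\delta:=s_1(1)/s_0(1),\qquad \rho:=\min\bigl(\log|a_2|/\log a_1,\,2\bigr)-1.$$ Assume furthermore that $r_0(1)\neq 0$, that $s_0$ does not have any zero in $|z|\le 1$ and that $\delta>0$. Then $G(z):=\frac{r_0(z)}{(1-z)s_0(z)}=\lim_{k\to\infty}G_k(z)$ and $$G(z)=\sum_{\ell\ge 0}w_\ell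 z^\ell$$ with $w_\ell=w_{\ell k}$ for $k\ge\ell$. Additionally, $w_\ell\neq 0$ for $\ell\ge\ell_0$ for a suitable $\ell_0$. Let $(X_\ell)_{\ell\ge\ell_0}$ be the sequence of random variables with support $\mathbb{N}_0$ defined by $$\mathbb{P}(X_\ell\le k)=\frac{w_{\ell k}}{w_\ell}.$$ Then the asymptotic formula $$\frac{w_{\ell k}}{w_\ell}=\exp(-\delta\ell/a^k)(1+o(1))$$ holds as $\ell\to\infty$ for $k=\log_a\ell+O(1)$. Hence the shifted random variable $X_\ell-\log_a\ell$ converges weakly to a limiting distribution if $\ell$ runs through a subset of the positive integers such that the fractional part $\{\log_a\ell\}$ of $\log_a\ell$ converges. The expected value of $X_\ell$ is $$\mathbb{E}X_\ell=\log_a\ell+\log_a\delta+\frac{\gamma}{\log a}+\frac12+\Psi_0(\log_a\ell+\log_a\delta)+O\Bigl(\frac{\log^{\rho+3}\ell}{\ell^\rho}\Bigr),$$ and the variance is $$\mathbb{V}X_\ell=\frac{\pi^2}{6\log^2a}+\frac1{12}+\Psi_1(\log_a\ell+\log_a\delta)-\frac{2\gamma}{\log a}\Psi_0(\log_a\ell+\log_a\delta)-\Psi_0^2(\log_a\ell+\log_a\delta)+O\Bigl(\frac{\log^{\rho+4}\ell}{\ell^\rho}\Bigr),$$ where $\gamma$ is the Euler--Mascheroni constant, and $\Psi_0(x)$ and $\Psi_1(x)$ are periodic functions (with period $1$ and mean value $0$) given by the Fourier expansions $$\Psi_0(x)=-\frac1{\log a}\sum_{n\neq 0}\Gamma\Bigl(-\frac{2n\pi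 i}{\log a}\Bigr)e^{2n\pi ix},\qquad \Psi_1(x)=\frac{2}{\log^2a}\sum_{n\neq 0}\Gamma'\Bigl(-\frac{2n\pi i}{\log a}\Bigr)e^{2n\pi ix}.$$
   Context: Here $\log$ is the natural logarithm, $\log_a$ the logarithm to base $a$, and $\Gamma$ is the Gamma function with derivative $\Gamma'$. The sums over $n\neq0$ run over all nonzero integers. $\mathbb{E}$ and $\mathbb{V}$ denote expectation and variance.
   Formalization: The identity w_ℓ = w_{ℓk} is proved for k > ℓ rather than k ≥ ℓ; at k = ℓ it fails in general, e.g. for G_k(z) = 1/(1−z+(z/2)^k), where w_{kk} = 1−2^{−k} for k ≥ 1 but w_k = 1. *)

theory Defs
  imports "HOL-Probability.Probability" "HOL-Library.Poly_Mapping" "HOL-Library.Landau_Symbols"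
    "HOL-Computational_Algebra.Computational_Algebra"
begin

text \<open>
  A real polynomial in the variables \<open>x\<^sub>0, x\<^sub>1, \<dots>\<close> is a finitely supported map from exponent
  vectors to coefficients. It is evaluated at univariate polynomials \<open>y i\<close>.
\<close>

type_synonym mpoly = "(nat \<Rightarrow>\<^sub>0 nat) \<Rightarrow>\<^sub>0 real"

definition mpoly_subst :: "(nat \<Rightarrow> real poly) \<Rightarrow> mpoly \<Rightarrow> real poly" where
  "mpoly_subst y p = (\<Sum>e\<in>Poly_Mapping.keys p.
     smult (Poly_Mapping.lookup p e)
       (\<Prod>i\<in>Poly_Mapping.keys e. y i ^ Poly_Mapping.lookup e i))"

definition mpoly_in_vars :: "nat \<Rightarrow> mpoly \<Rightarrow> bool" where
  "mpoly_in_vars m p \<longleftrightarrow> (\<forall>e\<in>Poly_Mapping.keys p. Poly_Mapping.keys e \<subseteq> {0..m})"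

text \<open>
  In \<open>r\<^sub>1\<close> and \<open>s\<^sub>2\<close> the variable \<open>x\<^sub>0\<close> stands for \<open>z\<close>, and \<open>x\<^sub>j\<close> for \<open>(z/a\<^sub>j)\<^sup>k\<close> when \<open>j\<close> is
  positive.
\<close>

definition arg_poly :: "(nat \<Rightarrow> real) \<Rightarrow> nat \<Rightarrow> nat \<Rightarrow> real poly" where
  "arg_poly a k j = (if j = 0 then [:0, 1:] else [:0, 1 / a j:] ^ k)"

definition R_poly :: "(nat \<Rightarrow> real) \<Rightarrow> real poly \<Rightarrow> mpoly \<Rightarrow> nat \<Rightarrow> real poly" where
  "R_poly a r0 r1 k = r0 + mpoly_subst (arg_poly a k) r1"

definition S_poly :: "(nat \<Rightarrow> real) \<Rightarrow> real poly \<Rightarrow> real poly \<Rightarrow> mpoly \<Rightarrow> nat \<Rightarrow> real poly" where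
  "S_poly a s0 s1 s2 k =
     [:1, -1:] * s0 + [:0, 1 / a 1:] ^ k * s1 + mpoly_subst (arg_poly a k) s2"

definition r1_admissible :: "nat \<Rightarrow> mpoly \<Rightarrow> bool" where
  "r1_admissible m p \<longleftrightarrow> mpoly_in_vars m p \<and>
     (\<forall>e\<in>Poly_Mapping.keys p. \<exists>j\<in>{1..m}. Poly_Mapping.lookup e j \<ge> 1)"

definition s2_admissible :: "nat \<Rightarrow> mpoly \<Rightarrow> bool" where
  "s2_admissible m p \<longleftrightarrow> mpoly_in_vars m p \<and>
     (\<forall>e\<in>Poly_Mapping.keys p. Poly_Mapping.lookup e 1 \<ge> 2 \<or>
        (\<exists>j\<in>{2..m}. Poly_Mapping.lookup e j \<ge> 1))"

definition cpoly :: "real poly \<Rightarrow> complex \<Rightarrow> complex" where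
  "cpoly p z = poly (map_poly complex_of_real p) z"

definition G_lim :: "real poly \<Rightarrow> real poly \<Rightarrow> complex \<Rightarrow> complex" where
  "G_lim r0 s0 z = cpoly r0 z / ((1 - z) * cpoly s0 z)"

text \<open>
  The Taylor coefficients of \<open>G_lim\<close> at 0, provided that \<open>s0\<close> does not vanish there. They agree
  with the coefficients of \<open>R_poly / S_poly\<close> below \<open>z\<^sup>k\<close>. At \<open>z\<^sup>k\<close> itself they can differ:
  \<open>1 / (1 - z + (z/2)\<^sup>k)\<close> tends to \<open>1 / (1 - z)\<close>, but its \<open>z\<^sup>k\<close> coefficient is not 1 (for
  \<open>k = 0\<close> the constant term is \<open>1/2\<close>).
\<close>

definition w_lim :: "real poly \<Rightarrow> real poly \<Rightarrow> nat \<Rightarrow> real" where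
  "w_lim r0 s0 l = fps_nth (fps_of_poly r0 / fps_of_poly ([:1, -1:] * s0)) l"

definition delta :: "real poly \<Rightarrow> real poly \<Rightarrow> real" where
  "delta s0 s1 = poly s1 1 / poly s0 1"

definition rho :: "(nat \<Rightarrow> real) \<Rightarrow> real" where
  "rho a = min (ln \<bar>a 2\<bar> / ln (a 1)) 2 - 1"

definition rv_with_cdf :: "'b measure \<Rightarrow> ('b \<Rightarrow> nat) \<Rightarrow> (nat \<Rightarrow> real) \<Rightarrow> bool" where
  "rv_with_cdf M X F \<longleftrightarrow> prob_space M \<and> X \<in> M \<rightarrow>\<^sub>M count_space UNIV \<and>
     (\<forall>k. measure M {\<omega> \<in> space M. X \<omega> \<le> k} = F k)"

definition Psi0_term :: "real \<Rightarrow> real \<Rightarrow> int \<Rightarrow> complex" where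
  "Psi0_term a x n = Gamma (- (2 * of_int n * of_real pi * \<i> / of_real (ln a)))
     * exp (2 * of_int n * of_real pi * \<i> * of_real x)"

definition Psi1_term :: "real \<Rightarrow> real \<Rightarrow> int \<Rightarrow> complex" where
  "Psi1_term a x n = deriv Gamma (- (2 * of_int n * of_real pi * \<i> / of_real (ln a)))
     * exp (2 * of_int n * of_real pi * \<i> * of_real x)"

text \<open>
  The sums below are complex-valued. That they converge and are real is a claim about them, not
  part of the definition.
\<close>

definition Psi0 :: "real \<Rightarrow> real \<Rightarrow> complex" where
  "Psi0 a x = - (1 / of_real (ln a)) * (\<Sum>\<^sub>\<infinity>n\<in>{n. n \<noteq> 0}. Psi0_term a x n)"

definition Psi1 :: "real \<Rightarrow> real \<Rightarrow> complex" where
  "Psi1 a x = 2 / of_real ((ln a)\<^sup>2) * (\<Sum>\<^sub>\<infinity>n\<in>{n. n \<noteq> 0}. Psi1_term a x n)"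

end

theory Submission
  imports Defs "HOL-Complex_Analysis.Complex_Analysis" "HOL-Real_Asymp.Real_Asymp"
begin

text \<open>
  For large \<open>k\<close> the denominator has exactly one zero near 1, namely
  \<open>\<zeta>\<^sub>k = 1 + \<delta> a\<^sup>-\<^sup>k + O(k b\<^sup>-\<^sup>k)\<close> with \<open>b = min \<bar>a\<^sub>2\<bar> a\<^sup>2 = a\<^sup>1\<^sup>+\<^sup>\<rho>\<close>. Once the factor
  \<open>1 - z/\<zeta>\<^sub>k\<close> is divided out, the cofactor tends to \<open>s\<^sub>0\<close> uniformly on a disc of radius \<open>r > 1\<close>, so
  Cauchy's inequality yields \<open>w\<^sub>l\<^sub>k = h\<^sub>k \<zeta>\<^sub>k\<^sup>-\<^sup>l + O(r\<^sup>-\<^sup>l)\<close> uniformly in \<open>k\<close> and \<open>l\<close>. Hence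
  \<open>w\<^sub>l\<^sub>k / w\<^sub>l\<close> equals \<open>exp (-\<delta> l / a\<^sup>k)\<close> up to an error whose sum over \<open>k\<close> is \<open>O(log\<^sup>3 l / l\<^sup>\<rho>)\<close>, even with
  the weight \<open>2k + 1\<close> of the second moment.

  If \<open>Y\<close> is a standard exponential variable and \<open>u = log\<^sub>a (\<delta> l)\<close>, then \<open>exp (-\<delta> l / a\<^sup>k)\<close> is the probability that
  \<open>\<lceil>u - log\<^sub>a Y\<rceil> \<le> k\<close>. Write \<open>\<lceil>v\<rceil> = v + 1/2 + s(v)\<close> with the sawtooth \<open>s\<close>. The Fourier series of
  \<open>s\<close> and \<open>s\<^sup>2\<close> turn the moments of \<open>\<lceil>u - log\<^sub>a Y\<rceil>\<close> into values of \<open>\<Gamma>\<close> and \<open>\<Gamma>'\<close>, because the expectation of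
  \<open>Y\<^sup>i\<^sup>t\<close> is \<open>\<Gamma>(1 + i t)\<close>.
\<close>

section \<open>The exponential distribution and the Gamma function\<close>

text \<open>The moments of a variable with distribution function \<open>F l\<close> are sums over
  \<open>k \<le> l\<close> of multiples of \<open>1 - F l k\<close>. An estimate that is good for
  each fixed \<open>k\<close> is therefore worthless: it must be uniform in \<open>l\<close> and
  \<open>k\<close> and summable over \<open>k\<close>. This dictates the shape of the error. The
  factor \<open>exp (- c * l / a ^ k)\<close> makes it tiny where \<open>a ^ k\<close> is small
  against \<open>l\<close>, the factors \<open>l / b ^ k\<close> and \<open>1 / a ^ k\<close> where
  it is large; with \<open>y = l / a ^ k\<close>, \<open>l / b ^ k\<close> is
  \<open>l powr (- \<rho>) * y powr (1 + \<rho>)\<close>. So only about \<open>log l\<close> values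
  of \<open>k\<close> count, each with one factor \<open>k\<close> from the position of the zero and
  one from the second moment, whence the cube of the logarithm. The finitely many \<open>k\<close>
  without a known zero are covered by monotonicity of \<open>w\<close> in \<open>k\<close>. The
  variance costs one more logarithm, because the error of the mean gets multiplied by the mean. The
  main terms need no contour integral: sums of tail probabilities are again clamped moments, and the
  Fourier series enters only under an expectation, where Abel summation and dominated convergence
  apply.\<close>

definition std_exp :: "real measure" where
  "std_exp = density lborel (exponential_density 1)"

lemma prob_space_std_exp: "prob_space std_exp"
  unfolding std_exp_def by (rule prob_space_exponential_density) simp

interpretation std_exp: prob_space std_exp
  by (rule prob_space_std_exp)

lemma sets_std_exp [measurable_cong, simp]: "sets std_exp = sets borel"
  by (simp add: std_exp_def)

lemma space_std_exp [simp]: "space std_exp = UNIV"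
  by (simp add: std_exp_def)

text \<open>\<open>ln\<close> and \<open>powr\<close> are total functions, and the identities for
  them below hold for positive \<open>y\<close> only; hence they are used almost everywhere.\<close>

lemma AE_std_exp_pos: "AE y in std_exp. y > 0"
proof -
  have "AE y in lborel. y \<noteq> (0::real)"
    by (rule AE_lborel_singleton)
  thus ?thesis
    unfolding std_exp_def by (subst AE_density) (auto simp: exponential_density_def elim!: eventually_mono)
qed

lemma integrable_std_exp_iff:
  fixes f :: "real \<Rightarrow> 'a :: {banach, second_countable_topology}"
  assumes [measurable]: "f \<in> borel_measurable borel"
  shows "integrable std_exp f \<longleftrightarrow> set_integrable lborel {0<..} (\<lambda>y. exp (- y) *\<^sub>R f y)"
proof -
  have "integrable std_exp f \<longleftrightarrow> integrable lborel (\<lambda>y. exponential_density 1 y *\<^sub>R f y)"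
    unfolding std_exp_def by (intro integrable_density) (auto simp: exponential_density_def)
  also have "\<dots> \<longleftrightarrow> integrable lborel (\<lambda>y. indicator {0<..} y *\<^sub>R (exp (- y) *\<^sub>R f y))"
  \<comment> \<open>The density equals 1 at 0, while the Gamma integral runs over the open ray. The
    two integrands differ at one point, a null set.\<close>
  proof (rule integrable_cong_AE)
    show "AE y in lborel. exponential_density 1 y *\<^sub>R f y = indicator {0<..} y *\<^sub>R (exp (- y) *\<^sub>R f y)"
      using AE_lborel_singleton[of 0]
      by eventually_elim (auto simp: exponential_density_def indicator_def)
  qed (auto simp: exponential_density_def[abs_def])
  finally show ?thesis by (simp add: set_integrable_def)
qed

lemma integral_std_exp:
  fixes f :: "real \<Rightarrow> 'a :: {banach, second_countable_topology}"
  assumes [measurable]: "f \<in> borel_measurable borel"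
  shows "integral\<^sup>L std_exp f = (LINT y:{0<..}|lborel. exp (- y) *\<^sub>R f y)"
proof -
  have "integral\<^sup>L std_exp f = integral\<^sup>L lborel (\<lambda>y. exponential_density 1 y *\<^sub>R f y)"
    unfolding std_exp_def by (intro integral_density) (auto simp: exponential_density_def)
  also have "\<dots> = integral\<^sup>L lborel (\<lambda>y. indicator {0<..} y *\<^sub>R (exp (- y) *\<^sub>R f y))"
  proof (rule integral_cong_AE)
    show "AE y in lborel. exponential_density 1 y *\<^sub>R f y = indicator {0<..} y *\<^sub>R (exp (- y) *\<^sub>R f y)"
      using AE_lborel_singleton[of 0]
      by eventually_elim (auto simp: exponential_density_def indicator_def)
  qed (auto simp: exponential_density_def[abs_def])
  finally show ?thesis by (simp add: set_lebesgue_integral_def)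
qed

text \<open>This is Euler's integral. The work lies in the passage between measures: the known
  integral lives on the completed Lebesgue measure, \<open>std_exp\<close> on Borel sets.\<close>

lemma std_exp_powr:
  assumes "Re z > 0"
  shows "integrable std_exp (\<lambda>y. complex_of_real y powr (z - 1))"
    and "(LINT y|std_exp. complex_of_real y powr (z - 1)) = Gamma z"
proof -
  let ?f = "\<lambda>y. complex_of_real y powr (z - 1) / of_real (exp y)"
  have m: "(\<lambda>y. indicator {0<..} y *\<^sub>R ?f y) \<in> borel_measurable lborel"
    by (auto intro!: borel_measurable_continuous_on_indicator continuous_intros)
  have m1: "(\<lambda>y. complex_of_real y powr (z - 1)) \<in> borel_measurable borel"
    by measurable
  have eq: "exp (- y) *\<^sub>R complex_of_real y powr (z - 1) = ?f y" for y
    by (simp add: exp_minus scaleR_conv_of_real field_simps)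
  have I: "?f absolutely_integrable_on {0<..}"
    by (rule absolutely_integrable_Gamma_integral'[OF assms])
  have I': "set_integrable lborel {0<..} ?f"
    using I m unfolding set_integrable_def by (subst (asm) integrable_completion) auto
  show "integrable std_exp (\<lambda>y. complex_of_real y powr (z - 1))"
    by (subst integrable_std_exp_iff[OF m1]) (use I' in \<open>simp only: eq\<close>)
  have "(LINT y|std_exp. complex_of_real y powr (z - 1)) = (LINT y:{0<..}|lborel. ?f y)"
    by (subst integral_std_exp[OF m1]) (simp only: eq)
  also have "\<dots> = (LINT y:{0<..}|lebesgue. ?f y)"
    using m unfolding set_lebesgue_integral_def by (subst integral_completion) auto
  also have "\<dots> = integral {0<..} ?f"
    by (rule set_lebesgue_integral_eq_integral(2)[OF I])
  also have "\<dots> = Gamma z"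
    by (rule integral_unique[OF Gamma_integral_complex'[OF assms]])
  finally show "(LINT y|std_exp. complex_of_real y powr (z - 1)) = Gamma z" .
qed

lemma std_exp_powr_real:
  assumes "s > -1"
  shows "integrable std_exp (\<lambda>y. y powr s)"
proof -
  have "integrable std_exp (\<lambda>y. complex_of_real y powr ((1 + of_real s) - 1))"
    using assms by (intro std_exp_powr) auto
  hence "integrable std_exp (\<lambda>y. cmod (complex_of_real y powr ((1 + of_real s) - 1)))"
    by (rule integrable_norm)
  thus ?thesis
  proof (rule iffD1[OF integrable_cong_AE, rotated -1])
    show "AE y in std_exp. cmod (complex_of_real y powr ((1 + of_real s) - 1)) = y powr s"
      using AE_std_exp_pos by eventually_elim (simp add: norm_powr_real_powr)
  qed measurable
qed

section \<open>Logarithmic moments of the exponential distribution\<close>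

lemma abs_ln_power_le:
  assumes "y > 0"
  shows "\<bar>ln y\<bar> ^ j \<le> (2 * real (Suc j)) ^ j * (y powr (1 / 2) + y powr (-1 / 2))"
proof -
  \<comment> \<open>The bound is \<open>ln x < x\<close> at \<open>x = v powr c\<close>, with
    \<open>c\<close> so small that the \<open>j\<close>-th power stays below
    \<open>v powr (1 / 2)\<close>. Values below 1 are inverted. Both final exponents exceed -1, so
    the bound is integrable.\<close>
  define c where "c = 1 / (2 * real (Suc j))"
  have c: "c > 0" "real j * c \<le> 1 / 2" "inverse c = 2 * real (Suc j)" by (auto simp: c_def field_simps)
  have aux: "ln v ^ j \<le> (2 * real (Suc j)) ^ j * v powr (1/2)" if "v \<ge> 1" for v :: real
  proof -
    have "ln v * c \<le> v powr c"
      using that c ln_less_self[of "v powr c"] by (simp add: ln_powr mult.commute)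
    hence "ln v \<le> inverse c * v powr c"
      using c by (simp add: field_simps)
    hence "ln v ^ j \<le> (inverse c * v powr c) ^ j"
      using that by (intro power_mono) auto
    also have "\<dots> = inverse c ^ j * v powr (real j * c)"
      using that by (simp add: power_mult_distrib powr_powr_swap powr_power)
    also have "\<dots> \<le> inverse c ^ j * v powr (1/2)"
      using that c by (intro mult_left_mono powr_mono) auto
    finally show ?thesis by (simp add: c)
  qed
  show ?thesis
  proof (cases "y \<ge> 1")
    case True
    have "\<bar>ln y\<bar> ^ j \<le> (2 * real (Suc j)) ^ j * y powr (1/2)" using aux[OF True] True by simp
    also have "\<dots> \<le> (2 * real (Suc j)) ^ j * (y powr (1 / 2) + y powr (-1 / 2))"
      by (intro mult_left_mono) auto
    finally show ?thesis .
  next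
    case False
    have "\<bar>ln y\<bar> ^ j = ln (1/y) ^ j" using False assms by (simp add: ln_div)
    also have "\<dots> \<le> (2 * real (Suc j)) ^ j * (1/y) powr (1/2)" using aux[of "1/y"] False assms by simp
    also have "(1/y) powr (1/2) = y powr (-1/2)" using assms by (simp add: powr_divide powr_minus_divide)
    also have "(2 * real (Suc j)) ^ j * \<dots> \<le> (2 * real (Suc j)) ^ j * (y powr (1 / 2) + y powr (-1 / 2))"
      by (intro mult_left_mono) auto
    finally show ?thesis .
  qed
qed

lemma integrable_abs_ln_power: "integrable std_exp (\<lambda>y. \<bar>ln y\<bar> ^ j)"
proof (rule Bochner_Integration.integrable_bound)
  show "integrable std_exp (\<lambda>y. (2 * real (Suc j)) ^ j * (y powr (1 / 2) + y powr (-1 / 2)))"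
    by (intro integrable_mult_right Bochner_Integration.integrable_add std_exp_powr_real) auto
  show "AE y in std_exp. norm (\<bar>ln y\<bar> ^ j) \<le> norm ((2 * real (Suc j)) ^ j * (y powr (1 / 2) + y powr (-1 / 2)))"
    using AE_std_exp_pos
  proof eventually_elim
    case (elim y)
    show ?case using abs_ln_power_le[OF elim, of j] by simp
  qed
qed measurable

text \<open>Up to the factor \<open>\<i> ^ j\<close> this is the \<open>j\<close>-th derivative of
  \<open>Gamma (1 + \<i> * t)\<close> in \<open>t\<close>. Required are \<open>j = 0, 1\<close> at
  the frequencies of the Fourier series and \<open>j = 1, 2\<close> at 0.\<close>

definition ln_moment :: "nat \<Rightarrow> real \<Rightarrow> complex" where
  "ln_moment j t = (LINT y|std_exp. of_real (ln y ^ j) * cis (t * ln y))"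

lemma measurable_cis_ln [measurable]:
  "(\<lambda>y. cis (t * ln y)) \<in> borel_measurable borel"
  unfolding cis_conv_exp by measurable

lemma integrable_ln_power_cis:
  "integrable std_exp (\<lambda>y. of_real (ln y ^ j) * cis (t * ln y))"
  by (rule Bochner_Integration.integrable_bound[OF integrable_abs_ln_power[of j]])
     (auto simp: norm_mult norm_power)

lemma ln_moment_0: "ln_moment 0 t = Gamma (1 + \<i> * of_real t)"
proof -
  have "ln_moment 0 t = (LINT y|std_exp. complex_of_real y powr ((1 + \<i> * of_real t) - 1))"
    unfolding ln_moment_def
  proof (rule integral_cong_AE)
    show "AE y in std_exp. of_real (ln y ^ 0) * cis (t * ln y) = complex_of_real y powr ((1 + \<i> * of_real t) - 1)"
      using AE_std_exp_pos
      by eventually_elim (simp add: powr_def cis_conv_exp Ln_of_real mult_ac)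
  qed measurable
  also have "\<dots> = Gamma (1 + \<i> * of_real t)"
    by (rule std_exp_powr) simp
  finally show ?thesis .
qed

lemma norm_cis_diff_le: "norm (cis a - cis b) \<le> \<bar>a - b\<bar>"
proof -
  have "cis a - cis b = cis b * (cis (a - b) - 1)"
    by (simp add: algebra_simps cis_mult)
  hence "norm (cis a - cis b) = norm (cis (a - b) - 1)"
    by (simp add: norm_mult)
  also have "\<dots> \<le> \<bar>a - b\<bar>"
    using iexp_approx1[of "a - b" 0] by (simp add: cis_conv_exp)
  finally show ?thesis .
qed

text \<open>Dominated convergence is applied to sequences, so a derivative has to be tested along a
  sequence of increments.\<close>

lemma has_vector_derivative_LIMSEQ:
  assumes f: "(f has_vector_derivative D) (at t)"
    and h0: "h \<longlonglongrightarrow> 0" and h: "\<And>n. h n \<noteq> 0"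
  shows "(\<lambda>n. (f (t + h n) - f t) /\<^sub>R h n) \<longlonglongrightarrow> D"
proof -
  have "filterlim h (at 0) sequentially"
    using h h0 by (auto simp: filterlim_at intro!: always_eventually)
  moreover have "((\<lambda>x. norm (f (t + x) - f t - x *\<^sub>R D) / norm x) \<longlongrightarrow> 0) (at 0)"
    using f by (simp add: has_vector_derivative_def has_derivative_at)
  ultimately have "(\<lambda>n. norm (f (t + h n) - f t - h n *\<^sub>R D) / norm (h n)) \<longlonglongrightarrow> 0"
    by (rule filterlim_compose[rotated])
  moreover have "norm (f (t + h n) - f t - h n *\<^sub>R D) / norm (h n)
      = norm ((f (t + h n) - f t) /\<^sub>R h n - D)" for n
  proof -
    have "(f (t + h n) - f t) /\<^sub>R h n - D = (f (t + h n) - f t - h n *\<^sub>R D) /\<^sub>R h n"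
      using h[of n] by (simp add: scaleR_diff_right)
    thus ?thesis by (simp add: divide_inverse mult.commute)
  qed
  ultimately have "(\<lambda>n. norm ((f (t + h n) - f t) /\<^sub>R h n - D)) \<longlonglongrightarrow> 0" by simp
  thus ?thesis by (subst LIM_zero_iff[symmetric], subst tendsto_norm_zero_iff[symmetric])
qed

text \<open>Differentiability is a hypothesis, supplied by the closed form of the lower moment. One
  sequence of difference quotients then determines the derivative, and since \<open>cis\<close> is
  1-Lipschitz, the quotients are dominated by \<open>\<bar>ln y\<bar> ^ Suc j\<close>.\<close>

lemma ln_moment_Suc:
  assumes "(ln_moment j has_vector_derivative D) (at t)"
  shows "\<i> * ln_moment (Suc j) t = D"
proof (rule LIMSEQ_unique)
  define h where "h n = 1 / real (Suc n)" for n
  have h: "h n > 0" for n by (simp add: h_def)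
  have h0: "h \<longlonglongrightarrow> 0" unfolding h_def by (rule LIMSEQ_Suc) (rule lim_1_over_n)
  show "(\<lambda>n. (ln_moment j (t + h n) - ln_moment j t) /\<^sub>R h n) \<longlonglongrightarrow> D"
    using h by (intro has_vector_derivative_LIMSEQ[OF assms h0]) (auto simp: less_le)
  have eq: "(ln_moment j (t + h n) - ln_moment j t) /\<^sub>R h n
     = (LINT y|std_exp. (of_real (ln y ^ j) * ((cis ((t + h n) * ln y) - cis (t * ln y)) /\<^sub>R h n)))" for n
    unfolding ln_moment_def
    by (subst Bochner_Integration.integral_diff[symmetric], rule integrable_ln_power_cis, rule integrable_ln_power_cis,
        subst integral_scaleR_right[symmetric]) (simp add: algebra_simps scaleR_diff_right)
  have "(\<lambda>n. (LINT y|std_exp. (of_real (ln y ^ j) * ((cis ((t + h n) * ln y) - cis (t * ln y)) /\<^sub>R h n))))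
         \<longlonglongrightarrow> (LINT y|std_exp. (of_real (ln y ^ j) * (of_real (ln y) * (\<i> * cis (t * ln y)))))"
  proof (rule integral_dominated_convergence[where w = "\<lambda>y. \<bar>ln y\<bar> ^ Suc j"])
    show "AE y in std_exp. (\<lambda>n. of_real (ln y ^ j) * ((cis ((t + h n) * ln y) - cis (t * ln y)) /\<^sub>R h n))
             \<longlonglongrightarrow> of_real (ln y ^ j) * (of_real (ln y) * (\<i> * cis (t * ln y)))"
    proof (intro AE_I2 tendsto_intros)
      fix y :: real
      have d: "((\<lambda>t. cis (t * ln y)) has_vector_derivative of_real (ln y) * (\<i> * cis (t * ln y))) (at t)"
        unfolding cis_conv_exp
        by (auto intro!: derivative_eq_intros has_vector_derivative_real_field simp: algebra_simps)
      show "(\<lambda>n. (cis ((t + h n) * ln y) - cis (t * ln y)) /\<^sub>R h n)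
             \<longlonglongrightarrow> of_real (ln y) * (\<i> * cis (t * ln y))"
        using h by (intro has_vector_derivative_LIMSEQ[OF d h0]) (auto simp: less_le)
    qed
    show "AE y in std_exp. norm (of_real (ln y ^ j) * ((cis ((t + h n) * ln y) - cis (t * ln y)) /\<^sub>R h n))
             \<le> \<bar>ln y\<bar> ^ Suc j" for n
    proof (rule AE_I2)
      fix y :: real
      have "norm (cis ((t + h n) * ln y) - cis (t * ln y)) \<le> h n * \<bar>ln y\<bar>"
        using norm_cis_diff_le[of "(t + h n) * ln y" "t * ln y"] h[of n]
        by (simp add: distrib_right abs_mult)
      hence "norm (cis ((t + h n) * ln y) - cis (t * ln y)) / h n \<le> (h n * \<bar>ln y\<bar>) / h n"
        using h[of n] by (intro divide_right_mono) auto
      hence "norm ((cis ((t + h n) * ln y) - cis (t * ln y)) /\<^sub>R h n) \<le> (h n * \<bar>ln y\<bar>) / h n"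
        using h[of n] by (simp only: norm_scaleR) (simp add: divide_inverse mult.commute)
      also have "\<dots> = \<bar>ln y\<bar>" using h[of n] by simp
      finally show "norm (of_real (ln y ^ j) * ((cis ((t + h n) * ln y) - cis (t * ln y)) /\<^sub>R h n))
             \<le> \<bar>ln y\<bar> ^ Suc j"
        unfolding norm_mult norm_of_real power_abs power_Suc2 by (intro mult_left_mono) auto
    qed
  qed (auto intro!: integrable_abs_ln_power simp del: power_Suc)
  also have "(LINT y|std_exp. (of_real (ln y ^ j) * (of_real (ln y) * (\<i> * cis (t * ln y))))) = \<i> * ln_moment (Suc j) t"
    unfolding ln_moment_def
    by (subst integral_mult_right_zero[symmetric], intro Bochner_Integration.integral_cong) (auto simp: algebra_simps)
  finally show "(\<lambda>n. (ln_moment j (t + h n) - ln_moment j t) /\<^sub>R h n) \<longlonglongrightarrow> \<i> * ln_moment (Suc j) t"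
    by (simp only: eq)
qed

lemma ln_moment_1: "ln_moment 1 t = deriv Gamma (1 + \<i> * of_real t)"
proof -
  have np: "1 + \<i> * of_real t \<notin> \<int>\<^sub>\<le>\<^sub>0"
    by (auto elim!: nonpos_Ints_cases simp: complex_eq_iff)
  have "(Gamma has_field_derivative deriv Gamma (1 + \<i> * of_real t)) (at (1 + \<i> * of_real t))"
    using np by (intro DERIV_deriv_iff_field_differentiable[THEN iffD2] field_differentiable_Gamma)
  hence "((Gamma \<circ> (\<lambda>t. 1 + \<i> * of_real t)) has_vector_derivative \<i> * deriv Gamma (1 + \<i> * of_real t)) (at t)"
    by (rule field_vector_diff_chain_at[rotated]) (auto intro!: derivative_eq_intros)
  hence "(ln_moment 0 has_vector_derivative \<i> * deriv Gamma (1 + \<i> * of_real t)) (at t)"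
    by (simp add: o_def ln_moment_0[abs_def])
  from ln_moment_Suc[OF this] show ?thesis by simp
qed

lemma Polygamma_1_1_complex: "Polygamma 1 (1 :: complex) = of_real (pi\<^sup>2 / 6)"
proof -
  have "(\<lambda>n. complex_of_real (1 / (real n + 1)\<^sup>2)) sums of_real (pi\<^sup>2 / 6)"
    using inverse_squares_sums by (subst sums_of_real_iff) (simp add: add.commute)
  moreover have "complex_of_real (1 / (real n + 1)\<^sup>2) = inverse ((1 + of_nat n) ^ 2)" for n
    by (simp add: field_simps)
  ultimately have "(\<lambda>n. inverse ((1 + of_nat n :: complex) ^ 2)) sums of_real (pi\<^sup>2 / 6)"
    by simp
  thus ?thesis by (simp add: Polygamma_def sums_iff numeral_2_eq_2)
qed

text \<open>The value is the second derivative of Gamma at 1, obtained by differentiating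
  \<open>Gamma z * Digamma z\<close>. At 1 the digamma function is minus Euler's constant, and its
  derivative is the sum of the inverse squares.\<close>

lemma ln_moment_2_0: "ln_moment 2 0 = of_real (euler_mascheroni\<^sup>2 + pi\<^sup>2 / 6)"
proof -
  have dG: "deriv Gamma z = Gamma z * Digamma z" if "z \<notin> \<int>\<^sub>\<le>\<^sub>0" for z :: complex
    using has_field_derivative_Gamma[OF that] by (rule DERIV_imp_deriv)
  have np: "1 + \<i> * of_real t \<notin> \<int>\<^sub>\<le>\<^sub>0" for t
    by (auto elim!: nonpos_Ints_cases simp: complex_eq_iff)
  have np1: "(1::complex) \<notin> \<int>\<^sub>\<le>\<^sub>0" using np[of 0] by simp
  have eq: "ln_moment 1 = (\<lambda>z. Gamma z * Digamma z) \<circ> (\<lambda>t. 1 + \<i> * of_real t)"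
    using ln_moment_1 dG[OF np] by (auto simp: fun_eq_iff)
  have "((\<lambda>z::complex. Gamma z * Digamma z) has_field_derivative
          Gamma 1 * Digamma 1 * Digamma 1 + Polygamma 1 1 * Gamma 1) (at 1)"
    using np1 by (auto intro!: derivative_eq_intros)
  hence "(((\<lambda>z. Gamma z * Digamma z) \<circ> (\<lambda>t. 1 + \<i> * of_real t)) has_vector_derivative
      \<i> * (Gamma 1 * Digamma 1 * Digamma 1 + Polygamma 1 1 * Gamma 1)) (at 0)"
    by (intro field_vector_diff_chain_at) (auto intro!: derivative_eq_intros)
  hence "(ln_moment 1 has_vector_derivative
      \<i> * (Gamma 1 * Digamma 1 * Digamma 1 + Polygamma 1 1 * Gamma 1)) (at 0)"
    by (simp only: eq)
  from ln_moment_Suc[OF this] show ?thesis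
    by (simp add: numeral_2_eq_2[symmetric] Polygamma_1_1_complex power2_eq_square del: One_nat_def)
qed

lemma expectation_ln: "(LINT y|std_exp. ln y) = - euler_mascheroni"
proof -
  have "complex_of_real (LINT y|std_exp. ln y) = ln_moment 1 0"
    by (simp add: ln_moment_def)
  also have "\<dots> = of_real (- euler_mascheroni)"
    using has_field_derivative_Gamma[of "1::complex"] by (simp add: ln_moment_1 DERIV_imp_deriv del: One_nat_def)
  finally show ?thesis by (simp only: of_real_eq_iff)
qed

lemma expectation_ln_square: "(LINT y|std_exp. (ln y)\<^sup>2) = euler_mascheroni\<^sup>2 + pi\<^sup>2 / 6"
proof -
  have "complex_of_real (LINT y|std_exp. (ln y)\<^sup>2) = ln_moment 2 0"
    by (simp add: ln_moment_def flip: of_real_power)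
  thus ?thesis by (simp only: ln_moment_2_0 of_real_eq_iff)
qed

lemma std_exp_tail:
  assumes "t \<ge> 0"
  shows "std_exp.prob {y. y < t} = 1 - exp (- t)"
    and "std_exp.prob {y. y \<ge> t} = exp (- t)"
proof -
  show 2: "std_exp.prob {y. y \<ge> t} = exp (- t)"
  proof -
    have D: "distributed std_exp lborel (\<lambda>x. x) (exponential_density 1)"
      unfolding distributed_def std_exp_def
      by (auto simp: exponential_density_def[abs_def] intro!: measure_eqI) (subst emeasure_distr, auto)
    have "std_exp.prob {y. y \<ge> t} = std_exp.prob {y \<in> space std_exp. t < y}"
    proof (rule std_exp.finite_measure_eq_AE)
      have "AE y in lborel. y \<noteq> t" by (rule AE_lborel_singleton)
      hence "AE y in std_exp. y \<noteq> t"
        unfolding std_exp_def by (subst AE_density) auto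
      thus "AE y in std_exp. (y \<in> {y. y \<ge> t}) = (y \<in> {y \<in> space std_exp. t < y})"
        by eventually_elim auto
    qed auto
    also have "\<dots> = exp (- t)"
      using std_exp.exponential_distributedD_gt[OF D assms] by simp
    finally show ?thesis .
  qed
  have "{y. y < t} = space std_exp - {y. y \<ge> t}" by auto
  thus "std_exp.prob {y. y < t} = 1 - exp (- t)"
    using 2 by (simp only: std_exp.prob_compl sets_std_exp) (subst std_exp.prob_compl, auto)
qed

text \<open>The modulus of \<open>y powr (z - 1)\<close> depends on \<open>Re z\<close> only, so the
  triangle inequality in Euler's integral suffices.\<close>

lemma norm_Gamma_le:
  assumes "Re z > 0"
  shows "norm (Gamma z) \<le> Gamma (Re z)"
proof -
  have "norm (Gamma z) \<le> (LINT y|std_exp. norm (complex_of_real y powr (z - 1)))"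
    by (subst std_exp_powr(2)[OF assms, symmetric]) (rule integral_norm_bound)
  also have "(LINT y|std_exp. norm (complex_of_real y powr (z - 1))) = Gamma (Re z)" (is "?l = _")
  proof -
    have "complex_of_real ?l = (LINT y|std_exp. complex_of_real y powr (of_real (Re z) - 1))"
      by (subst integral_complex_of_real[symmetric], intro integral_cong_AE)
         (use AE_std_exp_pos in \<open>auto elim!: eventually_mono simp: norm_powr_real_powr powr_of_real[symmetric]\<close>)
    also have "\<dots> = of_real (Gamma (Re z))"
      using assms by (subst std_exp_powr(2)) (auto simp: Gamma_complex_of_real)
    finally show ?thesis by (simp only: of_real_eq_iff)
  qed
  finally show ?thesis .
qed

section \<open>Fourier series of the sawtooth\<close>

text \<open>At integers the value is \<open>- 1 / 2\<close>, whereas the sine series gives 0 there.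
  Statements about the series of \<open>saw\<close> therefore exclude integers; the series of the
  square holds everywhere.\<close>

definition saw :: "real \<Rightarrow> real" where
  "saw v = of_int \<lceil>v\<rceil> - v - 1 / 2"

text \<open>
  The Abel means of the Fourier series of \<open>saw\<close>, in closed form. The closed form shows that they
  are bounded uniformly in \<open>r\<close>, which the partial sums of the series do not reveal as easily.
\<close>

definition abel_saw :: "real \<Rightarrow> real \<Rightarrow> real" where
  "abel_saw r v = - Im (Ln (1 - of_real r * cis (2 * pi * v))) / pi"

lemma measurable_saw [measurable]: "saw \<in> borel_measurable borel"
  unfolding saw_def[abs_def] by measurable

lemma abs_saw_le: "\<bar>saw v\<bar> \<le> 1 / 2"
  unfolding saw_def by linarith

text \<open>Imaginary part of the power series of \<open>- Ln (1 - w)\<close> at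
  \<open>w = r * cis (2 * pi * v)\<close>.\<close>

lemma abel_saw_sums:
  assumes "0 \<le> r" "r < 1"
  shows "(\<lambda>n. r ^ Suc n * sin (2 * pi * real (Suc n) * v) / (pi * real (Suc n))) sums abel_saw r v"
proof -
  define w where "w = of_real r * cis (2 * pi * v)"
  have "norm (- w) < 1" using assms by (simp add: w_def norm_mult)
  from Ln_series'[OF this] have "(\<lambda>n. - (w ^ n) / of_nat n) sums Ln (1 - w)" by simp
  hence "(\<lambda>n. - (w ^ Suc n) / of_nat (Suc n)) sums Ln (1 - w)"
    by (subst sums_Suc_iff) simp
  hence "(\<lambda>n. - Im (- (w ^ Suc n) / of_nat (Suc n)) / pi) sums (- Im (Ln (1 - w)) / pi)"
    by (intro sums_divide sums_minus sums_Im)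
  moreover have "- Im (- (w ^ Suc n) / of_nat (Suc n)) / pi
      = r ^ Suc n * sin (2 * pi * real (Suc n) * v) / (pi * real (Suc n))" for n
  proof -
    have "w ^ Suc n = of_real (r ^ Suc n) * cis (2 * pi * real (Suc n) * v)"
      unfolding w_def power_mult_distrib Complex.DeMoivre by (simp add: mult_ac)
    hence "Im (- (w ^ Suc n) / of_nat (Suc n)) = - (r ^ Suc n * sin (2 * pi * real (Suc n) * v)) / real (Suc n)"
      by (simp only: Im_divide_of_nat) simp
    thus ?thesis by simp
  qed
  ultimately show ?thesis by (simp only: abel_saw_def w_def)
qed

text \<open>The argument of the logarithm has positive real part, so its angle is less than
  \<open>pi / 2\<close> in modulus, whatever \<open>r\<close> is.\<close>

lemma abs_abel_saw_le:
  assumes "0 \<le> r" "r < 1"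
  shows "\<bar>abel_saw r v\<bar> \<le> 1 / 2"
proof -
  let ?z = "1 - of_real r * cis (2 * pi * v)"
  have "r * cos (2 * pi * v) \<le> r * 1" using assms by (intro mult_left_mono) auto
  hence "Re ?z > 0" using assms by simp
  moreover from this have "?z \<noteq> 0" by (metis less_irrefl zero_complex.sel(1))
  ultimately have "\<bar>Im (Ln ?z)\<bar> < pi / 2" by (subst Re_Ln_pos_lt)
  thus ?thesis by (simp add: abel_saw_def field_simps)
qed

text \<open>With \<open>p = pi * frac v\<close>, the number \<open>1 - cis (2 * p)\<close> has
  modulus \<open>2 * sin p\<close> and angle \<open>p - pi / 2\<close>. As \<open>p\<close> lies
  between 0 and \<open>pi\<close>, this angle is the principal one.\<close>

lemma abel_saw_1:
  assumes "v \<notin> \<int>"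
  shows "abel_saw 1 v = saw v"
proof -
  define f where "f = frac v"
  have f: "0 < f" "f < 1" using assms by (auto simp: f_def frac_lt_1)
  have v: "v = f + of_int \<lfloor>v\<rfloor>" by (simp add: f_def frac_def)
  have "cis (2 * pi * v) = cis (2 * pi * f)"
    by (subst v) (simp add: distrib_left cis_mult[symmetric] mult.assoc[symmetric])
  moreover have "Ln (1 - cis (2 * pi * f)) = Complex (ln (2 * sin (pi * f))) (pi * f - pi / 2)"
  proof (rule Ln_unique)
    have s: "sin (pi * f) > 0" using f by (intro sin_gt_zero) auto
    have "exp (Complex (ln (2 * sin (pi * f))) (pi * f - pi / 2))
        = of_real (2 * sin (pi * f)) * cis (pi * f - pi / 2)"
      using s by (simp add: exp_eq_polar)
    also have "\<dots> = 1 - cis (2 * pi * f)"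
      using cos_double[of "pi * f"] sin_double[of "pi * f"] sin_cos_squared_add[of "pi * f"]
      by (simp add: complex_eq_iff cos_diff sin_diff power2_eq_square mult_ac)
    finally show "exp (Complex (ln (2 * sin (pi * f))) (pi * f - pi / 2)) = 1 - cis (2 * pi * f)" .
    have "pi * f > 0" using f by simp
    thus "- pi < Im (Complex (ln (2 * sin (pi * f))) (pi * f - pi / 2))"
      unfolding complex.sel using pi_gt_zero by linarith
    have "pi * f < pi" using f by simp
    thus "Im (Complex (ln (2 * sin (pi * f))) (pi * f - pi / 2)) \<le> pi"
      unfolding complex.sel using pi_gt_zero by linarith
  qed
  ultimately have "abel_saw 1 v = 1 / 2 - f"
    by (simp add: abel_saw_def field_simps)
  moreover have "\<lceil>v\<rceil> = \<lfloor>v\<rfloor> + 1" using assms by (simp add: ceiling_altdef Ints_def) (metis of_int_eq_iff rangeI)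
  ultimately show ?thesis by (simp add: saw_def f_def frac_def)
qed

lemma tendsto_abel_saw:
  assumes "v \<notin> \<int>" "r \<longlonglongrightarrow> 1"
  shows "(\<lambda>n. abel_saw (r n) v) \<longlonglongrightarrow> saw v"
proof -
  have "1 - cis (2 * pi * v) \<notin> \<real>\<^sub>\<le>\<^sub>0"
  proof
    assume "1 - cis (2 * pi * v) \<in> \<real>\<^sub>\<le>\<^sub>0"
    hence "cos (2 * pi * v) = 1"
      by (auto simp: complex_nonpos_Reals_iff intro!: antisym)
    then obtain n :: int where "2 * pi * v = of_int n * (2 * pi)"
      by (subst (asm) cos_one_2pi_int) auto
    hence "v = of_int n" by simp
    with assms show False by simp
  qed
  hence "(\<lambda>n. abel_saw (r n) v) \<longlonglongrightarrow> abel_saw 1 v"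
    unfolding abel_saw_def using assms(2) by (intro tendsto_intros) (auto intro!: tendsto_eq_intros)
  thus ?thesis by (simp only: abel_saw_1[OF assms(1)])
qed

text \<open>Abel summation under the integral. For \<open>r < 1\<close> a geometric majorant allows
  integrating term by term. As \<open>r\<close> tends to 1, the integral converges by dominated
  convergence, thanks to the uniform bound \<open>1 / 2\<close>, and the series by Tannery's
  theorem, with \<open>summ\<close> as majorant.\<close>

theorem saw_Fourier_integral:
  fixes g V :: "'a \<Rightarrow> real"
  assumes g: "integrable M g" and V [measurable]: "V \<in> borel_measurable M"
    and nint: "AE x in M. V x \<notin> \<int>"
  defines "c \<equiv> (\<lambda>n. LINT x|M. of_real (g x) * cis (2 * pi * real n * V x))"
  assumes summ: "summable (\<lambda>n. norm (c (Suc n)) / real (Suc n))"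
  shows "(\<lambda>n. Im (c (Suc n)) / (pi * real (Suc n))) sums (LINT x|M. g x * saw (V x))"
proof -
  have gm [measurable]: "g \<in> borel_measurable M" using g by auto
  have mcis [measurable]: "(\<lambda>x. cis (t * V x)) \<in> borel_measurable M" for t
    unfolding cis_conv_exp by measurable
  have ic: "integrable M (\<lambda>x. of_real (g x) * cis (t * V x))" for t
    by (rule Bochner_Integration.integrable_bound[OF g]) (auto simp: norm_mult)
  have Imc: "Im (c n) = (LINT x|M. g x * sin (2 * pi * real n * V x))" for n
    unfolding c_def using ic by (subst integral_Im[symmetric]) auto
  have isin: "integrable M (\<lambda>x. g x * sin (2 * pi * real n * V x))" for n
    by (rule Bochner_Integration.integrable_bound[OF g]) (auto simp: abs_mult intro!: AE_I2 mult_left_le)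
  define r where "r j = 1 - 1 / real (Suc j)" for j
  have r: "0 \<le> r j" "r j < 1" for j by (auto simp: r_def)
  have r1: "r \<longlonglongrightarrow> 1"
    unfolding r_def by (rule LIMSEQ_Suc[of "\<lambda>j. 1 - 1 / real j"]) (auto intro!: tendsto_eq_intros lim_1_over_n)
  have ser: "(LINT x|M. g x * abel_saw (r j) (V x)) = suminf (\<lambda>n. r j ^ Suc n * (Im (c (Suc n)) / (pi * real (Suc n))))" for j
  proof -
    let ?f = "\<lambda>n x. g x * (r j ^ Suc n * sin (2 * pi * real (Suc n) * V x) / (pi * real (Suc n)))"
    have eqf: "?f n x = (r j ^ Suc n / (pi * real (Suc n))) * (g x * sin (2 * pi * real (Suc n) * V x))" for n x
      by simp
    have le: "norm (?f n x) \<le> r j ^ Suc n * \<bar>g x\<bar>" for n x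
    proof -
      have "1 * 1 \<le> pi * real (Suc n)"
        using pi_gt3 by (intro mult_mono) auto
      hence "\<bar>sin (2 * pi * real (Suc n) * V x)\<bar> \<le> pi * real (Suc n)"
        using abs_sin_le_one[of "2 * pi * real (Suc n) * V x"] by linarith
      hence "\<bar>sin (2 * pi * real (Suc n) * V x)\<bar> / (pi * real (Suc n)) \<le> 1"
        by (simp add: divide_le_eq)
      hence "(r j ^ Suc n * \<bar>g x\<bar>) * (\<bar>sin (2 * pi * real (Suc n) * V x)\<bar> / (pi * real (Suc n))) \<le> r j ^ Suc n * \<bar>g x\<bar>"
        using r[of j] by (intro mult_left_le) auto
      thus ?thesis using r[of j] by (simp add: abs_mult mult_ac)
    qed
    have geo: "summable (\<lambda>n. r j ^ Suc n * y)" for y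
      using r[of j] by (intro summable_mult2) (simp add: summable_geometric summable_mult)
    have i_f: "integrable M (?f n)" for n
      unfolding eqf using isin by (intro integrable_mult_right)
    have "(LINT x|M. suminf (\<lambda>n. ?f n x)) = suminf (\<lambda>n. LINT x|M. ?f n x)"
    proof (rule integral_suminf)
      show "integrable M (?f n)" for n by (rule i_f)
      show "AE x in M. summable (\<lambda>n. norm (?f n x))"
        using le by (intro AE_I2 summable_comparison_test'[OF geo, of 0]) auto
      show "summable (\<lambda>n. LINT x|M. norm (?f n x))"
      proof (rule summable_comparison_test'[OF geo, of 0])
        fix n
        have "(LINT x|M. norm (?f n x)) \<le> (LINT x|M. r j ^ Suc n * \<bar>g x\<bar>)"
          by (rule integral_mono[OF integrable_norm[OF i_f] integrable_mult_right[OF integrable_abs[OF g]] le])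
        thus "norm (LINT x|M. norm (?f n x)) \<le> r j ^ Suc n * (LINT x|M. \<bar>g x\<bar>)" by simp
      qed
    qed
    moreover have "suminf (\<lambda>n. ?f n x) = g x * abel_saw (r j) (V x)" for x
      using sums_mult[OF abel_saw_sums[OF r]] by (rule sums_unique[symmetric])
    moreover have "(LINT x|M. ?f n x) = r j ^ Suc n * (Im (c (Suc n)) / (pi * real (Suc n)))" for n
      unfolding eqf by (simp add: Imc del: of_nat_Suc)
    ultimately show ?thesis by simp
  qed
  have lim1: "(\<lambda>j. LINT x|M. g x * abel_saw (r j) (V x)) \<longlonglongrightarrow> (LINT x|M. g x * saw (V x))"
  proof (rule integral_dominated_convergence[where w = "\<lambda>x. \<bar>g x\<bar>"])
    show "AE x in M. (\<lambda>j. g x * abel_saw (r j) (V x)) \<longlonglongrightarrow> g x * saw (V x)"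
      using nint by eventually_elim (intro tendsto_intros tendsto_abel_saw r1)
    show "AE x in M. norm (g x * abel_saw (r j) (V x)) \<le> \<bar>g x\<bar>" for j
      using abs_abel_saw_le[OF r] by (intro AE_I2) (auto simp: abs_mult intro!: mult_left_le order_trans[OF abs_abel_saw_le[OF r]])
    show "(\<lambda>x. g x * abel_saw (r j) (V x)) \<in> borel_measurable M" for j
      unfolding abel_saw_def by measurable
  qed (use g in auto)
  let ?d = "\<lambda>n. Im (c (Suc n)) / (pi * real (Suc n))"
  have dle: "norm (?d n) \<le> norm (c (Suc n)) / real (Suc n)" for n
  proof -
    have "\<bar>Im (c (Suc n))\<bar> / (pi * real (Suc n)) \<le> norm (c (Suc n)) / (1 * real (Suc n))"
      using pi_gt3 by (intro frac_le abs_Im_le_cmod mult_right_mono) auto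
    thus ?thesis by simp
  qed
  have "(\<lambda>j. suminf (\<lambda>n. r j ^ Suc n * ?d n)) \<longlonglongrightarrow> suminf ?d"
  proof (rule tannerys_theorem[THEN conjunct2, THEN conjunct2])
    show "(\<lambda>j. r j ^ Suc k * ?d k) \<longlonglongrightarrow> ?d k" for k
      using r1 by (auto intro!: tendsto_eq_intros)
    show "\<forall>\<^sub>F (k, j) in at_top \<times>\<^sub>F sequentially. norm (r j ^ Suc k * ?d k) \<le> norm (c (Suc k)) / real (Suc k)"
    proof (intro always_eventually, clarify)
      fix k j
      have "norm (r j ^ Suc k * ?d k) \<le> norm (?d k)"
        unfolding norm_mult using r[of j] by (intro mult_left_le_one_le) (auto intro!: power_le_one mult_le_one)
      with dle[of k] show "norm (r j ^ Suc k * ?d k) \<le> norm (c (Suc k)) / real (Suc k)" by linarith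
    qed
  qed (use summ in auto)
  with lim1 have "suminf ?d = (LINT x|M. g x * saw (V x))"
    unfolding ser by (rule LIMSEQ_unique[rotated])
  moreover have "summable ?d"
    by (rule summable_comparison_test'[OF summ, of 0]) (use dle in auto)
  ultimately show ?thesis by (simp add: sums_iff)
qed

text \<open>On \<open>[0, 1]\<close> the square of \<open>saw\<close> is \<open>1/4 - 2 \<integral>\<^sub>0\<^sup>v saw\<close>, and the integral can be expanded term by term.\<close>

lemma saw_square_sums:
  "(\<lambda>n. cos (2 * pi * real (Suc n) * v) / (pi\<^sup>2 * real (Suc n) ^ 2)) sums ((saw v)\<^sup>2 - 1 / 12)"
proof -
  \<comment> \<open>One period first, where the square of \<open>saw\<close> is that of
    \<open>1 / 2 - v\<close>. The general case follows because both sides have period 1.\<close>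
  have main: "(\<lambda>n. cos (2 * pi * real (Suc n) * v) / (pi\<^sup>2 * real (Suc n) ^ 2)) sums (v\<^sup>2 - v + 1 / 6)"
    if v: "0 \<le> v" "v \<le> 1" for v :: real
  proof -
    \<comment> \<open>On this measure, \<open>saw_Fourier_integral\<close> with the constant weight
      1 integrates the sine series of \<open>saw\<close> from 0 to \<open>v\<close>.\<close>
    define M where "M = restrict_space lborel {0..v}"
    have Mint: "(LINT x|M. f x) = integral {0..v} f" "integrable M f" if "continuous_on {0..v} f" for f :: "real \<Rightarrow> 'b::euclidean_space"
    proof -
      have "set_integrable lborel {0..v} f" using that by (rule borel_integrable_atLeastAtMost')
      thus "(LINT x|M. f x) = integral {0..v} f" "integrable M f"
        unfolding M_def
        by (auto simp: integral_restrict_space integrable_restrict_space set_borel_integral_eq_integral(2)[symmetric] set_lebesgue_integral_def set_integrable_def)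
    qed
    have c: "(LINT x|M. of_real 1 * cis (2 * pi * real (Suc n) * x))
        = (cis (2 * pi * real (Suc n) * v) - 1) / (2 * pi * real (Suc n) * \<i>)" for n
    proof -
      have "((\<lambda>x. cis (2 * pi * real (Suc n) * x)) has_integral
          (cis (2 * pi * real (Suc n) * v) / (2 * pi * real (Suc n) * \<i>) - cis (2 * pi * real (Suc n) * 0) / (2 * pi * real (Suc n) * \<i>))) {0..v}"
        using v by (intro fundamental_theorem_of_calculus)
           (auto simp: cis_conv_exp field_simps intro!: derivative_eq_intros has_vector_derivative_real_field simp del: of_nat_Suc)
      hence "integral {0..v} (\<lambda>x. cis (2 * pi * real (Suc n) * x)) = (cis (2 * pi * real (Suc n) * v) - 1) / (2 * pi * real (Suc n) * \<i>)"
        by (simp add: integral_unique diff_divide_distrib del: of_nat_Suc)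
      thus ?thesis by (subst Mint) (auto simp: cis_conv_exp intro!: continuous_intros simp del: of_nat_Suc)
    qed
    have "(\<lambda>n. Im (LINT x|M. of_real 1 * cis (2 * pi * real (Suc n) * x)) / (pi * real (Suc n))) sums (LINT x|M. 1 * saw x)"
    proof (rule saw_Fourier_integral)
      show "integrable M (\<lambda>x. 1::real)" by (rule Mint) auto
      show "(\<lambda>x. x) \<in> borel_measurable M"
        unfolding M_def by (rule measurable_restrict_space1) simp
      have "AE x in lborel. x \<notin> (\<int>::real set)"
        by (rule AE_not_in) (auto intro!: countable_imp_null_set_lborel countable_int)
      thus "AE x in M. x \<notin> \<int>"
        unfolding M_def by (subst AE_restrict_space_iff) auto
      show "summable (\<lambda>n. norm (LINT x|M. of_real 1 * cis (2 * pi * real (Suc n) * x)) / real (Suc n))"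
      proof (rule summable_comparison_test'[of "\<lambda>n. 1 / real (Suc n) ^ 2" 0])
        show "summable (\<lambda>n. 1 / real (Suc n) ^ 2)" using inverse_squares_sums by (auto simp: sums_iff add.commute)
        fix n
        have "norm (cis (2 * pi * real (Suc n) * v) - 1) \<le> 2"
          using norm_triangle_ineq4[of "cis (2 * pi * real (Suc n) * v)" 1] by simp
        moreover have "norm (2 * pi * real (Suc n) * \<i>) = 2 * pi * real (Suc n)"
          by (simp add: norm_mult del: of_nat_Suc)
        ultimately have "norm ((cis (2 * pi * real (Suc n) * v) - 1) / (2 * pi * real (Suc n) * \<i>)) / real (Suc n)
             \<le> 2 / (2 * 1 * real (Suc n)) / real (Suc n)" (is "?lhs \<le> _")
          using pi_gt3 unfolding norm_divide by (intro divide_right_mono frac_le) (auto intro!: mult_right_mono simp del: of_nat_Suc)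
        also have "\<dots> = 1 / real (Suc n) ^ 2"
          by (simp add: power2_eq_square del: of_nat_Suc)
        finally show "norm (norm (LINT x|M. of_real 1 * cis (2 * pi * real (Suc n) * x)) / real (Suc n)) \<le> 1 / real (Suc n) ^ 2"
          unfolding c by (simp del: of_nat_Suc)
      qed
    qed
    moreover have "(LINT x|M. 1 * saw x) = (v - v\<^sup>2) / 2"
    proof -
      have "(LINT x|M. 1 * saw x) = (LINT x|M. 1 / 2 - x)"
      proof (rule integral_cong_AE)
        have "AE x in lborel. x \<in> {0..v} \<longrightarrow> saw x = 1 / 2 - x"
          using AE_lborel_singleton[of "0::real"]
        proof eventually_elim
          case (elim x)
          show ?case
          proof
            assume "x \<in> {0..v}"
            hence "0 < x" "x \<le> 1" using elim v(2) by (auto simp: less_le)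
            hence "\<lceil>x\<rceil> = 1" by (simp add: ceiling_eq_iff)
            thus "saw x = 1 / 2 - x" by (simp add: saw_def)
          qed
        qed
        thus "AE x in M. 1 * saw x = 1 / 2 - x"
          unfolding M_def by (subst AE_restrict_space_iff) auto
      qed (auto simp: M_def intro!: measurable_restrict_space1)
      also have "\<dots> = integral {0..v} (\<lambda>x. 1 / 2 - x)" by (intro Mint continuous_intros)
      also have "integral {0..v} (\<lambda>x. 1 / 2 - x) = (v / 2 - v\<^sup>2 / 2) - (0 / 2 - 0\<^sup>2 / 2)"
        using v by (intro integral_unique fundamental_theorem_of_calculus)
          (auto intro!: derivative_eq_intros simp: has_real_derivative_iff_has_vector_derivative[symmetric])
      also have "\<dots> = (v - v\<^sup>2) / 2" by (simp add: diff_divide_distrib)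
      finally show ?thesis .
    qed
    moreover have "Im (LINT x|M. of_real 1 * cis (2 * pi * real (Suc n) * x)) / (pi * real (Suc n))
        = (1 - cos (2 * pi * real (Suc n) * v)) / (2 * pi\<^sup>2 * real (Suc n) ^ 2)" for n
      unfolding c by (simp add: Im_divide power2_eq_square field_simps del: of_nat_Suc)
    moreover have e1: "2 * (x / (2 * p * q)) = x / (p * q)" and e2: "2 * (x / 2) = x" for x p q :: real
      by simp_all
    ultimately have "(\<lambda>n. (1 - cos (2 * pi * real (Suc n) * v)) / (2 * pi\<^sup>2 * real (Suc n) ^ 2)) sums ((v - v\<^sup>2) / 2)"
      by (simp only:)
    from sums_mult[OF this, of 2]
    have 1: "(\<lambda>n. (1 - cos (2 * pi * real (Suc n) * v)) / (pi\<^sup>2 * real (Suc n) ^ 2)) sums (v - v\<^sup>2)"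
      by (simp only: e1 e2)
    \<comment> \<open>The integrated series has terms with \<open>1 - cos\<close> in the numerator.
      Subtracting it from this constant part leaves the cosines, and this is the origin of the
      constant \<open>1 / 6\<close>.\<close>
    have 2: "(\<lambda>n. 1 / (pi\<^sup>2 * real (Suc n) ^ 2)) sums (1 / 6)"
      using sums_divide[OF inverse_squares_sums, of "pi\<^sup>2"] by (simp add: mult.commute)
    have "1 / x - (1 - c) / x = c / x" "1 / 6 - (v - v\<^sup>2) = v\<^sup>2 - v + 1 / 6" for x c :: real
      by (simp_all add: diff_divide_distrib)
    with sums_diff[OF 2 1] show ?thesis
      by (simp only:)
  qed
  define f where "f = frac v"
  have f: "0 \<le> f" "f \<le> 1" by (auto simp: f_def less_imp_le frac_lt_1)
  have v: "v = f + of_int \<lfloor>v\<rfloor>" by (simp add: f_def frac_def)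
  have "cos (2 * pi * real (Suc n) * v) = cos (2 * pi * real (Suc n) * f)" for n
  proof -
    have "2 * pi * real (Suc n) * v = 2 * pi * real (Suc n) * f + 2 * pi * of_int (int (Suc n) * \<lfloor>v\<rfloor>)"
      by (subst v) (simp add: algebra_simps)
    thus ?thesis by (simp only: cos_add cos_int_2pin sin_int_2pin)
  qed
  moreover have "(saw v)\<^sup>2 - 1 / 12 = f\<^sup>2 - f + 1 / 6"
  proof (cases "v \<in> \<int>")
    case True
    hence "f = 0" by (simp add: f_def)
    moreover from True have "saw v = - 1/2" by (auto elim!: Ints_cases simp: saw_def)
    ultimately show ?thesis by (simp add: power2_eq_square)
  next
    case False
    hence "\<lceil>v\<rceil> = \<lfloor>v\<rfloor> + 1" by (simp add: ceiling_altdef Ints_def) (metis of_int_eq_iff rangeI)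
    hence sv: "saw v = 1 / 2 - f" by (simp add: saw_def f_def frac_def)
    show ?thesis unfolding sv by (simp add: power2_eq_square algebra_simps)
  qed
  ultimately show ?thesis using main[OF f] by (simp only:)
qed

section \<open>Gamma on the imaginary axis and Fourier series over the nonzero integers\<close>

lemma Im_nonzero_imp_not_nonpos_Int: "Im z \<noteq> 0 \<Longrightarrow> z \<notin> \<int>\<^sub>\<le>\<^sub>0"
  by (auto elim!: nonpos_Ints_cases)

lemma Gamma_1_plus: "z \<notin> \<int>\<^sub>\<le>\<^sub>0 \<Longrightarrow> Gamma (1 + z) = z * Gamma (z :: complex)"
  by (subst add.commute) (rule Gamma_plus1)

text \<open>
  \<open>\<Gamma>\<close> decays exponentially along the imaginary axis, but quadratic decay is enough here, and it
  follows from \<open>\<Gamma>(z) = \<Gamma>(z + 2) / (z (z + 1))\<close>.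
\<close>

lemma Gamma_imaginary_axis_bound:
  assumes t0: "t0 > (0::real)"
  shows "\<exists>C>0. \<forall>t. \<bar>t\<bar> \<ge> t0 \<longrightarrow> norm (Gamma (\<i> * of_real t)) \<le> C / t\<^sup>2 \<and>
            norm (deriv Gamma (\<i> * of_real t)) \<le> C / t\<^sup>2"
proof -
  \<comment> \<open>Radius of the discs for Cauchy's inequality: \<open>e \<le> 1 / 2\<close> keeps
    \<open>Re (z + 2)\<close> between \<open>3 / 2\<close> and \<open>5 / 2\<close>, where the real
    Gamma function is bounded by \<open>K\<close> below, and \<open>e \<le> t0 / 2\<close> keeps
    \<open>\<bar>Im z\<bar>\<close> at least \<open>\<bar>t\<bar> / 2\<close>.\<close>
  define e where "e = min (1 / 2) (t0 / 2)"
  have e: "e > 0" "e \<le> 1 / 2" "e \<le> t0 / 2" using t0 by (auto simp: e_def)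
  have "compact {3/2..5/2::real}" "continuous_on {3/2..5/2::real} Gamma"
    by (auto intro!: continuous_on_Gamma elim!: nonpos_Ints_cases)
  then obtain x0 where x0: "\<And>x. x \<in> {3/2..5/2::real} \<Longrightarrow> Gamma x \<le> Gamma x0"
    using continuous_attains_sup[of "{3/2..5/2::real}" Gamma] by (metis atLeastAtMost_iff empty_iff le_numeral_extra(4) order.refl divide_right_mono numeral_le_iff semiring_norm(71) zero_le_numeral)
  define K where "K = max 1 (Gamma x0)"
  have K: "K > 0" "\<And>x. x \<in> {3/2..5/2} \<Longrightarrow> Gamma x \<le> K"
    using x0 by (auto simp: K_def intro: max.coboundedI2)
  have bound: "norm (Gamma z) \<le> 4 * K / t\<^sup>2" and np: "z \<notin> \<int>\<^sub>\<le>\<^sub>0"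
    if t: "\<bar>t\<bar> \<ge> t0" and z: "z \<in> cball (\<i> * of_real t) e" for t z
  proof -
    have d: "norm (z - \<i> * of_real t) \<le> e" using z by (simp add: dist_norm norm_minus_commute)
    have re: "\<bar>Re z\<bar> \<le> 1 / 2" using abs_Re_le_cmod[of "z - \<i> * of_real t"] d e by simp
    have "\<bar>Im z - t\<bar> \<le> e" using abs_Im_le_cmod[of "z - \<i> * of_real t"] d by simp
    hence im: "\<bar>Im z\<bar> \<ge> \<bar>t\<bar> / 2" using e t by linarith
    have tpos: "\<bar>t\<bar> > 0" using t t0 by linarith
    have "Im z \<noteq> 0" "Im (z + 1) \<noteq> 0" using im tpos by auto
    hence nz: "z \<notin> \<int>\<^sub>\<le>\<^sub>0" "z + 1 \<notin> \<int>\<^sub>\<le>\<^sub>0" by (simp_all only: Im_nonzero_imp_not_nonpos_Int not_False_eq_True)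
    show "z \<notin> \<int>\<^sub>\<le>\<^sub>0" by (rule nz)
    have n: "norm z \<ge> \<bar>t\<bar> / 2" "norm (z + 1) \<ge> \<bar>t\<bar> / 2"
      using im abs_Im_le_cmod[of z] abs_Im_le_cmod[of "z + 1"] by simp_all
    have "Gamma (z + 1 + 1) = (z + 1) * Gamma (z + 1)" by (rule Gamma_plus1[OF nz(2)])
    moreover have "Gamma (z + 1) = z * Gamma z" by (rule Gamma_plus1[OF nz(1)])
    moreover have "z + 1 + 1 = z + 2" by simp
    ultimately have eq: "norm (Gamma (z + 2)) = norm (z + 1) * (norm z * norm (Gamma z))"
      by (simp only: norm_mult)
    have "norm (Gamma (z + 2)) \<le> Gamma (Re (z + 2))" using re by (intro norm_Gamma_le) auto
    also have "\<dots> \<le> K" using re by (intro K) auto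
    finally have "norm (z + 1) * (norm z * norm (Gamma z)) \<le> K" by (simp only: eq)
    moreover have "(\<bar>t\<bar> / 2) * ((\<bar>t\<bar> / 2) * norm (Gamma z)) \<le> norm (z + 1) * (norm z * norm (Gamma z))"
      using n by (intro mult_mono mult_right_mono) auto
    ultimately have "t\<^sup>2 / 4 * norm (Gamma z) \<le> K" by (simp add: power2_eq_square)
    thus "norm (Gamma z) \<le> 4 * K / t\<^sup>2" using tpos by (simp add: field_simps)
  qed
  define C where "C = max (4 * K) (4 * K / e)"
  have "C > 0" using K by (auto simp: C_def)
  moreover have "norm (Gamma (\<i> * of_real t)) \<le> C / t\<^sup>2 \<and> norm (deriv Gamma (\<i> * of_real t)) \<le> C / t\<^sup>2"
    if t: "\<bar>t\<bar> \<ge> t0" for t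
  proof
    have "norm (Gamma (\<i> * of_real t)) \<le> 4 * K / t\<^sup>2" using e by (intro bound[OF t]) auto
    also have "\<dots> \<le> C / t\<^sup>2" by (intro divide_right_mono) (auto simp: C_def)
    finally show "norm (Gamma (\<i> * of_real t)) \<le> C / t\<^sup>2" .
    have "norm ((deriv ^^ 1) Gamma (\<i> * of_real t)) \<le> fact 1 * (4 * K / t\<^sup>2) / e ^ 1"
    proof (rule Cauchy_inequality)
      show "Gamma holomorphic_on ball (\<i> * of_real t) e"
        using np[OF t] by (intro holomorphic_Gamma) auto
      show "continuous_on (cball (\<i> * of_real t) e) Gamma"
        using np[OF t] by (intro continuous_on_Gamma) auto
    qed (use e bound[OF t] in \<open>auto simp: dist_norm\<close>)
    also have "\<dots> = (4 * K / e) / t\<^sup>2" by simp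
    also have "\<dots> \<le> C / t\<^sup>2" by (intro divide_right_mono) (auto simp: C_def)
    finally show "norm (deriv Gamma (\<i> * of_real t)) \<le> C / t\<^sup>2" by simp
  qed
  ultimately show ?thesis by blast
qed

text \<open>Quadratic decay gives absolute summability, so the unordered sum splits into positive
  and negative indices, which can then be paired.\<close>

lemma has_sum_nonzero_ints:
  fixes f :: "int \<Rightarrow> 'a :: banach"
  assumes f: "\<forall>n. n \<noteq> 0 \<longrightarrow> norm (f n) \<le> C / (of_int n)\<^sup>2"
  shows "f summable_on {n. n \<noteq> 0}"
    and "(\<lambda>n. f (int (Suc n)) + f (- int (Suc n))) sums infsum f {n. n \<noteq> 0}"
proof -
  have S: "summable (\<lambda>n. C / (real (Suc n))\<^sup>2)"
    using summable_mult[OF sums_summable[OF inverse_squares_sums], of C] by (simp add: add.commute)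
  have inj: "inj (\<lambda>n. int (Suc n))" "inj (\<lambda>n. - int (Suc n))" by (auto simp: inj_def)
  have r: "{n. n \<noteq> 0} = range (\<lambda>n. int (Suc n)) \<union> range (\<lambda>n. - int (Suc n))"
  proof (intro set_eqI iffI)
    fix n :: int assume "n \<in> {n. n \<noteq> 0}"
    hence "n = int (Suc (nat (n - 1))) \<or> n = - int (Suc (nat (- n - 1)))" by auto
    thus "n \<in> range (\<lambda>n. int (Suc n)) \<union> range (\<lambda>n. - int (Suc n))" by blast
  qed auto
  have disj: "range (\<lambda>n. int (Suc n)) \<inter> range (\<lambda>n. - int (Suc n)) = {}"
    by auto
  have n1: "summable (\<lambda>n. norm (f (int (Suc n))))"
    by (rule summable_comparison_test'[OF S, of 0]) (use f[rule_format, of "int (Suc _)"] in \<open>simp del: of_nat_Suc\<close>)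
  have n2: "summable (\<lambda>n. norm (f (- int (Suc n))))"
    by (rule summable_comparison_test'[OF S, of 0]) (use f[rule_format, of "- int (Suc _)"] in \<open>simp del: of_nat_Suc\<close>)
  note s = summable_sums[OF summable_norm_cancel[OF n1]] summable_sums[OF summable_norm_cancel[OF n2]]
  have "(f has_sum suminf (\<lambda>n. f (int (Suc n)))) (range (\<lambda>n. int (Suc n)))"
       "(f has_sum suminf (\<lambda>n. f (- int (Suc n)))) (range (\<lambda>n. - int (Suc n)))"
    using norm_summable_imp_has_sum[OF n1 s(1)] norm_summable_imp_has_sum[OF n2 s(2)]
    by (simp_all only: has_sum_reindex[OF inj(1)] has_sum_reindex[OF inj(2)] o_def)
  from has_sum_Un_disjoint[OF this disj]
  have main: "(f has_sum (suminf (\<lambda>n. f (int (Suc n))) + suminf (\<lambda>n. f (- int (Suc n))))) {n. n \<noteq> 0}"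
    by (simp only: r)
  thus "f summable_on {n. n \<noteq> 0}" by (auto simp: summable_on_def)
  have "infsum f {n. n \<noteq> 0} = suminf (\<lambda>n. f (int (Suc n))) + suminf (\<lambda>n. f (- int (Suc n)))"
    using main by (rule infsumI)
  with sums_add[OF s] show "(\<lambda>n. f (int (Suc n)) + f (- int (Suc n))) sums infsum f {n. n \<noteq> 0}"
    by (simp only:)
qed

lemma summable_on_inverse_square_ints: "(\<lambda>n::int. C / (of_int n)\<^sup>2 :: real) summable_on {n. n \<noteq> 0}"
  by (rule has_sum_nonzero_ints(1)[where C = "\<bar>C\<bar>"]) auto

lemma exp_2npii: "exp (2 * of_int n * of_real pi * \<i> * of_real x) = cis (2 * pi * of_int n * x)"
  by (simp add: cis_conv_exp mult_ac)

text \<open>Quadratic decay makes the convergence uniform, so the sum may be integrated term by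
  term, and every term with \<open>n \<noteq> 0\<close> has integral 0 over a period. Under
  conjugate symmetry the terms for \<open>n\<close> and \<open>- n\<close> combine to twice a real
  part.\<close>

lemma nonzero_Fourier_series:
  fixes A :: "int \<Rightarrow> complex"
  assumes A: "\<forall>n. n \<noteq> 0 \<longrightarrow> norm (A n) \<le> C / (of_int n)\<^sup>2"
  defines "T \<equiv> (\<lambda>x n. A n * exp (2 * of_int n * of_real pi * \<i> * of_real x))"
  shows "T x summable_on {n. n \<noteq> 0}"
    and "infsum (T (x + 1)) {n. n \<noteq> 0} = infsum (T x) {n. n \<noteq> 0}"
    and "((\<lambda>x. infsum (T x) {n. n \<noteq> 0}) has_integral 0) {0..1}"
    and "\<forall>n. n \<noteq> 0 \<longrightarrow> A (- n) = cnj (A n) \<Longrightarrow>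
      (\<lambda>n. complex_of_real (2 * Re (A (int (Suc n)) * cis (2 * pi * real (Suc n) * x)))) sums infsum (T x) {n. n \<noteq> 0}"
proof -
  have T: "T x n = A n * cis (2 * pi * of_int n * x)" for x n
    unfolding T_def exp_2npii ..
  have nT: "\<forall>n. n \<noteq> 0 \<longrightarrow> norm (T x n) \<le> C / (of_int n)\<^sup>2" for x
    using A by (simp add: T norm_mult)
  show "T x summable_on {n. n \<noteq> 0}" by (rule has_sum_nonzero_ints(1)[OF nT])
  have "T (x + 1) = T x"
  proof
    fix n
    have "cis (2 * pi * of_int n * (x + 1)) = cis (2 * pi * of_int n * x) * cis (2 * pi * of_int n)"
      by (simp only: cis_mult distrib_left mult_1_right)
    also have "cis (2 * pi * of_int n) = 1" by simp
    finally show "T (x + 1) n = T x n" by (simp add: T)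
  qed
  thus "infsum (T (x + 1)) {n. n \<noteq> 0} = infsum (T x) {n. n \<noteq> 0}" by simp
  have U: "uniform_limit {0..1} (\<lambda>X y. \<Sum>n\<in>X. T y n) (\<lambda>y. infsum (T y) {n. n \<noteq> 0}) (finite_subsets_at_top {n. n \<noteq> 0})"
    by (rule Weierstrass_m_test_general[OF _ summable_on_inverse_square_ints]) (use nT in auto)
  have cont: "continuous_on {0..1} (\<lambda>y. \<Sum>n\<in>X. T y n)" for X
    unfolding T_def by (intro continuous_intros)
  obtain I J where IJ: "\<And>X. ((\<lambda>y. \<Sum>n\<in>X. T y n) has_integral I X) {0..1}"
      "((\<lambda>y. infsum (T y) {n. n \<noteq> 0}) has_integral J) {0..1}" "(I \<longlongrightarrow> J) (finite_subsets_at_top {n. n \<noteq> 0})"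
    by (rule uniform_limit_integral[OF U cont]) auto
  have Tint: "((\<lambda>y. T y n) has_integral 0) {0..1}" if "n \<noteq> 0" for n
  proof -
    let ?c = "2 * of_int n * of_real pi * \<i> :: complex"
    have "((\<lambda>y. T y n) has_integral (A n * exp (?c * of_real 1) / ?c - A n * exp (?c * of_real 0) / ?c)) {0..1}"
      using that unfolding T_def
      by (intro fundamental_theorem_of_calculus)
         (auto intro!: derivative_eq_intros has_vector_derivative_real_field simp: mult_ac)
    also have "exp (?c * of_real 1) = 1"
      unfolding exp_2npii by simp
    finally show ?thesis by simp
  qed
  have "\<forall>\<^sub>F X in finite_subsets_at_top {n. n \<noteq> 0}. I X = 0"
  proof -
    have "\<forall>\<^sub>F X in finite_subsets_at_top {n::int. n \<noteq> 0}. finite X \<and> X \<subseteq> {n. n \<noteq> 0}"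
      by (rule eventually_finite_subsets_at_top_weakI) auto
    thus ?thesis
    proof eventually_elim
      case (elim X)
      hence "((\<lambda>y. \<Sum>n\<in>X. T y n) has_integral (\<Sum>n\<in>X. 0)) {0..1}"
        by (intro has_integral_sum Tint) auto
      with IJ(1)[of X] show ?case by (auto dest: has_integral_unique)
    qed
  qed
  hence "(I \<longlongrightarrow> 0) (finite_subsets_at_top {n. n \<noteq> 0})"
    by (rule tendsto_eventually)
  hence "J = 0" using IJ(3) by (intro tendsto_unique[OF _ IJ(3)]) auto
  thus "((\<lambda>x. infsum (T x) {n. n \<noteq> 0}) has_integral 0) {0..1}" using IJ(2) by simp
  assume cnj: "\<forall>n. n \<noteq> 0 \<longrightarrow> A (- n) = cnj (A n)"
  have "T x (int (Suc n)) + T x (- int (Suc n)) = complex_of_real (2 * Re (A (int (Suc n)) * cis (2 * pi * real (Suc n) * x)))" for n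
  proof -
    have "T x (- k) = cnj (T x k)" if "k \<noteq> 0" for k
      using cnj that unfolding T by (simp add: cis_cnj)
    from this[of "int (Suc n)"] have "T x (- int (Suc n)) = cnj (T x (int (Suc n)))" by (simp only: of_nat_eq_0_iff)
    hence "T x (int (Suc n)) + T x (- int (Suc n)) = complex_of_real (2 * Re (T x (int (Suc n))))"
      by (simp only: complex_add_cnj)
    thus ?thesis by (simp only: T of_int_of_nat_eq)
  qed
  thus "(\<lambda>n. complex_of_real (2 * Re (A (int (Suc n)) * cis (2 * pi * real (Suc n) * x)))) sums infsum (T x) {n. n \<noteq> 0}"
    using has_sum_nonzero_ints(2)[OF nT, of x] by (simp only:)
qed

text \<open>These are the solutions \<open>s\<close> of \<open>a powr s = 1\<close>.\<close>

definition Gfreq :: "real \<Rightarrow> int \<Rightarrow> complex" where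
  "Gfreq a n = - (2 * of_int n * of_real pi * \<i> / of_real (ln a))"

lemma Gfreq_eq: "Gfreq a n = \<i> * of_real (- 2 * pi * of_int n / ln a)"
  by (simp add: Gfreq_def)

lemma Gamma_Gfreq_bounds:
  assumes a: "a > 1"
  obtains C where "C > 0" "\<forall>n. n \<noteq> 0 \<longrightarrow> norm (Gamma (Gfreq a n)) \<le> C / (of_int n)\<^sup>2"
    "\<forall>n. n \<noteq> 0 \<longrightarrow> norm (deriv Gamma (Gfreq a n)) \<le> C / (of_int n)\<^sup>2"
proof -
  have la: "ln a > 0" using a by simp
  obtain C where C: "C > 0" "\<And>t. \<bar>t\<bar> \<ge> 2 * pi / ln a \<Longrightarrow>
     norm (Gamma (\<i> * of_real t)) \<le> C / t\<^sup>2 \<and> norm (deriv Gamma (\<i> * of_real t)) \<le> C / t\<^sup>2"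
    using Gamma_imaginary_axis_bound[of "2 * pi / ln a"] la by auto
  let ?C = "C * (ln a)\<^sup>2 / (2 * pi)\<^sup>2"
  have "\<bar>- 2 * pi * of_int n / ln a\<bar> \<ge> 2 * pi / ln a"
    "C / (- 2 * pi * of_int n / ln a)\<^sup>2 = ?C / (of_int n)\<^sup>2" if "n \<noteq> 0" for n :: int
  proof -
    have "1 \<le> real_of_int \<bar>n\<bar>" using that by linarith
    thus "\<bar>- 2 * pi * of_int n / ln a\<bar> \<ge> 2 * pi / ln a"
      using la by (simp add: abs_mult divide_right_mono)
    show "C / (- 2 * pi * of_int n / ln a)\<^sup>2 = ?C / (of_int n)\<^sup>2"
      using la that by (simp add: power_divide power_mult_distrib field_simps)
  qed
  with C(2)[of "- 2 * pi * of_int _ / ln a"]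
  have "norm (Gamma (Gfreq a n)) \<le> ?C / (of_int n)\<^sup>2 \<and> norm (deriv Gamma (Gfreq a n)) \<le> ?C / (of_int n)\<^sup>2" if "n \<noteq> 0" for n
    using that unfolding Gfreq_eq by metis
  thus ?thesis using C(1) la by (intro that[of ?C]) auto
qed

lemma Gfreq_uminus: "Gfreq a (- n) = cnj (Gfreq a n)"
  by (simp add: Gfreq_def)

lemma Gfreq_nonpole: "a > 1 \<Longrightarrow> n \<noteq> 0 \<Longrightarrow> Gfreq a n \<notin> \<int>\<^sub>\<le>\<^sub>0"
  by (auto simp: Gfreq_eq elim!: nonpos_Ints_cases simp: complex_eq_iff)

lemma deriv_Gamma_cnj: 
  assumes "z \<notin> \<int>\<^sub>\<le>\<^sub>0"
  shows "deriv Gamma (cnj z) = cnj (deriv Gamma z)"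
proof -
  have "(Gamma has_field_derivative deriv Gamma z) (at z)"
    using assms by (intro DERIV_deriv_iff_field_differentiable[THEN iffD2] field_differentiable_Gamma)
  hence "(cnj \<circ> Gamma \<circ> cnj has_field_derivative cnj (deriv Gamma z)) (at (cnj z))"
    by (intro has_field_derivative_cnj_cnj) auto
  moreover have "cnj \<circ> Gamma \<circ> cnj = Gamma"
    by (auto simp: fun_eq_iff cnj_Gamma)
  ultimately show ?thesis by (simp add: DERIV_imp_deriv)
qed

text \<open>The character \<open>cis (2 * pi * n * V y)\<close> is a constant times an imaginary
  power of \<open>y\<close>, with expectation \<open>Gamma (1 + s) = s * Gamma s\<close> at
  \<open>s = Gfreq a n\<close>. The factor \<open>s\<close> is proportional to \<open>n\<close> and
  cancels the \<open>1 / n\<close> of the sine series. With the extra factor \<open>ln y\<close> one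
  gets \<open>Gamma s + s * deriv Gamma s\<close> instead; the term \<open>Gamma s\<close> is
  cancelled by the series of the square of \<open>saw\<close>, and for this reason the two integrals
  appear together.\<close>

lemma saw_expectation_Psi:
  fixes a u :: real
  assumes a: "a > 1"
  defines "V \<equiv> (\<lambda>y. u - ln y / ln a)"
  shows "complex_of_real (LINT y|std_exp. saw (V y)) = Psi0 a u"
    and "complex_of_real (2 * (LINT y|std_exp. - (ln y / ln a) * saw (V y)) + (LINT y|std_exp. (saw (V y))\<^sup>2 - 1 / 12)) = Psi1 a u"
proof -
  have la: "ln a > 0" using a by simp
  have [measurable]: "V \<in> borel_measurable borel" unfolding V_def by measurable
  \<comment> \<open>\<open>V y = k\<close> holds for one positive \<open>y\<close> only, namely
    \<open>a powr (u - k)\<close>; the exceptional set is countable.\<close>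
  have nint: "AE y in std_exp. V y \<notin> \<int>"
  proof -
    have "countable ((\<lambda>k. exp (ln a * (u - of_int k))) ` (UNIV :: int set))" by simp
    hence "AE y in lborel. y \<notin> (\<lambda>k. exp (ln a * (u - of_int k))) ` (UNIV :: int set)"
      by (intro AE_not_in countable_imp_null_set_lborel)
    hence "AE y in std_exp. y \<notin> (\<lambda>k. exp (ln a * (u - of_int k))) ` (UNIV :: int set)"
      unfolding std_exp_def by (subst AE_density) auto
    with AE_std_exp_pos show ?thesis
    proof eventually_elim
      case (elim y)
      show ?case
      proof
        assume "V y \<in> \<int>"
        then obtain k where "V y = of_int k" by (auto elim: Ints_cases)
        hence "ln y = ln a * (u - of_int k)" using la by (simp add: V_def field_simps)
        hence "y = exp (ln a * (u - of_int k))" using elim by (metis exp_ln)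
        thus False using elim by blast
      qed
    qed
  qed
  define \<theta> where "\<theta> n = 2 * pi * real n / ln a" for n
  define z where "z n = Gamma (Gfreq a (int n)) * cis (2 * pi * real n * u)" for n
  define z' where "z' n = deriv Gamma (Gfreq a (int n)) * cis (2 * pi * real n * u)" for n
  have cisV: "cis (2 * pi * real n * V y) = cis (2 * pi * real n * u) * cis (- \<theta> n * ln y)" for n y
    unfolding V_def \<theta>_def cis_mult using la by (simp add: field_simps)
  have Gf: "Gfreq a (int n) = \<i> * of_real (- \<theta> n)" for n
    by (simp add: Gfreq_eq \<theta>_def)
  have \<theta>0: "\<theta> (Suc n) > 0" for n using la by (simp add: \<theta>_def)
  have n\<theta>: "norm (- \<i> * of_real (\<theta> (Suc n)) * x) = \<theta> (Suc n) * norm x"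
    "norm (\<i> * of_real (\<theta> (Suc n)) * x) = \<theta> (Suc n) * norm x" for n and x :: complex
    using \<theta>0[of n] by (simp_all add: norm_mult)
  have \<theta>S: "\<theta> (Suc n) * x / real (Suc n) = 2 * pi / ln a * x" for n x
    by (simp add: \<theta>_def del: of_nat_Suc)
  have m0: "ln_moment 0 (- \<theta> (Suc n)) = Gfreq a (int (Suc n)) * Gamma (Gfreq a (int (Suc n)))" for n
  proof -
    have "Gfreq a (int (Suc n)) \<notin> \<int>\<^sub>\<le>\<^sub>0" using Gfreq_nonpole[OF a] by simp
    thus ?thesis unfolding ln_moment_0 Gf[symmetric] by (rule Gamma_1_plus)
  qed
  have m1: "ln_moment 1 (- \<theta> (Suc n)) = Gamma (Gfreq a (int (Suc n))) + Gfreq a (int (Suc n)) * deriv Gamma (Gfreq a (int (Suc n)))" for n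
  proof -
    let ?z = "Gfreq a (int (Suc n))"
    have np: "?z \<notin> \<int>\<^sub>\<le>\<^sub>0" using Gfreq_nonpole[OF a] by simp
    have im: "Im ?z \<noteq> 0" unfolding Gf using \<theta>0[of n] by simp
    have np1: "1 + ?z \<notin> \<int>\<^sub>\<le>\<^sub>0" using im by (intro Im_nonzero_imp_not_nonpos_Int) simp
    have "(Gamma has_field_derivative deriv Gamma ?z) (at ?z)"
      using np by (intro DERIV_deriv_iff_field_differentiable[THEN iffD2] field_differentiable_Gamma)
    from DERIV_mult[OF DERIV_ident this]
    have d1: "((\<lambda>z. z * Gamma z) has_field_derivative Gamma ?z + ?z * deriv Gamma ?z) (at ?z)"
      by (simp add: mult.commute)
    have "(Gamma has_field_derivative deriv Gamma (1 + ?z)) (at (1 + ?z))"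
      using np1 by (intro DERIV_deriv_iff_field_differentiable[THEN iffD2] field_differentiable_Gamma)
    hence "((\<lambda>z. Gamma (1 + z)) has_field_derivative deriv Gamma (1 + ?z) * 1) (at ?z)"
      by (rule DERIV_chain2) (auto intro!: derivative_eq_intros)
    hence d2: "((\<lambda>z. Gamma (1 + z)) has_field_derivative deriv Gamma (1 + ?z)) (at ?z)"
      by simp
    \<comment> \<open>Comparing derivatives needs the functional equation on a whole neighbourhood;
      off the real axis it has no exceptions.\<close>
    have ev: "\<forall>\<^sub>F z in nhds ?z. Gamma (1 + z) = z * Gamma z"
    proof -
      have "open {z. Im z \<noteq> 0}" by (intro open_Collect_neq continuous_intros)
      hence "\<forall>\<^sub>F z in nhds ?z. z \<in> {z. Im z \<noteq> 0}"
        by (rule eventually_nhds_in_open) (use im in auto)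
      thus ?thesis by eventually_elim (simp add: Gamma_1_plus Im_nonzero_imp_not_nonpos_Int)
    qed
    have "((\<lambda>z. z * Gamma z) has_field_derivative deriv Gamma (1 + ?z)) (at ?z)"
      using d2 by (subst (asm) DERIV_cong_ev[OF refl ev refl])
    from DERIV_unique[OF this d1] show ?thesis
      unfolding ln_moment_1 Gf[symmetric] by simp
  qed
  have c0: "(LINT y|std_exp. of_real 1 * cis (2 * pi * real (Suc n) * V y)) = - \<i> * of_real (\<theta> (Suc n)) * z (Suc n)" for n
  proof -
    have "(LINT y|std_exp. of_real 1 * cis (2 * pi * real (Suc n) * V y)) = cis (2 * pi * real (Suc n) * u) * ln_moment 0 (- \<theta> (Suc n))"
      unfolding cisV ln_moment_def by simp
    also have "\<dots> = - \<i> * of_real (\<theta> (Suc n)) * z (Suc n)"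
      unfolding m0 z_def by (simp add: Gf mult_ac del: of_nat_Suc)
    finally show ?thesis .
  qed
  have c1: "(LINT y|std_exp. of_real (- (ln y / ln a)) * cis (2 * pi * real (Suc n) * V y)) = - (z (Suc n) - \<i> * of_real (\<theta> (Suc n)) * z' (Suc n)) / of_real (ln a)" for n
  proof -
    have "(LINT y|std_exp. of_real (- (ln y / ln a)) * cis (2 * pi * real (Suc n) * V y))
       = (LINT y|std_exp. (- cis (2 * pi * real (Suc n) * u) / of_real (ln a)) * (of_real (ln y ^ 1) * cis (- \<theta> (Suc n) * ln y)))"
      unfolding cisV by (simp add: mult_ac)
    also have "\<dots> = - cis (2 * pi * real (Suc n) * u) / of_real (ln a) * ln_moment 1 (- \<theta> (Suc n))"
      unfolding ln_moment_def by (rule integral_mult_right_zero)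
    also have "\<dots> = - (z (Suc n) - \<i> * of_real (\<theta> (Suc n)) * z' (Suc n)) / of_real (ln a)"
      unfolding m1 z_def z'_def by (simp add: Gf algebra_simps add_divide_distrib diff_divide_distrib del: of_nat_Suc)
    finally show ?thesis .
  qed
  obtain C where C: "C > 0" "\<forall>n. n \<noteq> 0 \<longrightarrow> norm (Gamma (Gfreq a n)) \<le> C / (of_int n)\<^sup>2"
    "\<forall>n. n \<noteq> 0 \<longrightarrow> norm (deriv Gamma (Gfreq a n)) \<le> C / (of_int n)\<^sup>2"
    by (rule Gamma_Gfreq_bounds[OF a])
  have zle: "norm (z (Suc n)) \<le> C / (real (Suc n))\<^sup>2" "norm (z' (Suc n)) \<le> C / (real (Suc n))\<^sup>2" for n
    using C(2,3)[rule_format, of "int (Suc n)"] by (simp_all add: z_def z'_def norm_mult)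
  have S: "summable (\<lambda>n. D / (real (Suc n))\<^sup>2)" for D
    using summable_mult[OF sums_summable[OF inverse_squares_sums], of D] by (simp add: add.commute)
  have cnjA: "\<forall>n. n \<noteq> 0 \<longrightarrow> Gamma (Gfreq a (- n)) = cnj (Gamma (Gfreq a n))"
    by (simp add: Gfreq_uminus cnj_Gamma)
  have cnjA': "\<forall>n. n \<noteq> 0 \<longrightarrow> deriv Gamma (Gfreq a (- n)) = cnj (deriv Gamma (Gfreq a n))"
    by (simp add: Gfreq_uminus deriv_Gamma_cnj[OF Gfreq_nonpole[OF a]])
  have P0: "(\<lambda>n. complex_of_real (2 * Re (z (Suc n)))) sums infsum (Psi0_term a u) {n. n \<noteq> 0}"
    using nonzero_Fourier_series(4)[OF C(2) cnjA, of u]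
    by (simp only: z_def Psi0_term_def[abs_def] Gfreq_def)
  have P1: "(\<lambda>n. complex_of_real (2 * Re (z' (Suc n)))) sums infsum (Psi1_term a u) {n. n \<noteq> 0}"
    using nonzero_Fourier_series(4)[OF C(3) cnjA', of u]
    by (simp only: z'_def Psi1_term_def[abs_def] Gfreq_def)
  have E0: "(\<lambda>n. Im (- \<i> * of_real (\<theta> (Suc n)) * z (Suc n)) / (pi * real (Suc n))) sums (LINT y|std_exp. 1 * saw (V y))"
    unfolding c0[symmetric]
  proof (rule saw_Fourier_integral[OF _ _ nint])
    show "summable (\<lambda>n. norm (LINT y|std_exp. of_real 1 * cis (2 * pi * real (Suc n) * V y)) / real (Suc n))"
      unfolding c0
    proof (rule summable_comparison_test'[OF S[of "2 * pi / ln a * C"], of 0])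
      fix n
      have "norm (- \<i> * of_real (\<theta> (Suc n)) * z (Suc n)) / real (Suc n) = 2 * pi / ln a * norm (z (Suc n))"
        by (simp only: n\<theta> \<theta>S)
      also have "\<dots> \<le> 2 * pi / ln a * (C / (real (Suc n))\<^sup>2)"
        using la by (intro mult_left_mono zle) auto
      finally show "norm (norm (- \<i> * of_real (\<theta> (Suc n)) * z (Suc n)) / real (Suc n)) \<le> 2 * pi / ln a * C / (real (Suc n))\<^sup>2"
        by (simp del: of_nat_Suc)
    qed
  qed auto
  have "Im (- \<i> * of_real (\<theta> (Suc n)) * z (Suc n)) / (pi * real (Suc n)) = - (1 / ln a) * (2 * Re (z (Suc n)))" for n
  proof -
    have "Im (- \<i> * of_real (\<theta> (Suc n)) * z (Suc n)) / (pi * real (Suc n)) = - (\<theta> (Suc n) * Re (z (Suc n)) / real (Suc n)) / pi"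
      by (simp add: divide_divide_eq_left mult.commute del: of_nat_Suc)
    thus ?thesis unfolding \<theta>S by simp
  qed
  hence E0': "(\<lambda>n. complex_of_real (- (1 / ln a) * (2 * Re (z (Suc n))))) sums of_real (LINT y|std_exp. saw (V y))"
    using E0 unfolding sums_of_real_iff by simp
  have "(\<lambda>n. - (1 / of_real (ln a)) * complex_of_real (2 * Re (z (Suc n)))) sums Psi0 a u"
    unfolding Psi0_def by (rule sums_mult[OF P0])
  with E0' show "complex_of_real (LINT y|std_exp. saw (V y)) = Psi0 a u"
    by (auto intro: sums_unique2)
  have E1: "(\<lambda>n. Im (- (z (Suc n) - \<i> * of_real (\<theta> (Suc n)) * z' (Suc n)) / of_real (ln a)) / (pi * real (Suc n))) sums (LINT y|std_exp. - (ln y / ln a) * saw (V y))"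
    unfolding c1[symmetric]
  proof (rule saw_Fourier_integral[OF _ _ nint])
    have "integrable std_exp ln"
      by (rule Bochner_Integration.integrable_bound[OF integrable_abs_ln_power[of 1]]) auto
    thus "integrable std_exp (\<lambda>y. - (ln y / ln a))" by simp
    show "summable (\<lambda>n. norm (LINT y|std_exp. of_real (- (ln y / ln a)) * cis (2 * pi * real (Suc n) * V y)) / real (Suc n))"
      unfolding c1
    proof (rule summable_comparison_test'[OF S[of "C / ln a + 2 * pi / ln a * C / ln a"], of 0])
      fix n
      have "norm (- (z (Suc n) - \<i> * of_real (\<theta> (Suc n)) * z' (Suc n)) / of_real (ln a)) / real (Suc n)
         = norm (z (Suc n) - \<i> * of_real (\<theta> (Suc n)) * z' (Suc n)) / ln a / real (Suc n)"
        using la by (simp add: norm_divide norm_minus_commute)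
      also have "\<dots> \<le> (norm (z (Suc n)) + norm (\<i> * of_real (\<theta> (Suc n)) * z' (Suc n))) / ln a / real (Suc n)"
        using la by (intro divide_right_mono norm_triangle_ineq4) auto
      also have "\<dots> = norm (z (Suc n)) / ln a / real (Suc n) + (\<theta> (Suc n) * norm (z' (Suc n)) / real (Suc n)) / ln a"
        unfolding n\<theta> by (simp add: add_divide_distrib del: of_nat_Suc)
      also have "\<theta> (Suc n) * norm (z' (Suc n)) / real (Suc n) = 2 * pi / ln a * norm (z' (Suc n))"
        by (rule \<theta>S)
      also have "norm (z (Suc n)) / ln a / real (Suc n) \<le> norm (z (Suc n)) / ln a / 1"
        using la by (intro divide_left_mono) auto
      also have "norm (z (Suc n)) / ln a / 1 + 2 * pi / ln a * norm (z' (Suc n)) / ln a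
         \<le> (C / (real (Suc n))\<^sup>2) / ln a / 1 + 2 * pi / ln a * (C / (real (Suc n))\<^sup>2) / ln a"
        using la by (intro add_mono divide_right_mono mult_left_mono zle) auto
      also have "\<dots> = (C / ln a + 2 * pi / ln a * C / ln a) / (real (Suc n))\<^sup>2"
        by (simp add: add_divide_distrib mult_ac del: of_nat_Suc)
      finally show "norm (norm (- (z (Suc n) - \<i> * of_real (\<theta> (Suc n)) * z' (Suc n)) / of_real (ln a)) / real (Suc n))
          \<le> (C / ln a + 2 * pi / ln a * C / ln a) / (real (Suc n))\<^sup>2"
        by (simp del: of_nat_Suc)
    qed
  qed auto
  have E2: "(\<lambda>n. Re (- \<i> * of_real (\<theta> (Suc n)) * z (Suc n)) / (pi\<^sup>2 * (real (Suc n))\<^sup>2)) sums (LINT y|std_exp. (saw (V y))\<^sup>2 - 1 / 12)"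
  proof -
    let ?f = "\<lambda>n y. cos (2 * pi * real (Suc n) * V y) / (pi\<^sup>2 * (real (Suc n))\<^sup>2)"
    have le: "norm (?f n y) \<le> (1 / pi\<^sup>2) / (real (Suc n))\<^sup>2" for n y
      by (simp add: divide_right_mono del: of_nat_Suc)
    have "(\<lambda>n. LINT y|std_exp. ?f n y) sums (LINT y|std_exp. suminf (\<lambda>n. ?f n y))"
    proof (rule sums_integral)
      show "integrable std_exp (?f n)" for n
        using le by (intro std_exp.integrable_const_bound[of _ "(1 / pi\<^sup>2) / (real (Suc n))\<^sup>2"]) auto
      show "AE y in std_exp. summable (\<lambda>n. norm (?f n y))"
        by (intro AE_I2 summable_comparison_test'[OF S[of "1 / pi\<^sup>2"], of 0]) (use le in simp)
      show "summable (\<lambda>n. LINT y|std_exp. norm (?f n y))"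
      proof (rule summable_comparison_test'[OF S[of "1 / pi\<^sup>2"], of 0])
        fix n
        have "(LINT y|std_exp. norm (?f n y)) \<le> (LINT y|std_exp. (1 / pi\<^sup>2) / (real (Suc n))\<^sup>2)"
          using le by (intro integral_mono std_exp.integrable_const_bound[of _ "(1 / pi\<^sup>2) / (real (Suc n))\<^sup>2"]) auto
        thus "norm (LINT y|std_exp. norm (?f n y)) \<le> (1 / pi\<^sup>2) / (real (Suc n))\<^sup>2"
          using std_exp.prob_space by simp
      qed
    qed
    moreover have "suminf (\<lambda>n. ?f n y) = (saw (V y))\<^sup>2 - 1 / 12" for y
      by (rule sums_unique[OF saw_square_sums, symmetric])
    moreover have "(LINT y|std_exp. ?f n y) = Re (- \<i> * of_real (\<theta> (Suc n)) * z (Suc n)) / (pi\<^sup>2 * (real (Suc n))\<^sup>2)" for n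
    proof -
      have "integrable std_exp (\<lambda>y. of_real 1 * cis (2 * pi * real (Suc n) * V y))"
        by (intro std_exp.integrable_const_bound[of _ 1]) (auto simp: cis_conv_exp norm_exp_i_times)
      from integral_Re[OF this] show ?thesis
        unfolding c0[symmetric] by (simp del: of_nat_Suc)
    qed
    ultimately show ?thesis by (simp only:)
  qed
  \<comment> \<open>Here the terms with \<open>Im (z (Suc n))\<close>, that is with the values of
    Gamma itself, cancel, and only its derivative remains.\<close>
  have "2 * (Im (- (z (Suc n) - \<i> * of_real (\<theta> (Suc n)) * z' (Suc n)) / of_real (ln a)) / (pi * real (Suc n)))
        + Re (- \<i> * of_real (\<theta> (Suc n)) * z (Suc n)) / (pi\<^sup>2 * (real (Suc n))\<^sup>2)
      = 2 / (ln a)\<^sup>2 * (2 * Re (z' (Suc n)))" for n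
  proof -
    define N where "N = real (Suc n)"
    have N: "N > 0" by (simp add: N_def)
    have "Im (- (z (Suc n) - \<i> * of_real (\<theta> (Suc n)) * z' (Suc n)) / of_real (ln a))
       = (\<theta> (Suc n) * Re (z' (Suc n)) - Im (z (Suc n))) / ln a"
      by simp
    moreover have "Re (- \<i> * of_real (\<theta> (Suc n)) * z (Suc n)) = \<theta> (Suc n) * Im (z (Suc n))"
      by simp
    moreover have "2 * ((2 * pi * N / ln a * x - y) / ln a / (pi * N)) + 2 * pi * N / ln a * y / (pi\<^sup>2 * N\<^sup>2)
       = 2 / (ln a)\<^sup>2 * (2 * x)" for x y
      using la N by (simp add: field_simps power2_eq_square)
    moreover have "\<theta> (Suc n) = 2 * pi * N / ln a" by (simp only: \<theta>_def N_def)
    ultimately show ?thesis unfolding N_def[symmetric] by (simp only:)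
  qed
  with sums_add[OF sums_mult[OF E1, of 2] E2]
  have "(\<lambda>n. complex_of_real (2 / (ln a)\<^sup>2 * (2 * Re (z' (Suc n))))) sums of_real (2 * (LINT y|std_exp. - (ln y / ln a) * saw (V y)) + (LINT y|std_exp. (saw (V y))\<^sup>2 - 1 / 12))"
    unfolding sums_of_real_iff by (simp only:)
  moreover have "(\<lambda>n. 2 / of_real ((ln a)\<^sup>2) * complex_of_real (2 * Re (z' (Suc n)))) sums Psi1 a u"
    unfolding Psi1_def by (rule sums_mult[OF P1])
  ultimately show "complex_of_real (2 * (LINT y|std_exp. - (ln y / ln a) * saw (V y)) + (LINT y|std_exp. (saw (V y))\<^sup>2 - 1 / 12)) = Psi1 a u"
    by (auto intro: sums_unique2)
qed

text \<open>That the values are real follows from their being expectations of real functions, by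
  \<open>saw_expectation_Psi\<close>; the rest is uniform convergence.\<close>

lemma Psi_facts:
  assumes a: "a > (1::real)"
  shows "Psi0_term a x summable_on {n. n \<noteq> 0}" "Psi0 a x \<in> \<real>" "Psi0 a (x + 1) = Psi0 a x"
    "(Psi0 a has_integral 0) {0..1}"
    "Psi1_term a x summable_on {n. n \<noteq> 0}" "Psi1 a x \<in> \<real>" "Psi1 a (x + 1) = Psi1 a x"
    "(Psi1 a has_integral 0) {0..1}"
proof -
  obtain C where C: "C > 0" "\<forall>n. n \<noteq> 0 \<longrightarrow> norm (Gamma (Gfreq a n)) \<le> C / (of_int n)\<^sup>2"
    "\<forall>n. n \<noteq> 0 \<longrightarrow> norm (deriv Gamma (Gfreq a n)) \<le> C / (of_int n)\<^sup>2"
    by (rule Gamma_Gfreq_bounds[OF a])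
  note F0 = nonzero_Fourier_series[OF C(2)] and F1 = nonzero_Fourier_series[OF C(3)]
  show "Psi0_term a x summable_on {n. n \<noteq> 0}" "Psi1_term a x summable_on {n. n \<noteq> 0}"
    using F0(1) F1(1) by (simp_all only: Psi0_term_def[abs_def] Psi1_term_def[abs_def] Gfreq_def)
  show "Psi0 a (x + 1) = Psi0 a x" "Psi1 a (x + 1) = Psi1 a x"
    using F0(2) F1(2) by (simp_all only: Psi0_def Psi1_def Psi0_term_def[abs_def] Psi1_term_def[abs_def] Gfreq_def)
  show "Psi0 a x \<in> \<real>" "Psi1 a x \<in> \<real>"
    by (simp_all only: saw_expectation_Psi[OF a, symmetric] Reals_of_real)
  show "(Psi0 a has_integral 0) {0..1}" "(Psi1 a has_integral 0) {0..1}"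
    unfolding Psi0_def[abs_def] Psi1_def[abs_def]
    using has_integral_mult_right[OF F0(3)] has_integral_mult_right[OF F1(3)]
    by (simp_all only: Psi0_term_def[abs_def] Psi1_term_def[abs_def] Gfreq_def mult_zero_right)
qed

text \<open>Moments from tails: consecutive odd numbers add up to squares. Cutting the sum at
  \<open>n\<close> amounts to clamping \<open>N\<close> to the range from 0 to \<open>n + 1\<close>.
  Both \<open>X_l\<close> and the discretized Gumbel variable are treated by this identity.\<close>

lemma sum_indicator_less_int:
  fixes N :: int
  shows "(\<Sum>k\<le>n. if int k < N then 1 else 0 :: real) = of_int (min (max N 0) (int n + 1))"
    and "(\<Sum>k\<le>n. (2 * real k + 1) * (if int k < N then 1 else 0)) = (of_int (min (max N 0) (int n + 1)))\<^sup>2"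
proof -
  show "(\<Sum>k\<le>n. if int k < N then 1 else 0 :: real) = of_int (min (max N 0) (int n + 1))"
    by (induction n) auto
  show "(\<Sum>k\<le>n. (2 * real k + 1) * (if int k < N then 1 else 0)) = (of_int (min (max N 0) (int n + 1)))\<^sup>2"
  proof (induction n)
    case 0
    have "N \<le> 0 \<or> N = 1 \<or> 1 < N" by linarith
    thus ?case by (elim disjE) auto
  next
    case (Suc n)
    show ?case
    proof (cases "int (Suc n) < N")
      case True
      hence "min (max N 0) (int n + 1) = int n + 1" "min (max N 0) (int (Suc n) + 1) = int (Suc n) + 1" by auto
      thus ?thesis using True Suc by (simp add: power2_eq_square algebra_simps)
    next
      case False
      hence "min (max N 0) (int n + 1) = min (max N 0) (int (Suc n) + 1)" by auto
      thus ?thesis using False Suc by simp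
    qed
  qed
qed

section \<open>The discretized Gumbel distribution\<close>

locale discretized_Gumbel =
  fixes a :: real
  assumes a: "a > 1"
begin

lemma ln_a_pos: "ln a > 0"
  using a by simp

text \<open>If \<open>y\<close> is standard exponential, then \<open>- ln y\<close> has the standard
  Gumbel distribution; \<open>T\<close> is its rescaling to base \<open>a\<close>.\<close>

definition T :: "real \<Rightarrow> real" where "T y = - (ln y / ln a)"

definition X :: "real \<Rightarrow> real \<Rightarrow> int" where "X u y = \<lceil>u + T y\<rceil>"

lemma measurable_T [measurable]: "T \<in> borel_measurable borel"
  unfolding T_def[abs_def] by measurable

lemma X_conv_saw: "of_int (X u y) = (u + 1 / 2) + (T y + saw (u + T y))"
  by (simp add: X_def saw_def)

lemma integrable_T_power: "integrable std_exp (\<lambda>y. \<bar>T y\<bar> ^ j)"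
proof -
  have "integrable std_exp (\<lambda>y. \<bar>ln y\<bar> ^ j / ln a ^ j)"
    by (intro integrable_divide_zero integrable_abs_ln_power)
  thus ?thesis using ln_a_pos by (simp add: T_def abs_divide power_divide)
qed

lemma integrable_T: "integrable std_exp T"
  by (rule Bochner_Integration.integrable_bound[OF integrable_T_power[of 1]]) auto

lemma integrable_saw_T: "integrable std_exp (\<lambda>y. saw (u + T y))"
  using abs_saw_le by (intro std_exp.integrable_const_bound[of _ "1/2"]) auto

lemma integrable_T_saw: "integrable std_exp (\<lambda>y. T y * saw (u + T y))"
proof (rule Bochner_Integration.integrable_bound[OF integrable_T_power[of 1]])
  have "\<bar>T y\<bar> * \<bar>saw (u + T y)\<bar> \<le> \<bar>T y\<bar> * 1" for y
    using abs_saw_le[of "u + T y"] by (intro mult_left_mono) auto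
  thus "AE y in std_exp. norm (T y * saw (u + T y)) \<le> norm (\<bar>T y\<bar> ^ 1)"
    by (simp add: abs_mult)
qed measurable

lemma integrable_saw_T_square: "integrable std_exp (\<lambda>y. (saw (u + T y))\<^sup>2)"
proof (rule std_exp.integrable_const_bound[of _ 1])
  have "(saw v)\<^sup>2 \<le> 1\<^sup>2" for v
    using abs_saw_le[of v] by (intro power2_le_iff_abs_le[THEN iffD2]) auto
  thus "AE y in std_exp. norm ((saw (u + T y))\<^sup>2) \<le> 1" by simp
qed measurable

lemma integrable_T_square: "integrable std_exp (\<lambda>y. (T y)\<^sup>2)"
  using integrable_T_power[of 2] by simp

lemma expectation_T: "(LINT y|std_exp. T y) = euler_mascheroni / ln a"
  by (simp add: T_def expectation_ln)

lemma expectation_T_square: "(LINT y|std_exp. (T y)\<^sup>2) = (euler_mascheroni\<^sup>2 + pi\<^sup>2 / 6) / (ln a)\<^sup>2"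
  by (simp add: T_def power_divide expectation_ln_square)

lemma integrable_X: "integrable std_exp (\<lambda>y. of_int (X u y) :: real)"
  unfolding X_conv_saw by (intro Bochner_Integration.integrable_add integrable_T integrable_saw_T) auto

lemma X_square:
  "(of_int (X u y) :: real)\<^sup>2 = (u + 1 / 2)\<^sup>2 + 2 * (u + 1 / 2) * (T y + saw (u + T y))
      + ((T y)\<^sup>2 + 2 * (T y * saw (u + T y)) + (saw (u + T y))\<^sup>2)"
  unfolding X_conv_saw by (simp add: power2_eq_square algebra_simps)

lemma integrable_X_square: "integrable std_exp (\<lambda>y. (of_int (X u y) :: real)\<^sup>2)"
  unfolding X_square
  by (intro Bochner_Integration.integrable_add integrable_mult_right integrable_T integrable_saw_T
        integrable_T_saw integrable_saw_T_square integrable_T_square) auto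

lemma expectation_saw: "(LINT y|std_exp. saw (u + T y)) = Re (Psi0 a u)"
  using arg_cong[OF saw_expectation_Psi(1)[OF a, of u], of Re] by (simp add: T_def)

lemma expectation_T_saw:
  "2 * (LINT y|std_exp. T y * saw (u + T y)) + (LINT y|std_exp. (saw (u + T y))\<^sup>2) = Re (Psi1 a u) + 1 / 12"
proof -
  have "2 * (LINT y|std_exp. T y * saw (u + T y)) + (LINT y|std_exp. (saw (u + T y))\<^sup>2 - 1 / 12) = Re (Psi1 a u)"
    using arg_cong[OF saw_expectation_Psi(2)[OF a, of u], of Re] by (simp add: T_def)
  moreover have "(LINT y|std_exp. (saw (u + T y))\<^sup>2 - 1 / 12) = (LINT y|std_exp. (saw (u + T y))\<^sup>2) - 1 / 12"
    using integrable_saw_T_square std_exp.prob_space by (subst Bochner_Integration.integral_diff) auto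
  ultimately show ?thesis by simp
qed

definition meanX :: "real \<Rightarrow> real" where
  "meanX u = u + euler_mascheroni / ln a + 1 / 2 + Re (Psi0 a u)"

definition varX :: "real \<Rightarrow> real" where
  "varX u = pi\<^sup>2 / (6 * (ln a)\<^sup>2) + 1 / 12 + Re (Psi1 a u)
     - 2 * euler_mascheroni / ln a * Re (Psi0 a u) - (Re (Psi0 a u))\<^sup>2"

lemma expectation_X: "(LINT y|std_exp. of_int (X u y)) = meanX u"
  unfolding X_conv_saw meanX_def
  using integrable_T integrable_saw_T std_exp.prob_space
  by (simp add: expectation_T expectation_saw)

lemma expectation_X_square: "(LINT y|std_exp. (of_int (X u y))\<^sup>2) = varX u + (meanX u)\<^sup>2"
proof -
  let ?s = "\<lambda>y. saw (u + T y)"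
  have "(LINT y|std_exp. (of_int (X u y))\<^sup>2)
      = (u + 1 / 2)\<^sup>2 + 2 * (u + 1 / 2) * ((LINT y|std_exp. T y) + (LINT y|std_exp. ?s y))
        + ((LINT y|std_exp. (T y)\<^sup>2) + 2 * (LINT y|std_exp. T y * ?s y) + (LINT y|std_exp. (?s y)\<^sup>2))"
    unfolding X_square
    using integrable_T integrable_saw_T integrable_T_saw integrable_saw_T_square integrable_T_square std_exp.prob_space
    by simp
  also have "\<dots> = (u + 1 / 2)\<^sup>2 + 2 * (u + 1 / 2) * (euler_mascheroni / ln a + Re (Psi0 a u))
       + ((euler_mascheroni\<^sup>2 + pi\<^sup>2 / 6) / (ln a)\<^sup>2 + (Re (Psi1 a u) + 1 / 12))"
    using expectation_T_saw[of u] by (simp add: expectation_T expectation_T_square expectation_saw)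
  also have "\<dots> = varX u + (meanX u)\<^sup>2"
    using ln_a_pos unfolding varX_def meanX_def by (simp add: field_simps power2_eq_square)
  finally show ?thesis .
qed

text \<open>The integer variable as a sum over \<open>0 \<le> k \<le> n\<close> of tail
  probabilities sees it: negative values and values above \<open>n + 1\<close> are lost.\<close>

definition clamp_X :: "real \<Rightarrow> nat \<Rightarrow> real \<Rightarrow> real" where
  "clamp_X u n y = of_int (min (max (X u y) 0) (int n + 1))"

text \<open>A ceiling exceeds the integer \<open>k\<close> iff its argument does, and
  \<open>log a x - log a y > k\<close> means \<open>y < x / a ^ k\<close>.\<close>

lemma prob_X_gt:
  assumes x: "x > 0"
  shows "std_exp.prob {y. int k < X (log a x) y} = 1 - exp (- x / a ^ k)"
proof -
  have "std_exp.prob {y. int k < X (log a x) y} = std_exp.prob {y. y < x / a ^ k}"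
  proof (rule std_exp.finite_measure_eq_AE)
    show "AE y in std_exp. (y \<in> {y. int k < X (log a x) y}) = (y \<in> {y. y < x / a ^ k})"
      using AE_std_exp_pos
    proof eventually_elim
      case (elim y)
      have "int k < X (log a x) y \<longleftrightarrow> real k < log a x + T y"
        unfolding X_def by (simp add: less_ceiling_iff)
      also have "\<dots> \<longleftrightarrow> ln y < ln x - real k * ln a"
        using ln_a_pos by (simp add: T_def log_def field_simps)
      also have "ln x - real k * ln a = ln (x / a ^ k)"
        using x a by (simp add: ln_div ln_realpow)
      also have "ln y < ln (x / a ^ k) \<longleftrightarrow> y < x / a ^ k"
        using elim x a by simp
      finally show ?case by simp
    qed
  qed (auto simp: X_def)
  also have "\<dots> = 1 - exp (- (x / a ^ k))"
    using x a by (intro std_exp_tail) auto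
  finally show ?thesis by simp
qed

lemma measurable_X [measurable]: "X u \<in> measurable borel (count_space UNIV)"
  unfolding X_def[abs_def] by measurable

lemma measurable_clamp_X [measurable]: "clamp_X u n \<in> borel_measurable borel"
  unfolding clamp_X_def[abs_def] by measurable

lemma expectation_clamp_X:
  assumes x: "x > 0"
  shows "(LINT y|std_exp. clamp_X (log a x) n y) = (\<Sum>k\<le>n. 1 - exp (- x / a ^ k))"
    and "(LINT y|std_exp. (clamp_X (log a x) n y)\<^sup>2) = (\<Sum>k\<le>n. (2 * real k + 1) * (1 - exp (- x / a ^ k)))"
proof -
  let ?A = "\<lambda>k. {y. int k < X (log a x) y}"
  have ind: "(if int k < X (log a x) y then 1 else 0) = indicat_real (?A k) y" for k y
    by (simp add: indicator_def)
  have int: "integrable std_exp (indicat_real (?A k))" for k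
    by (rule std_exp.integrable_const_bound[of _ 1]) auto
  have E: "(LINT y|std_exp. indicat_real (?A k) y) = 1 - exp (- x / a ^ k)" for k
    using prob_X_gt[OF x, of k] by simp
  show "(LINT y|std_exp. clamp_X (log a x) n y) = (\<Sum>k\<le>n. 1 - exp (- x / a ^ k))"
    unfolding clamp_X_def sum_indicator_less_int(1)[symmetric] ind
    using int E by simp
  show "(LINT y|std_exp. (clamp_X (log a x) n y)\<^sup>2) = (\<Sum>k\<le>n. (2 * real k + 1) * (1 - exp (- x / a ^ k)))"
    unfolding clamp_X_def sum_indicator_less_int(2)[symmetric] ind
  proof (subst Bochner_Integration.integral_sum)
    show "(\<Sum>k\<le>n. LINT y|std_exp. (2 * real k + 1) * indicat_real (?A k) y) = (\<Sum>k\<le>n. (2 * real k + 1) * (1 - exp (- x / a ^ k)))"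
      unfolding integral_mult_right_zero E ..
  qed (use int in \<open>auto intro!: integrable_mult_right\<close>)
qed

text \<open>Negative values of \<open>X\<close> force \<open>y > x\<close>, and then
  \<open>- X\<close> is at most the logarithm of \<open>y / x\<close>; this costs a term of order
  \<open>1 / x\<close>. Values above \<open>n + 1\<close> force \<open>T y\<close> to be large,
  because \<open>log a x\<close> is at most \<open>n / 2\<close>.\<close>

lemma clamp_X_error:
  assumes x: "x > 0" and n: "2 * log a x \<le> real n" and y: "y > 0"
  shows "\<bar>of_int (X (log a x) y) - clamp_X (log a x) n y\<bar> \<le> y / (x * ln a) + 4 * \<bar>T y\<bar> ^ 2 / (real n + 1)"
    and "\<bar>(of_int (X (log a x) y))\<^sup>2 - (clamp_X (log a x) n y)\<^sup>2\<bar> \<le> 4 * y / (x * (ln a)\<^sup>2) + 8 * \<bar>T y\<bar> ^ 3 / (real n + 1)"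
proof -
  define u where "u = log a x"
  define N where "N = X u y"
  define v where "v = y / x"
  have V: "u + T y = - (ln v / ln a)"
    using x y by (simp add: u_def T_def v_def log_def ln_div diff_divide_distrib)
  have nonneg: "0 \<le> y / (x * ln a)" "0 \<le> 4 * \<bar>T y\<bar> ^ 2 / (real n + 1)" "0 \<le> 4 * y / (x * (ln a)\<^sup>2)" "0 \<le> 8 * \<bar>T y\<bar> ^ 3 / (real n + 1)"
    using x y ln_a_pos by auto
  consider "N < 0" | "0 \<le> N" "N \<le> int n + 1" | "N > int n + 1" by linarith
  hence "\<bar>of_int N - clamp_X u n y\<bar> \<le> y / (x * ln a) + 4 * \<bar>T y\<bar> ^ 2 / (real n + 1)
     \<and> \<bar>(of_int N)\<^sup>2 - (clamp_X u n y)\<^sup>2\<bar> \<le> 4 * y / (x * (ln a)\<^sup>2) + 8 * \<bar>T y\<bar> ^ 3 / (real n + 1)"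
  proof cases
    case 1
    have v0: "v > 0" using x y by (simp add: v_def)
    have c: "clamp_X u n y = 0" using 1 by (simp add: clamp_X_def N_def)
    have "u + T y \<le> of_int N" by (simp add: N_def X_def)
    hence N: "of_int (- N) \<le> ln v / ln a" unfolding V by simp
    have "real_of_int (- N) > 0" using 1 by simp
    with N have "ln v / ln a > 0" by linarith
    hence lv: "ln v > 0" using ln_a_pos by (simp add: zero_less_divide_iff)
    hence "v > 1" using v0 by simp
    have "of_int (- N) \<le> v / ln a"
    proof (rule order_trans[OF N])
      show "ln v / ln a \<le> v / ln a"
        using ln_less_self[OF v0] ln_a_pos by (intro divide_right_mono) auto
    qed
    hence 11: "\<bar>of_int N - clamp_X u n y\<bar> \<le> y / (x * ln a)"
      using 1 by (simp add: c v_def mult.commute)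
    \<comment> \<open>The square root is taken so that the square of the logarithm, too, is bounded
      linearly in \<open>v\<close>.\<close>
    have "ln (sqrt v) \<le> sqrt v" using v0 by (intro less_imp_le ln_less_self) simp
    hence "ln v \<le> 2 * sqrt v" using v0 by (simp add: ln_sqrt)
    hence "(ln v)\<^sup>2 \<le> (2 * sqrt v)\<^sup>2" using lv by (intro power_mono) auto
    hence lv2: "(ln v)\<^sup>2 \<le> 4 * v" using v0 by (simp add: power_mult_distrib)
    have "(of_int (- N))\<^sup>2 \<le> (ln v / ln a)\<^sup>2"
      using N 1 by (intro power_mono) auto
    also have "\<dots> \<le> 4 * v / (ln a)\<^sup>2"
      unfolding power_divide using lv2 by (intro divide_right_mono) auto
    finally have "\<bar>(of_int N)\<^sup>2 - (clamp_X u n y)\<^sup>2\<bar> \<le> 4 * y / (x * (ln a)\<^sup>2)"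
      by (simp add: c v_def mult.commute)
    with 11 nonneg show ?thesis by linarith
  next
    case 2
    hence "clamp_X u n y = of_int N" by (simp add: clamp_X_def N_def)
    with nonneg show ?thesis by simp
  next
    case 3
    have c: "clamp_X u n y = real n + 1" using 3 by (simp add: clamp_X_def N_def)
    have N3: "of_int N > real n + 1" using 3 by linarith
    have "u + T y > real n + 1"
    proof -
      have "int n + 1 < \<lceil>u + T y\<rceil>" using 3 by (simp add: N_def X_def)
      thus ?thesis by (simp add: less_ceiling_iff)
    qed
    moreover have "of_int N \<le> u + T y + 1" unfolding N_def X_def by linarith
    \<comment> \<open>From \<open>u \<le> n / 2\<close> and \<open>u + T y > n + 1\<close> one gets
      \<open>u + 1 < T y\<close>.\<close>
    ultimately have "of_int N \<le> 2 * T y" using n unfolding u_def by linarith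
    hence NT: "of_int N \<le> 2 * \<bar>T y\<bar>" by linarith
    have N0: "0 \<le> (of_int N :: real)" using N3 by linarith
    \<comment> \<open>As in Markov's inequality, multiplying by this ratio buys the factor
      \<open>1 / (n + 1)\<close> at the price of one higher moment of \<open>T\<close>.\<close>
    have r: "1 \<le> of_int N / (real n + 1)" using N3 by simp
    have "\<bar>of_int N - clamp_X u n y\<bar> \<le> of_int N * 1" using N3 by (simp add: c)
    also have "\<dots> \<le> of_int N * (of_int N / (real n + 1))" using r N0 by (intro mult_left_mono)
    also have "\<dots> = (of_int N)\<^sup>2 / (real n + 1)" by (simp add: power2_eq_square)
    also have "\<dots> \<le> (2 * \<bar>T y\<bar>)\<^sup>2 / (real n + 1)" using NT N0 by (intro divide_right_mono power_mono) auto
    finally have 1: "\<bar>of_int N - clamp_X u n y\<bar> \<le> 4 * \<bar>T y\<bar> ^ 2 / (real n + 1)" by (simp add: power_mult_distrib)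
    have "(real n + 1)\<^sup>2 \<le> (of_int N)\<^sup>2" using N3 by (intro power_mono) auto
    hence "\<bar>(of_int N)\<^sup>2 - (clamp_X u n y)\<^sup>2\<bar> \<le> (of_int N)\<^sup>2 * 1" by (simp add: c)
    also have "\<dots> \<le> (of_int N)\<^sup>2 * (of_int N / (real n + 1))" using r by (intro mult_left_mono) auto
    also have "\<dots> = (of_int N) ^ 3 / (real n + 1)" by (simp add: power2_eq_square power3_eq_cube)
    also have "\<dots> \<le> (2 * \<bar>T y\<bar>) ^ 3 / (real n + 1)" using NT N0 by (intro divide_right_mono power_mono) auto
    finally have "\<bar>(of_int N)\<^sup>2 - (clamp_X u n y)\<^sup>2\<bar> \<le> 8 * \<bar>T y\<bar> ^ 3 / (real n + 1)" by (simp add: power_mult_distrib)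
    with 1 nonneg show ?thesis by linarith
  qed
  thus "\<bar>of_int (X (log a x) y) - clamp_X (log a x) n y\<bar> \<le> y / (x * ln a) + 4 * \<bar>T y\<bar> ^ 2 / (real n + 1)"
    and "\<bar>(of_int (X (log a x) y))\<^sup>2 - (clamp_X (log a x) n y)\<^sup>2\<bar> \<le> 4 * y / (x * (ln a)\<^sup>2) + 8 * \<bar>T y\<bar> ^ 3 / (real n + 1)"
    by (simp_all only: u_def N_def)
qed

text \<open>The pointwise bounds of \<open>clamp_X_error\<close> are integrated; \<open>C\<close>
  collects the expectation of \<open>y\<close> and the second and third absolute moments of
  \<open>T\<close>. The term \<open>1 / x\<close> pays for negative values,
  \<open>1 / (n + 1)\<close> for cutting the sums at \<open>n\<close>.\<close>

theorem moment_sums: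
  obtains C where "C > 0"
    "\<And>x n. x > 0 \<Longrightarrow> 2 * log a x \<le> real n \<Longrightarrow>
        \<bar>(\<Sum>k\<le>n. 1 - exp (- x / a ^ k)) - meanX (log a x)\<bar> \<le> C * (1 / x + 1 / (real n + 1))"
    "\<And>x n. x > 0 \<Longrightarrow> 2 * log a x \<le> real n \<Longrightarrow>
        \<bar>(\<Sum>k\<le>n. (2 * real k + 1) * (1 - exp (- x / a ^ k))) - (varX (log a x) + (meanX (log a x))\<^sup>2)\<bar> \<le> C * (1 / x + 1 / (real n + 1))"
proof -
  have iy: "integrable std_exp (\<lambda>y. \<bar>y\<bar>)"
  proof (rule iffD1[OF integrable_cong_AE std_exp_powr_real[of 1]])
    show "AE y in std_exp. y powr 1 = \<bar>y\<bar>" using AE_std_exp_pos by eventually_elim simp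
  qed auto
  define Y where "Y = (LINT y|std_exp. \<bar>y\<bar>)"
  define E2 where "E2 = (LINT y|std_exp. \<bar>T y\<bar> ^ 2)"
  define E3 where "E3 = (LINT y|std_exp. \<bar>T y\<bar> ^ 3)"
  have nn: "Y \<ge> 0" "E2 \<ge> 0" "E3 \<ge> 0" unfolding Y_def E2_def E3_def by auto
  have ic: "integrable std_exp (\<lambda>y. clamp_X u n y)" "integrable std_exp (\<lambda>y. (clamp_X u n y)\<^sup>2)" for u n
  proof -
    have 1: "\<bar>clamp_X u n y\<bar> \<le> real n + 1" for y
      unfolding clamp_X_def by (auto simp: min_def max_def)
    show "integrable std_exp (\<lambda>y. clamp_X u n y)"
      using 1 by (intro std_exp.integrable_const_bound[of _ "real n + 1"]) auto
    have "(clamp_X u n y)\<^sup>2 \<le> (real n + 1)\<^sup>2" for y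
      using 1[of y] by (intro power2_le_iff_abs_le[THEN iffD2]) auto
    thus "integrable std_exp (\<lambda>y. (clamp_X u n y)\<^sup>2)"
      by (intro std_exp.integrable_const_bound[of _ "(real n + 1)\<^sup>2"]) auto
  qed
  have gen: "\<bar>(LINT y|std_exp. c y) - (LINT y|std_exp. f y)\<bar> \<le> p * Y / x + q * E / (real n + 1)"
    if f: "integrable std_exp f" and c: "integrable std_exp c" and j: "E = (LINT y|std_exp. \<bar>T y\<bar> ^ j)"
      and le: "\<And>y. y > 0 \<Longrightarrow> \<bar>f y - c y\<bar> \<le> p * \<bar>y\<bar> / x + q * \<bar>T y\<bar> ^ j / (real n + 1)"
    for f c E j x p q n
  proof -
    have "\<bar>(LINT y|std_exp. c y) - (LINT y|std_exp. f y)\<bar> = \<bar>LINT y|std_exp. f y - c y\<bar>"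
      using f c by simp
    also have "\<dots> \<le> (LINT y|std_exp. \<bar>f y - c y\<bar>)"
      by (rule integral_abs_bound)
    also have "\<dots> \<le> (LINT y|std_exp. p * \<bar>y\<bar> / x + q * \<bar>T y\<bar> ^ j / (real n + 1))"
    proof (rule integral_mono_AE)
      show "AE y in std_exp. \<bar>f y - c y\<bar> \<le> p * \<bar>y\<bar> / x + q * \<bar>T y\<bar> ^ j / (real n + 1)"
        using AE_std_exp_pos by eventually_elim (rule le)
    qed (use f c iy integrable_T_power[of j] in auto)
    also have "\<dots> = p * Y / x + q * E / (real n + 1)"
      using iy integrable_T_power[of j] by (simp add: Y_def j)
    finally show ?thesis .
  qed
  define C where "C = 1 + Y / ln a + 4 * E2 + 4 / (ln a)\<^sup>2 * Y + 8 * E3"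
  have C: "C > 0" "Y / ln a \<le> C" "4 * E2 \<le> C" "4 / (ln a)\<^sup>2 * Y \<le> C" "8 * E3 \<le> C"
    using nn ln_a_pos by (auto simp: C_def add_nonneg_pos add_pos_nonneg intro!: add_nonneg_nonneg)
  show ?thesis
  proof (rule that[OF C(1)])
    fix x :: real and n :: nat assume x: "x > 0" and n: "2 * log a x \<le> real n"
    have "\<bar>(LINT y|std_exp. clamp_X (log a x) n y) - (LINT y|std_exp. of_int (X (log a x) y))\<bar> \<le> (1 / ln a) * Y / x + 4 * E2 / (real n + 1)"
      using clamp_X_error(1)[OF x n]
      by (intro gen[OF integrable_X ic(1) E2_def]) (simp add: mult.commute)
    also have "\<dots> \<le> C / x + C / (real n + 1)"
      using C x by (intro add_mono divide_right_mono) auto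
    finally show "\<bar>(\<Sum>k\<le>n. 1 - exp (- x / a ^ k)) - meanX (log a x)\<bar> \<le> C * (1 / x + 1 / (real n + 1))"
      unfolding expectation_X expectation_clamp_X[OF x] by (simp add: distrib_left)
    have "\<bar>(LINT y|std_exp. (clamp_X (log a x) n y)\<^sup>2) - (LINT y|std_exp. (of_int (X (log a x) y))\<^sup>2)\<bar> \<le> (4 / (ln a)\<^sup>2) * Y / x + 8 * E3 / (real n + 1)"
      using clamp_X_error(2)[OF x n]
      by (intro gen[OF integrable_X_square ic(2) E3_def]) (simp add: mult.commute)
    also have "\<dots> \<le> C / x + C / (real n + 1)"
      using C x by (intro add_mono divide_right_mono) auto
    finally show "\<bar>(\<Sum>k\<le>n. (2 * real k + 1) * (1 - exp (- x / a ^ k))) - (varX (log a x) + (meanX (log a x))\<^sup>2)\<bar> \<le> C * (1 / x + 1 / (real n + 1))"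
      unfolding expectation_X_square expectation_clamp_X[OF x] by (simp add: distrib_left)
  qed
qed

end

section \<open>Coefficients of rational functions\<close>

lemma cpoly_0 [simp]: "cpoly 0 z = 0"
  by (simp add: cpoly_def)

lemma cpoly_pCons [simp]: "cpoly (pCons c p) z = of_real c + z * cpoly p z"
  by (simp add: cpoly_def map_poly_pCons)

lemma cpoly_1 [simp]: "cpoly 1 z = 1"
  unfolding one_pCons by simp

lemma cpoly_add [simp]: "cpoly (p + q) z = cpoly p z + cpoly q z"
  by (induction p q rule: poly_induct2) (simp_all add: algebra_simps)

lemma cpoly_smult [simp]: "cpoly (smult c p) z = of_real c * cpoly p z"
  by (induction p) (simp_all add: algebra_simps)

lemma cpoly_mult [simp]: "cpoly (p * q) z = cpoly p z * cpoly q z"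
  by (induction p) (simp_all add: algebra_simps)

lemma cpoly_monom [simp]: "cpoly (monom c n) z = of_real c * z ^ n"
  by (simp add: cpoly_def map_poly_monom poly_monom)

lemma cpoly_of_real [simp]: "cpoly p (of_real x) = of_real (poly p x)"
  by (induction p) simp_all

lemma map_poly_of_real_pderiv:
  "map_poly complex_of_real (pderiv p) = pderiv (map_poly complex_of_real p)"
  by (rule poly_eqI) (simp add: coeff_map_poly coeff_pderiv)

lemma has_field_derivative_cpoly: "(cpoly p has_field_derivative cpoly (pderiv p) z) (at z within A)"
  unfolding cpoly_def[abs_def] map_poly_of_real_pderiv
  by (rule has_field_derivative_at_within[OF poly_DERIV])

lemma continuous_on_cpoly [continuous_intros]: "continuous_on A (cpoly p)"
  unfolding cpoly_def[abs_def] by (intro continuous_intros)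

lemma holomorphic_on_cpoly [holomorphic_intros]: "cpoly p holomorphic_on A"
  unfolding holomorphic_on_def field_differentiable_def using has_field_derivative_cpoly by blast

lemma cpoly_bounded: "\<exists>C>0. \<forall>z. cmod z \<le> r \<longrightarrow> cmod (cpoly p z) \<le> C"
proof -
  have "compact (cpoly p ` cball 0 r)" by (intro compact_continuous_image continuous_intros) auto
  hence "bounded (cpoly p ` cball 0 r)" by (rule compact_imp_bounded)
  thus ?thesis by (auto simp: bounded_pos)
qed

lemma cpoly_Lipschitz:
  "\<exists>C>0. \<forall>z w. cmod z \<le> r \<longrightarrow> cmod w \<le> r \<longrightarrow> cmod (cpoly p z - cpoly p w) \<le> C * cmod (z - w)"
proof -
  obtain C where C: "C > 0" "\<And>z. cmod z \<le> r \<Longrightarrow> cmod (cpoly (pderiv p) z) \<le> C"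
    using cpoly_bounded[of r "pderiv p"] by auto
  have "cmod (cpoly p z - cpoly p w) \<le> C * cmod (z - w)" if "cmod z \<le> r" "cmod w \<le> r" for z w
    by (rule field_differentiable_bound[OF convex_cball[of 0 r] has_field_derivative_cpoly])
       (use C that in auto)
  with C(1) show ?thesis by blast
qed

lemma fps_complex_of_real_mult_poly:
  "Abs_fps (\<lambda>n. complex_of_real (fps_nth F n)) * fps_of_poly (map_poly complex_of_real p)
     = Abs_fps (\<lambda>n. complex_of_real (fps_nth (F * fps_of_poly p) n))"
  by (rule fps_ext) (simp add: fps_mult_nth coeff_map_poly)

text \<open>Bridge from the formal identity, over the reals, to a holomorphic function, to which
  Cauchy's inequality applies. As \<open>T\<close> has nonzero constant term, the formal quotient is
  the Taylor expansion.\<close>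

lemma fps_poly_quotient_coefficient:
  fixes R T :: "real poly"
  assumes hT: "h * fps_of_poly T = fps_of_poly R" and T0: "poly.coeff T 0 \<noteq> 0"
  shows "complex_of_real (fps_nth h n) = (deriv ^^ n) (\<lambda>z. cpoly R z / cpoly T z) 0 / fact n"
proof -
  let ?c = "map_poly complex_of_real"
  let ?f = "\<lambda>z. cpoly R z / cpoly T z"
  have exp_poly: "poly p has_fps_expansion fps_of_poly p" for p :: "complex poly"
    using eval_fps_has_fps_expansion[of "fps_of_poly p"] by (simp add: eval_fps_of_poly[abs_def])
  have "?f has_fps_expansion (fps_of_poly (?c R) / fps_of_poly (?c T))"
    unfolding cpoly_def using T0
    by (intro has_fps_expansion_divide' exp_poly) (simp add: coeff_map_poly)
  also have "fps_of_poly (?c R) / fps_of_poly (?c T) = Abs_fps (\<lambda>n. complex_of_real (fps_nth h n))" (is "_ = ?H")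
  proof -
    have "?H * fps_of_poly (?c T) = Abs_fps (\<lambda>n. complex_of_real (fps_nth (fps_of_poly R) n))"
      unfolding fps_complex_of_real_mult_poly hT ..
    also have "\<dots> = fps_of_poly (?c R)"
      by (rule fps_ext) (simp add: coeff_map_poly)
    finally have "fps_of_poly (?c R) = ?H * fps_of_poly (?c T)" ..
    moreover have "fps_of_poly (?c T) \<noteq> 0"
    proof
      assume "fps_of_poly (?c T) = 0"
      hence "fps_nth (fps_of_poly (?c T)) 0 = 0" by simp
      thus False using T0 by (simp add: coeff_map_poly)
    qed
    ultimately show ?thesis by simp
  qed
  finally have exp: "?f has_fps_expansion ?H" .
  show ?thesis
    using fps_nth_fps_expansion[OF exp, of n] by simp
qed

text \<open>Multiplying the generating function by \<open>1 - z / \<zeta>\<close> removes the pole,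
  so the coefficients of \<open>h = R / T\<close> are at most \<open>B / r ^ n\<close>. The product
  \<open>W l * \<zeta> ^ l\<close> is exactly the partial sum of the series of \<open>h\<close> at
  \<open>\<zeta>\<close>, and its distance from the full sum \<open>R \<zeta> / T \<zeta>\<close> is
  a geometric tail. All constants are explicit, which gives uniformity when \<open>R\<close>,
  \<open>T\<close> and \<open>\<zeta>\<close> vary with \<open>k\<close>.\<close>

theorem dominant_pole_coefficient:
  fixes R T :: "real poly" and W :: "nat \<Rightarrow> real"
  assumes eq: "Abs_fps W * fps_of_poly ([:1, - 1 / \<zeta>:] * T) = fps_of_poly R"
    and \<zeta>: "0 < \<zeta>" "\<zeta> < r"
    and nz: "\<And>z. cmod z \<le> r \<Longrightarrow> cpoly T z \<noteq> 0"
    and B: "\<And>z. cmod z \<le> r \<Longrightarrow> cmod (cpoly R z / cpoly T z) \<le> B"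
  shows "\<bar>W l * \<zeta> ^ l - poly R \<zeta> / poly T \<zeta>\<bar> \<le> B * (\<zeta> / r) ^ l / (1 - \<zeta> / r)"
proof -
  have r: "r > 0" using \<zeta> by simp
  define h where "h = Abs_fps W * fps_of_poly [:1, - 1 / \<zeta>:]"
  define f where "f z = cpoly R z / cpoly T z" for z
  have hT: "h * fps_of_poly T = fps_of_poly R"
    using eq unfolding h_def fps_of_poly_mult by (simp only: mult.assoc)
  have hn: "fps_nth h n = W n - (if n = 0 then 0 else W (n - 1) / \<zeta>)" for n
  proof -
    have lin: "fps_of_poly [:1, - 1 / \<zeta>:] = 1 - fps_const (1 / \<zeta>) * fps_X"
      by (simp add: fps_of_poly_pCons fps_of_poly_const fps_const_neg[symmetric] del: fps_const_neg)
    have "h = Abs_fps W - fps_const (1 / \<zeta>) * (fps_X * Abs_fps W)"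
      unfolding h_def lin by (simp add: algebra_simps)
    thus ?thesis by simp
  qed
  \<comment> \<open>Telescoping: each term is
    \<open>W j * \<zeta> ^ j - W (j - 1) * \<zeta> ^ (j - 1)\<close>, without the second part for
    \<open>j = 0\<close>.\<close>
  have tel: "W l * \<zeta> ^ l = (\<Sum>j\<le>l. fps_nth h j * \<zeta> ^ j)"
    using \<zeta> by (induction l) (auto simp: hn field_simps)
  have T0: "poly.coeff T 0 \<noteq> 0"
  proof -
    have "cpoly T (of_real 0) \<noteq> 0" using r by (intro nz) auto
    thus ?thesis unfolding cpoly_of_real by (simp add: poly_0_coeff_0)
  qed
  have coeff: "complex_of_real (fps_nth h n) = (deriv ^^ n) f 0 / fact n" for n
    using fps_poly_quotient_coefficient[OF hT T0, of n] unfolding f_def[abs_def] .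
  have holo: "f holomorphic_on ball 0 r"
    unfolding f_def using nz by (intro holomorphic_intros) auto
  have cont: "continuous_on (cball 0 r) f"
    unfolding f_def using nz by (intro continuous_intros) auto
  have hB: "\<bar>fps_nth h n\<bar> \<le> B / r ^ n" for n
  proof -
    have "cmod ((deriv ^^ n) f 0) \<le> fact n * B / r ^ n"
      using r B by (intro Cauchy_inequality[OF holo cont]) (auto simp: f_def)
    hence "cmod (complex_of_real (fps_nth h n)) \<le> B / r ^ n"
      unfolding coeff by (simp add: norm_divide field_simps)
    thus ?thesis by simp
  qed
  have "(\<lambda>n. (deriv ^^ n) f 0 / fact n * (of_real \<zeta> - 0) ^ n) sums f (of_real \<zeta>)"
    using \<zeta> by (intro holomorphic_power_series[OF holo]) auto
  hence "(\<lambda>n. complex_of_real (fps_nth h n * \<zeta> ^ n)) sums complex_of_real (poly R \<zeta> / poly T \<zeta>)"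
    by (simp add: coeff[symmetric] f_def)
  hence sums: "(\<lambda>n. fps_nth h n * \<zeta> ^ n) sums (poly R \<zeta> / poly T \<zeta>)"
    by (subst (asm) sums_of_real_iff)
  have tail: "(\<lambda>n. fps_nth h (n + Suc l) * \<zeta> ^ (n + Suc l)) sums (poly R \<zeta> / poly T \<zeta> - W l * \<zeta> ^ l)"
    using sums_split_initial_segment[OF sums, of "Suc l"] unfolding tel lessThan_Suc_atMost .
  define q where "q = \<zeta> / r"
  have q: "0 < q" "q < 1" using \<zeta> by (auto simp: q_def)
  have geo: "(\<lambda>n. B * q ^ l * q ^ n) sums (B * q ^ l * (1 / (1 - q)))"
    using q by (intro sums_mult geometric_sums) auto
  have "B \<ge> 0" using B[of 0] r by (intro order_trans[OF norm_ge_zero B[of 0]]) auto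
  have le: "norm (fps_nth h (n + Suc l) * \<zeta> ^ (n + Suc l)) \<le> B * q ^ l * q ^ n" for n
  proof -
    have "norm (fps_nth h (n + Suc l) * \<zeta> ^ (n + Suc l)) \<le> B / r ^ (n + Suc l) * \<zeta> ^ (n + Suc l)"
      unfolding real_norm_def abs_mult using hB[of "n + Suc l"] \<zeta> by (intro mult_mono) auto
    also have "\<dots> = B * q ^ (n + Suc l)" by (simp add: q_def power_divide)
    also have "\<dots> \<le> B * q ^ (n + l)"
      using q \<open>B \<ge> 0\<close> by (intro mult_left_mono power_decreasing) auto
    finally show ?thesis by (simp add: power_add mult_ac)
  qed
  have "norm (poly R \<zeta> / poly T \<zeta> - W l * \<zeta> ^ l) \<le> B * q ^ l * (1 / (1 - q))"
    by (rule norm_sums_le[OF tail geo le])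
  thus ?thesis by (simp add: q_def abs_minus_commute)
qed

section \<open>Perturbation terms that decay with k\<close>

text \<open>
  The model is \<open>c z\<^sup>d\<^sup>+\<^sup>k\<^sup>q / A\<^sup>k\<close> with \<open>q \<ge> 1\<close>, \<open>\<bar>A\<bar> \<ge> a\<^sup>q\<close> and \<open>\<bar>A\<bar> \<ge> b\<close>. The bounds in terms of \<open>b\<close> are
  only claimed where \<open>\<bar>z\<bar>\<^sup>k \<le> 2\<close>, which holds at \<open>\<zeta>\<^sub>k\<close> but not on a fixed disc of radius greater than 1.
\<close>

definition decaying :: "real \<Rightarrow> real \<Rightarrow> (nat \<Rightarrow> real poly) \<Rightarrow> bool" where
  "decaying a b P \<longleftrightarrow>
     (\<forall>k. \<forall>n<k. poly.coeff (P k) n = 0) \<and>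
     (\<forall>r. 1 \<le> r \<and> r < a \<longrightarrow> (\<exists>C\<ge>0. \<forall>k z. cmod z \<le> r \<longrightarrow>
        cmod (cpoly (P k) z) \<le> C * (r / a) ^ k \<and>
        cmod (cpoly (pderiv (P k)) z) \<le> C * (real k + 1) * (r / a) ^ k)) \<and>
     (\<exists>C\<ge>0. \<forall>k z. cmod z \<le> 2 \<and> cmod z ^ k \<le> 2 \<longrightarrow>
        cmod (cpoly (P k) z) \<le> C / b ^ k \<and>
        cmod (cpoly (pderiv (P k)) z) \<le> C * (real k + 1) / b ^ k)"

lemma decaying_0: "decaying a b (\<lambda>_. 0)"
  unfolding decaying_def by (auto intro: exI[of _ 0])

lemma decaying_mono:
  assumes "decaying a b P" "0 < b'" "b' \<le> b"
  shows "decaying a b' P"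
proof -
  obtain C where C: "C \<ge> 0" "\<And>k z. cmod z \<le> 2 \<Longrightarrow> cmod z ^ k \<le> 2 \<Longrightarrow>
        cmod (cpoly (P k) z) \<le> C / b ^ k \<and>
        cmod (cpoly (pderiv (P k)) z) \<le> C * (real k + 1) / b ^ k"
    using assms(1) unfolding decaying_def by blast
  have "C / b ^ k \<le> C / b' ^ k" "C * (real k + 1) / b ^ k \<le> C * (real k + 1) / b' ^ k" for k
    using assms C(1) by (auto intro!: divide_left_mono power_mono mult_pos_pos)
  with C have "\<exists>C\<ge>0. \<forall>k z. cmod z \<le> 2 \<and> cmod z ^ k \<le> 2 \<longrightarrow>
        cmod (cpoly (P k) z) \<le> C / b' ^ k \<and>
        cmod (cpoly (pderiv (P k)) z) \<le> C * (real k + 1) / b' ^ k"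
    by (meson order_trans)
  thus ?thesis using assms(1) unfolding decaying_def by blast
qed

lemma decaying_add:
  assumes P: "decaying a b P" and Q: "decaying a b Q"
  shows "decaying a b (\<lambda>k. P k + Q k)"
  unfolding decaying_def
proof (intro conjI allI impI)
  fix k n :: nat assume "n < k"
  thus "poly.coeff (P k + Q k) n = 0" using P Q unfolding decaying_def by simp
next
  fix r assume r: "1 \<le> r \<and> r < a"
  obtain C where C: "C \<ge> 0" "\<And>k z. cmod z \<le> r \<Longrightarrow> cmod (cpoly (P k) z) \<le> C * (r / a) ^ k \<and>
        cmod (cpoly (pderiv (P k)) z) \<le> C * (real k + 1) * (r / a) ^ k"
    using P r unfolding decaying_def by blast
  obtain D where D: "D \<ge> 0" "\<And>k z. cmod z \<le> r \<Longrightarrow> cmod (cpoly (Q k) z) \<le> D * (r / a) ^ k \<and>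
        cmod (cpoly (pderiv (Q k)) z) \<le> D * (real k + 1) * (r / a) ^ k"
    using Q r unfolding decaying_def by blast
  show "\<exists>C\<ge>0. \<forall>k z. cmod z \<le> r \<longrightarrow>
        cmod (cpoly (P k + Q k) z) \<le> C * (r / a) ^ k \<and>
        cmod (cpoly (pderiv (P k + Q k)) z) \<le> C * (real k + 1) * (r / a) ^ k"
    unfolding pderiv_add cpoly_add distrib_right
    using C D by (intro exI[of _ "C + D"] conjI allI impI) (auto simp: distrib_right intro!: order_trans[OF norm_triangle_ineq] add_mono)
next
  obtain C where C: "C \<ge> 0" "\<And>k z. cmod z \<le> 2 \<and> cmod z ^ k \<le> 2 \<Longrightarrow> cmod (cpoly (P k) z) \<le> C / b ^ k \<and>
        cmod (cpoly (pderiv (P k)) z) \<le> C * (real k + 1) / b ^ k"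
    using P unfolding decaying_def by blast
  obtain D where D: "D \<ge> 0" "\<And>k z. cmod z \<le> 2 \<and> cmod z ^ k \<le> 2 \<Longrightarrow> cmod (cpoly (Q k) z) \<le> D / b ^ k \<and>
        cmod (cpoly (pderiv (Q k)) z) \<le> D * (real k + 1) / b ^ k"
    using Q unfolding decaying_def by blast
  show "\<exists>C\<ge>0. \<forall>k z. cmod z \<le> 2 \<and> cmod z ^ k \<le> 2 \<longrightarrow>
        cmod (cpoly (P k + Q k) z) \<le> C / b ^ k \<and>
        cmod (cpoly (pderiv (P k + Q k)) z) \<le> C * (real k + 1) / b ^ k"
    unfolding pderiv_add cpoly_add
    using C D by (intro exI[of _ "C + D"] conjI allI impI) (auto simp: distrib_right add_divide_distrib intro!: order_trans[OF norm_triangle_ineq] add_mono)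
qed

lemma decaying_sum:
  assumes "finite I" "\<And>i. i \<in> I \<Longrightarrow> decaying a b (P i)"
  shows "decaying a b (\<lambda>k. \<Sum>i\<in>I. P i k)"
  using assms by (induction I rule: finite_induct) (auto intro: decaying_0 decaying_add)

text \<open>Serves the exponent of a derivative. Below 1 a smaller exponent increases the power,
  hence the case distinction; for \<open>n = 0\<close> truncated subtraction gives the value 1,
  which \<open>y\<close> also bounds.\<close>

lemma power_pred_le:
  fixes x :: real
  assumes "0 \<le> x" "x ^ n \<le> y" "1 \<le> y"
  shows "x ^ (n - 1) \<le> y"
proof (cases "x \<le> 1")
  case True
  thus ?thesis using assms power_le_one[of x "n - 1"] by linarith
next
  case False
  hence "x ^ (n - 1) \<le> x ^ n" by (intro power_increasing) auto
  with assms show ?thesis by linarith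
qed

text \<open>On the disc of radius \<open>r\<close>, each step in \<open>k\<close> contributes
  \<open>r ^ q / \<bar>A\<bar>\<close>, which is at most \<open>(r / a) ^ q\<close> and so at most
  \<open>r / a\<close>. Where \<open>cmod z ^ k \<le> 2\<close>, the power of \<open>z\<close> is
  bounded by \<open>2 ^ (d + q)\<close> and only \<open>1 / \<bar>A\<bar> ^ k\<close> remains.
  Differentiation costs the exponent \<open>d + k * q\<close>, whence the factor
  \<open>k + 1\<close>.\<close>

lemma decaying_monom:
  assumes a: "a > 1" and b: "b > 0" and q: "q \<ge> 1" and A: "\<bar>A\<bar> \<ge> a ^ q" "\<bar>A\<bar> \<ge> b"
  shows "decaying a b (\<lambda>k. monom (c / A ^ k) (d + k * q))"
  unfolding decaying_def
proof (intro conjI allI impI)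
  fix k n :: nat assume "n < k"
  moreover have "k * 1 \<le> k * q" using q by (rule mult_le_mono2)
  ultimately have "n < d + k * q" by linarith
  thus "poly.coeff (monom (c / A ^ k) (d + k * q)) n = 0" by simp
next
  have A0: "\<bar>A\<bar> > 0" using A(2) b by linarith
  have dN: "real (d + k * q) \<le> real (d + q) * (real k + 1)" for k
    by (simp add: algebra_simps)
  have D: "cpoly (pderiv (monom (c / A ^ k) n)) z = of_real (c / A ^ k) * of_nat n * z ^ (n - 1)" for k n z
    by (simp add: pderiv_monom mult_ac)
  have est: "cmod (cpoly (monom (c / A ^ k) (d + k * q)) z) \<le> \<bar>c\<bar> * M / \<bar>A\<bar> ^ k"
    "cmod (cpoly (pderiv (monom (c / A ^ k) (d + k * q))) z) \<le> \<bar>c\<bar> * real (d + q) * (real k + 1) * M / \<bar>A\<bar> ^ k"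
    if M: "cmod z ^ (d + k * q) \<le> M" "M \<ge> 1" for M k z
  proof -
    have "cmod (cpoly (monom (c / A ^ k) (d + k * q)) z) = \<bar>c\<bar> / \<bar>A\<bar> ^ k * cmod z ^ (d + k * q)"
      by (simp add: norm_mult norm_divide norm_power)
    also have "\<dots> \<le> \<bar>c\<bar> / \<bar>A\<bar> ^ k * M" using A0 M by (intro mult_left_mono) auto
    finally show "cmod (cpoly (monom (c / A ^ k) (d + k * q)) z) \<le> \<bar>c\<bar> * M / \<bar>A\<bar> ^ k" by simp
    have "cmod (cpoly (pderiv (monom (c / A ^ k) (d + k * q))) z) = \<bar>c\<bar> / \<bar>A\<bar> ^ k * real (d + k * q) * cmod z ^ (d + k * q - 1)"
      unfolding D norm_mult norm_of_nat norm_power by (simp add: norm_divide norm_power)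
    also have "\<dots> \<le> \<bar>c\<bar> / \<bar>A\<bar> ^ k * (real (d + q) * (real k + 1)) * M"
      using A0 M dN[of k] by (intro mult_mono mult_left_mono power_pred_le) auto
    finally show "cmod (cpoly (pderiv (monom (c / A ^ k) (d + k * q))) z) \<le> \<bar>c\<bar> * real (d + q) * (real k + 1) * M / \<bar>A\<bar> ^ k"
      by (simp add: mult_ac)
  qed
  define F where "F = \<bar>c\<bar> * (1 + real (d + q))"
  have F: "F \<ge> 0" "\<bar>c\<bar> \<le> F" "\<bar>c\<bar> * real (d + q) \<le> F" by (auto simp: F_def distrib_left)
  {
    fix r assume r: "1 \<le> r \<and> r < a"
    show "\<exists>C\<ge>0. \<forall>k z. cmod z \<le> r \<longrightarrow>
          cmod (cpoly (monom (c / A ^ k) (d + k * q)) z) \<le> C * (r / a) ^ k \<and>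
          cmod (cpoly (pderiv (monom (c / A ^ k) (d + k * q))) z) \<le> C * (real k + 1) * (r / a) ^ k"
    proof (intro exI[of _ "F * r ^ d"] conjI allI impI)
      show "F * r ^ d \<ge> 0" using F r by auto
      fix k z assume z: "cmod z \<le> r"
      have M: "cmod z ^ (d + k * q) \<le> r ^ (d + k * q)" "r ^ (d + k * q) \<ge> 1"
        using z r by (auto intro: power_mono one_le_power)
      have key: "r ^ (d + k * q) / \<bar>A\<bar> ^ k \<le> r ^ d * (r / a) ^ k"
      proof -
        have "r ^ (d + k * q) / \<bar>A\<bar> ^ k = r ^ d * (r ^ q / \<bar>A\<bar>) ^ k"
          by (simp add: power_add power_mult power_divide mult.commute[of k])
        also have "\<dots> \<le> r ^ d * (r / a) ^ k"
        proof (intro mult_left_mono power_mono)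
          have "r ^ q / \<bar>A\<bar> \<le> r ^ q / a ^ q"
            using A(1) a r A0 by (intro divide_left_mono mult_pos_pos) auto
          also have "\<dots> = (r / a) ^ q" by (simp add: power_divide)
          also have "\<dots> \<le> (r / a) ^ 1" using q r a by (intro power_decreasing) auto
          finally show "r ^ q / \<bar>A\<bar> \<le> r / a" by simp
        qed (use r in auto)
        finally show ?thesis .
      qed
      have "cmod (cpoly (monom (c / A ^ k) (d + k * q)) z) \<le> \<bar>c\<bar> * (r ^ (d + k * q) / \<bar>A\<bar> ^ k)"
        using est(1)[OF M] by simp
      also have "\<dots> \<le> F * (r ^ d * (r / a) ^ k)"
        using F key r a by (intro mult_mono) auto
      finally show "cmod (cpoly (monom (c / A ^ k) (d + k * q)) z) \<le> F * r ^ d * (r / a) ^ k"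
        by (simp add: mult.assoc)
      have "cmod (cpoly (pderiv (monom (c / A ^ k) (d + k * q))) z) \<le> \<bar>c\<bar> * real (d + q) * (real k + 1) * (r ^ (d + k * q) / \<bar>A\<bar> ^ k)"
        using est(2)[OF M] by simp
      also have "\<dots> \<le> F * (real k + 1) * (r ^ d * (r / a) ^ k)"
        using F key r a by (intro mult_mono mult_right_mono) auto
      finally show "cmod (cpoly (pderiv (monom (c / A ^ k) (d + k * q))) z) \<le> F * r ^ d * (real k + 1) * (r / a) ^ k"
        by (simp add: mult_ac)
    qed
  }
  show "\<exists>C\<ge>0. \<forall>k z. cmod z \<le> 2 \<and> cmod z ^ k \<le> 2 \<longrightarrow>
          cmod (cpoly (monom (c / A ^ k) (d + k * q)) z) \<le> C / b ^ k \<and>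
          cmod (cpoly (pderiv (monom (c / A ^ k) (d + k * q))) z) \<le> C * (real k + 1) / b ^ k"
  proof (intro exI[of _ "F * 2 ^ (d + q)"] conjI allI impI)
    show "F * 2 ^ (d + q) \<ge> 0" using F by auto
    fix k z assume z: "cmod z \<le> 2 \<and> cmod z ^ k \<le> 2"
    have "cmod z ^ (d + k * q) = cmod z ^ d * (cmod z ^ k) ^ q" by (simp add: power_add power_mult)
    also have "\<dots> \<le> 2 ^ d * 2 ^ q" using z by (intro mult_mono power_mono) auto
    finally have M: "cmod z ^ (d + k * q) \<le> 2 ^ (d + q)" "2 ^ (d + q) \<ge> (1::real)"
      by (simp_all only: power_add[symmetric]) (rule one_le_power, simp)
    have key: "1 / \<bar>A\<bar> ^ k \<le> 1 / b ^ k" using A b A0 by (intro divide_left_mono power_mono mult_pos_pos) auto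
    have "cmod (cpoly (monom (c / A ^ k) (d + k * q)) z) \<le> \<bar>c\<bar> * 2 ^ (d + q) * (1 / \<bar>A\<bar> ^ k)"
      using est(1)[OF M] by simp
    also have "\<dots> \<le> F * 2 ^ (d + q) * (1 / b ^ k)"
      using F key A0 by (intro mult_mono mult_right_mono) auto
    finally show "cmod (cpoly (monom (c / A ^ k) (d + k * q)) z) \<le> F * 2 ^ (d + q) / b ^ k" by simp
    have "cmod (cpoly (pderiv (monom (c / A ^ k) (d + k * q))) z) \<le> \<bar>c\<bar> * real (d + q) * (2 ^ (d + q) * (real k + 1)) * (1 / \<bar>A\<bar> ^ k)"
      using est(2)[OF M] by (simp add: mult_ac)
    also have "\<dots> \<le> F * (2 ^ (d + q) * (real k + 1)) * (1 / b ^ k)"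
      using F key A0 by (intro mult_mono mult_right_mono) auto
    finally show "cmod (cpoly (pderiv (monom (c / A ^ k) (d + k * q))) z) \<le> F * 2 ^ (d + q) * (real k + 1) / b ^ k"
      by (simp add: mult_ac)
  qed
qed

section \<open>Substitution into the multivariate polynomials\<close>

lemma prod_monom: "(\<Prod>i\<in>I. monom (c i) (n i)) = monom (\<Prod>i\<in>I. c i :: 'a :: comm_semiring_1) (\<Sum>i\<in>I. n i)"
proof (induction I rule: infinite_finite_induct)
  case (insert x I)
  thus ?case by (simp add: mult_monom)
qed (simp_all add: monom_0 one_pCons)

lemma monom_pow: "monom (c :: 'a :: comm_semiring_1) n ^ k = monom (c ^ k) (n * k)"
  by (induction k) (simp_all add: mult_monom monom_0 one_pCons)

text \<open>After substitution the monomial \<open>e\<close> becomes a multiple of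
  \<open>z ^ (d + k * q) / A ^ k\<close>. Here \<open>A\<close> is \<open>geom_base a e\<close>,
  \<open>q\<close> is \<open>geom_degree e\<close> and \<open>d\<close> is the exponent of variable
  0, which stands for \<open>z\<close> and contributes to neither.\<close>

definition geom_base :: "(nat \<Rightarrow> real) \<Rightarrow> (nat \<Rightarrow>\<^sub>0 nat) \<Rightarrow> real" where
  "geom_base a e = (\<Prod>i\<in>Poly_Mapping.keys e - {0}. a i ^ Poly_Mapping.lookup e i)"

definition geom_degree :: "(nat \<Rightarrow>\<^sub>0 nat) \<Rightarrow> nat" where
  "geom_degree e = (\<Sum>i\<in>Poly_Mapping.keys e - {0}. Poly_Mapping.lookup e i)"

lemma mpoly_subst_arg_poly:
  "mpoly_subst (arg_poly a k) p = (\<Sum>e\<in>Poly_Mapping.keys p.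
     monom (Poly_Mapping.lookup p e / geom_base a e ^ k) (Poly_Mapping.lookup e 0 + k * geom_degree e))"
proof -
  have arg: "arg_poly a k i ^ n = monom ((1 / a i ^ n) ^ k) (k * n)" if "i \<noteq> 0" for i n
  proof -
    have "arg_poly a k i = monom ((1 / a i) ^ k) k"
      using that by (simp add: arg_poly_def monom_Suc[of _ 0, unfolded monom_0, symmetric] monom_pow)
    thus ?thesis by (simp add: monom_pow power_divide mult.commute flip: power_mult)
  qed
  have "(\<Prod>i\<in>Poly_Mapping.keys e. arg_poly a k i ^ Poly_Mapping.lookup e i)
      = monom (1 / geom_base a e ^ k) (Poly_Mapping.lookup e 0 + k * geom_degree e)" for e
  proof -
    \<comment> \<open>Index 0 is inserted so that its factor can be split off even if
      \<open>z\<close> does not occur; its exponent is then 0.\<close>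
    have "(\<Prod>i\<in>Poly_Mapping.keys e. arg_poly a k i ^ Poly_Mapping.lookup e i)
       = (\<Prod>i\<in>insert 0 (Poly_Mapping.keys e). arg_poly a k i ^ Poly_Mapping.lookup e i)"
      by (intro prod.mono_neutral_left) (auto simp: in_keys_iff)
    also have "\<dots> = arg_poly a k 0 ^ Poly_Mapping.lookup e 0
        * (\<Prod>i\<in>Poly_Mapping.keys e - {0}. arg_poly a k i ^ Poly_Mapping.lookup e i)"
      by (simp add: prod.insert_remove)
    also have "(\<Prod>i\<in>Poly_Mapping.keys e - {0}. arg_poly a k i ^ Poly_Mapping.lookup e i)
        = (\<Prod>i\<in>Poly_Mapping.keys e - {0}. monom ((1 / a i ^ Poly_Mapping.lookup e i) ^ k) (k * Poly_Mapping.lookup e i))"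
      by (intro prod.cong arg) auto
    also have "\<dots> = monom (1 / geom_base a e ^ k) (k * geom_degree e)"
      unfolding prod_monom geom_base_def geom_degree_def
      by (simp add: prod_power_distrib[symmetric] prod_dividef power_one_over sum_distrib_left)
    also have "arg_poly a k 0 ^ Poly_Mapping.lookup e 0 = monom 1 (Poly_Mapping.lookup e 0)"
      by (simp add: arg_poly_def monom_altdef)
    finally show ?thesis by (simp add: mult_monom)
  qed
  thus ?thesis by (simp add: mpoly_subst_def smult_monom)
qed

text \<open>Every \<open>\<bar>a i\<bar>\<close> that occurs is at least \<open>a 1\<close>, hence
  at least 1, so the product can be bounded factor by factor or by a single factor.\<close>

lemma geom_base_bounds:
  assumes a1: "1 < a 1" and aj: "\<And>j. 1 \<le> j \<Longrightarrow> j \<le> m \<Longrightarrow> a 1 \<le> \<bar>a j\<bar>"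
    and e: "Poly_Mapping.keys e \<subseteq> {0..m}"
  shows "\<bar>geom_base a e\<bar> \<ge> a 1 ^ geom_degree e"
    and "j \<ge> 1 \<Longrightarrow> Poly_Mapping.lookup e j \<ge> 1 \<Longrightarrow> \<bar>geom_base a e\<bar> \<ge> \<bar>a j\<bar> \<and> geom_degree e \<ge> Poly_Mapping.lookup e j"
proof -
  have ge: "a 1 \<le> \<bar>a i\<bar>" if "i \<in> Poly_Mapping.keys e - {0}" for i
    using that e by (intro aj) auto
  have abs: "\<bar>geom_base a e\<bar> = (\<Prod>i\<in>Poly_Mapping.keys e - {0}. \<bar>a i\<bar> ^ Poly_Mapping.lookup e i)"
    by (simp add: geom_base_def abs_prod power_abs)
  have "a 1 ^ geom_degree e = (\<Prod>i\<in>Poly_Mapping.keys e - {0}. a 1 ^ Poly_Mapping.lookup e i)"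
    by (simp add: geom_degree_def power_sum)
  also have "\<dots> \<le> \<bar>geom_base a e\<bar>"
    unfolding abs using ge a1 by (intro prod_mono conjI power_mono) auto
  finally show "\<bar>geom_base a e\<bar> \<ge> a 1 ^ geom_degree e" .
  assume j: "j \<ge> 1" "Poly_Mapping.lookup e j \<ge> 1"
  hence jk: "j \<in> Poly_Mapping.keys e - {0}" by (auto simp: in_keys_iff)
  have gt1: "1 \<le> \<bar>a i\<bar>" if "i \<in> Poly_Mapping.keys e - {0}" for i
    using ge[OF that] a1 by linarith
  have "\<bar>a j\<bar> * 1 \<le> \<bar>a j\<bar> ^ Poly_Mapping.lookup e j * (\<Prod>i\<in>Poly_Mapping.keys e - {0} - {j}. \<bar>a i\<bar> ^ Poly_Mapping.lookup e i)"
  proof (intro mult_mono)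
    show "\<bar>a j\<bar> \<le> \<bar>a j\<bar> ^ Poly_Mapping.lookup e j"
      using power_increasing[OF j(2) gt1[OF jk]] by simp
    show "1 \<le> (\<Prod>i\<in>Poly_Mapping.keys e - {0} - {j}. \<bar>a i\<bar> ^ Poly_Mapping.lookup e i)"
      using gt1 by (intro prod_ge_1 one_le_power) auto
  qed auto
  also have "\<dots> = \<bar>geom_base a e\<bar>"
    unfolding abs using jk by (subst prod.remove[of _ j]) auto
  finally have 1: "\<bar>a j\<bar> \<le> \<bar>geom_base a e\<bar>" by simp
  have "Poly_Mapping.lookup e j \<le> geom_degree e"
    unfolding geom_degree_def using jk by (intro member_le_sum) auto
  with 1 show "\<bar>geom_base a e\<bar> \<ge> \<bar>a j\<bar> \<and> geom_degree e \<ge> Poly_Mapping.lookup e j" by blast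
qed

lemma decaying_r1:
  assumes a1: "1 < a 1" and aj: "\<And>j. 1 \<le> j \<Longrightarrow> j \<le> m \<Longrightarrow> a 1 \<le> \<bar>a j\<bar>"
    and p: "r1_admissible m p"
  shows "decaying (a 1) (a 1) (\<lambda>k. mpoly_subst (arg_poly a k) p)"
  unfolding mpoly_subst_arg_poly
proof (intro decaying_sum decaying_monom)
  fix e assume e: "e \<in> Poly_Mapping.keys p"
  then obtain j where j: "j \<in> {1..m}" "Poly_Mapping.lookup e j \<ge> 1" and sub: "Poly_Mapping.keys e \<subseteq> {0..m}"
    using p unfolding r1_admissible_def mpoly_in_vars_def by blast
  note b = geom_base_bounds[where a = a and m = m and e = e, OF a1 aj sub]
  show "\<bar>geom_base a e\<bar> \<ge> a 1 ^ geom_degree e" by (rule b(1))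
  show "1 \<le> geom_degree e" "a 1 \<le> \<bar>geom_base a e\<bar>" using b(2)[of j] j aj[of j] by auto
qed (use a1 in auto)

text \<open>The two alternatives of \<open>s2_admissible\<close> give the two candidates for the
  rate: a square of variable 1 forces degree at least 2 and
  \<open>\<bar>A\<bar> \<ge> (a 1)\<^sup>2\<close>, a variable with index at least 2 forces
  \<open>\<bar>A\<bar> \<ge> \<bar>a 2\<bar>\<close>.\<close>

lemma decaying_s2:
  assumes a1: "1 < a 1" and a2: "2 \<le> m" "a 1 < \<bar>a 2\<bar>" "\<And>j. 2 \<le> j \<Longrightarrow> j \<le> m \<Longrightarrow> \<bar>a 2\<bar> \<le> \<bar>a j\<bar>"
    and p: "s2_admissible m p"
  shows "decaying (a 1) (min \<bar>a 2\<bar> ((a 1)\<^sup>2)) (\<lambda>k. mpoly_subst (arg_poly a k) p)"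
  unfolding mpoly_subst_arg_poly
proof (intro decaying_sum decaying_monom)
  have aj: "a 1 \<le> \<bar>a j\<bar>" if "1 \<le> j" "j \<le> m" for j
    using that a2(2) a2(3)[of j] by (cases "j = 1") auto
  fix e assume e: "e \<in> Poly_Mapping.keys p"
  then have sub: "Poly_Mapping.keys e \<subseteq> {0..m}" and
    *: "Poly_Mapping.lookup e 1 \<ge> 2 \<or> (\<exists>j\<in>{2..m}. Poly_Mapping.lookup e j \<ge> 1)"
    using p unfolding s2_admissible_def mpoly_in_vars_def by blast+
  note b = geom_base_bounds[where a = a and m = m and e = e, OF a1 aj sub]
  show b1: "\<bar>geom_base a e\<bar> \<ge> a 1 ^ geom_degree e" by (rule b(1))
  from * have "1 \<le> geom_degree e \<and> min \<bar>a 2\<bar> ((a 1)\<^sup>2) \<le> \<bar>geom_base a e\<bar>"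
  proof
    assume l: "Poly_Mapping.lookup e 1 \<ge> 2"
    hence g: "geom_degree e \<ge> 2" using b(2)[of 1] by auto
    have "(a 1)\<^sup>2 \<le> a 1 ^ geom_degree e" using g a1 by (intro power_increasing) auto
    with b1 g show ?thesis by auto
  next
    assume "\<exists>j\<in>{2..m}. Poly_Mapping.lookup e j \<ge> 1"
    then obtain j where j: "2 \<le> j" "j \<le> m" "Poly_Mapping.lookup e j \<ge> 1" by auto
    have "\<bar>a 2\<bar> \<le> \<bar>geom_base a e\<bar>" "1 \<le> geom_degree e"
      using b(2)[of j] j a2(3)[of j] by auto
    thus ?thesis by auto
  qed
  thus "1 \<le> geom_degree e" "min \<bar>a 2\<bar> ((a 1)\<^sup>2) \<le> \<bar>geom_base a e\<bar>" by blast+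
qed (use a1 a2 in auto)

section \<open>The dominant zero of the denominator\<close>

text \<open>The multivariate polynomials enter only through their decay: \<open>P\<close> stands for
  the perturbation of the numerator, \<open>Q\<close> for the part of the denominator beyond the
  first-order term with \<open>s1\<close>.\<close>

locale perturbed_pole =
  fixes a b :: real and r0 s0 s1 :: "real poly" and P Q :: "nat \<Rightarrow> real poly"
  assumes a: "1 < a" and ab: "a < b" and ba: "b \<le> a\<^sup>2"
    and P: "decaying a a P" and Q: "decaying a b Q"
    and r0_1: "poly r0 1 \<noteq> 0"
    and s0_nz: "\<And>z. cmod z \<le> 1 \<Longrightarrow> cpoly s0 z \<noteq> 0"
    and delta_pos: "delta s0 s1 > 0"
begin

abbreviation "\<delta> \<equiv> delta s0 s1"

definition R :: "nat \<Rightarrow> real poly" where "R k = r0 + P k"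
definition E :: "nat \<Rightarrow> real poly" where "E k = monom (1 / a ^ k) k * s1 + Q k"
definition S :: "nat \<Rightarrow> real poly" where "S k = [:1, -1:] * s0 + E k"

lemma s01: "poly s0 1 \<noteq> 0"
  using s0_nz[of "of_real 1"] by (simp del: of_real_1)

lemma s11: "poly s1 1 = \<delta> * poly s0 1"
  using s01 by (simp add: delta_def)

text \<open>The full perturbation \<open>E\<close> decays only at rate \<open>a\<close>, since it
  contains the first-order term; expanding \<open>s1\<close> into monomials reduces that term to
  \<open>decaying_monom\<close>.\<close>

lemma decaying_E: "decaying a a E"
proof -
  have "monom (1 / a ^ k) k * s1 = (\<Sum>i\<le>degree s1. monom (poly.coeff s1 i / a ^ k) (i + k * 1))" for k
  proof -
    have "monom (1 / a ^ k) k * s1 = monom (1 / a ^ k) k * (\<Sum>i\<le>degree s1. monom (poly.coeff s1 i) i)"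
      by (simp only: poly_as_sum_of_monoms)
    also have "\<dots> = (\<Sum>i\<le>degree s1. monom (poly.coeff s1 i / a ^ k) (i + k * 1))"
      unfolding sum_distrib_left by (intro sum.cong) (auto simp: mult_monom add.commute)
    finally show ?thesis .
  qed
  moreover have "decaying a a (\<lambda>k. \<Sum>i\<le>degree s1. monom (poly.coeff s1 i / a ^ k) (i + k * 1))"
    using a by (intro decaying_sum decaying_monom) auto
  ultimately have "decaying a a (\<lambda>k. monom (1 / a ^ k) k * s1)" by (simp only:)
  moreover have "decaying a a Q" using Q by (rule decaying_mono) (use a ab in auto)
  ultimately show ?thesis unfolding E_def[abs_def] by (rule decaying_add)
qed

text \<open>The zeros of \<open>s0\<close> in the closed disc of radius \<open>a\<close> form a
  compact set, so one has least modulus, greater than 1; the radius lies halfway between 1 and that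
  modulus. The lower bound \<open>m0\<close> is a minimum over the smaller closed disc.\<close>

lemma exists_radius:
  obtains r m0 where "1 < r" "r < a" "m0 > 0" "\<And>z. cmod z \<le> r \<Longrightarrow> m0 \<le> cmod (cpoly s0 z)"
proof -
  define Z where "Z = {z \<in> cball 0 a. cpoly s0 z = 0}"
  have "\<exists>r. 1 < r \<and> r < a \<and> (\<forall>z. cmod z \<le> r \<longrightarrow> cpoly s0 z \<noteq> 0)"
  proof (cases "Z = {}")
    case True
    thus ?thesis using a by (intro exI[of _ "(1 + a) / 2"]) (auto simp: Z_def)
  next
    case False
    have "closed Z"
      unfolding Z_def by (intro continuous_closed_preimage_constant continuous_intros) auto
    hence "compact (cball 0 a \<inter> Z)" by (intro compact_Int_closed) auto
    also have "cball 0 a \<inter> Z = Z" by (auto simp: Z_def)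
    finally have "compact Z" .
    then obtain z0 where z0: "z0 \<in> Z" "\<And>z. z \<in> Z \<Longrightarrow> cmod z0 \<le> cmod z"
      using continuous_attains_inf[of Z norm] False by (auto intro: continuous_intros)
    have n0: "cmod z0 > 1" "cmod z0 \<le> a" using z0(1) s0_nz[of z0] by (auto simp: Z_def not_le[symmetric])
    show ?thesis
    proof (intro exI[of _ "(1 + cmod z0) / 2"] conjI allI impI notI)
      fix z assume z: "cmod z \<le> (1 + cmod z0) / 2" "cpoly s0 z = 0"
      hence "z \<in> Z" using n0 by (auto simp: Z_def)
      from order_trans[OF z0(2)[OF this] z(1)] n0(1) show False by (simp add: field_simps)
    qed (use n0 in auto)
  qed
  then obtain r where r: "1 < r" "r < a" "\<And>z. cmod z \<le> r \<Longrightarrow> cpoly s0 z \<noteq> 0" by blast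
  have "continuous_on (cball 0 r) (\<lambda>z. cmod (cpoly s0 z))" by (intro continuous_intros)
  then obtain z1 where z1: "z1 \<in> cball 0 r" "\<And>z. z \<in> cball 0 r \<Longrightarrow> cmod (cpoly s0 z1) \<le> cmod (cpoly s0 z)"
    using continuous_attains_inf[of "cball 0 r" "\<lambda>z. cmod (cpoly s0 z)"] r by auto
  show ?thesis
    by (rule that[OF r(1,2), of "cmod (cpoly s0 z1)"]) (use z1 r in auto)
qed

lemma decaying_real:
  assumes "decaying a c F"
  obtains C where "C \<ge> 0"
    "\<And>k x. 1 \<le> x \<Longrightarrow> x \<le> 2 \<Longrightarrow> x ^ k \<le> 2 \<Longrightarrow> \<bar>poly (F k) x\<bar> \<le> C / c ^ k"
    "\<And>k x. 1 \<le> x \<Longrightarrow> x \<le> 2 \<Longrightarrow> x ^ k \<le> 2 \<Longrightarrow> \<bar>poly (pderiv (F k)) x\<bar> \<le> C * (real k + 1) / c ^ k"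
proof -
  obtain C where C: "C \<ge> 0" "\<And>k z. cmod z \<le> 2 \<Longrightarrow> cmod z ^ k \<le> 2 \<Longrightarrow>
        cmod (cpoly (F k) z) \<le> C / c ^ k \<and>
        cmod (cpoly (pderiv (F k)) z) \<le> C * (real k + 1) / c ^ k"
    using assms unfolding decaying_def by blast
  show ?thesis
  proof (rule that[OF C(1)])
    fix k x assume "1 \<le> x" "x \<le> 2" "x ^ k \<le> (2::real)"
    with C(2)[of "of_real x" k] show "\<bar>poly (F k) x\<bar> \<le> C / c ^ k" "\<bar>poly (pderiv (F k)) x\<bar> \<le> C * (real k + 1) / c ^ k"
      by auto
  qed
qed

lemma poly_Lipschitz_1:
  fixes p :: "real poly"
  obtains L where "L > 0" "\<And>x. 1 \<le> x \<Longrightarrow> x \<le> 2 \<Longrightarrow> \<bar>poly p x - poly p 1\<bar> \<le> L * (x - 1)"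
    "\<And>x. 1 \<le> x \<Longrightarrow> x \<le> 2 \<Longrightarrow> \<bar>poly p x\<bar> \<le> L"
proof -
  obtain L where L: "L > 0" "\<And>z w. cmod z \<le> 2 \<Longrightarrow> cmod w \<le> 2 \<Longrightarrow> cmod (cpoly p z - cpoly p w) \<le> L * cmod (z - w)"
    using cpoly_Lipschitz[of 2 p] by blast
  obtain M where M: "M > 0" "\<And>z. cmod z \<le> 2 \<Longrightarrow> cmod (cpoly p z) \<le> M"
    using cpoly_bounded[of 2 p] by blast
  show ?thesis
  proof (rule that[of "L + M"])
    fix x :: real assume x: "1 \<le> x" "x \<le> 2"
    have "\<bar>poly p x - poly p 1\<bar> \<le> L * (x - 1)"
      using L(2)[of "of_real x" "of_real 1"] x unfolding cpoly_of_real of_real_diff[symmetric] norm_of_real by simp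
    also have "\<dots> \<le> (L + M) * (x - 1)" using M x by (intro mult_right_mono) auto
    finally show "\<bar>poly p x - poly p 1\<bar> \<le> (L + M) * (x - 1)" .
    show "\<bar>poly p x\<bar> \<le> L + M" using M(2)[of "of_real x"] L x by simp
  qed (use L M in auto)
qed

text \<open>Points within \<open>O(1 / a ^ k)\<close> of 1 thus satisfy \<open>x ^ k \<le> 2\<close>
  for large \<open>k\<close>, which is the side condition of the sharp bounds in
  \<open>decaying\<close>.\<close>

lemma tendsto_shifted_power:
  fixes d :: real assumes "d > 0"
  shows "(\<lambda>k. (1 + d / a ^ k) ^ k) \<longlonglongrightarrow> 1" "(\<lambda>k. 1 + d / a ^ k) \<longlonglongrightarrow> 1"
  using a assms by real_asymp+

lemma tendsto_ratio: "(\<lambda>k. a ^ k * (1 / b ^ k)) \<longlonglongrightarrow> 0"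
  using a ab by real_asymp

text \<open>To first order the zero is \<open>1 + \<delta> / a ^ k\<close>; doubling the shift
  leaves room for a change of sign.\<close>

definition is_root :: "nat \<Rightarrow> real \<Rightarrow> bool" where
  "is_root k x \<longleftrightarrow> 1 < x \<and> x < 1 + 2 * \<delta> / a ^ k \<and> poly (S k) x = 0"

lemma S_eval: "poly (S k) x = (1 - x) * poly s0 x + x ^ k / a ^ k * poly s1 x + poly (Q k) x"
  by (simp add: S_def E_def poly_monom algebra_simps)

text \<open>Multiplied by \<open>a ^ k\<close>, the values of \<open>S k\<close> at the two ends of
  the interval tend to \<open>poly s1 1\<close> and, as \<open>2 * \<delta> * poly s0 1\<close> is
  \<open>2 * poly s1 1\<close>, to its negative. So their product is eventually negative, whatever
  the sign of \<open>poly s1 1\<close>.\<close>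

lemma eventually_root: "\<forall>\<^sub>F k in sequentially. \<exists>x. is_root k x"
proof -
  obtain C where C: "C \<ge> 0" "\<And>k x. 1 \<le> x \<Longrightarrow> x \<le> 2 \<Longrightarrow> x ^ k \<le> 2 \<Longrightarrow> \<bar>poly (Q k) x\<bar> \<le> C / b ^ k"
    using decaying_real[OF Q] by metis
  define y where "y k = 1 + 2 * \<delta> / a ^ k" for k
  have d2: "2 * \<delta> > 0" using delta_pos by simp
  have y1: "y \<longlonglongrightarrow> 1" and yk: "(\<lambda>k. y k ^ k) \<longlonglongrightarrow> 1"
    unfolding y_def using tendsto_shifted_power[OF d2] by auto
  have ygt: "y k > 1" for k using d2 a by (simp add: y_def)
  have ev: "\<forall>\<^sub>F k in sequentially. y k < 2 \<and> y k ^ k < 2"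
    using order_tendstoD(2)[OF y1, of 2] order_tendstoD(2)[OF yk, of 2] by (simp add: eventually_conj)
  have bpos: "b > 0" using a ab by simp
  have Q0: "(\<lambda>k. a ^ k * poly (Q k) (x k)) \<longlonglongrightarrow> 0"
    if "\<forall>\<^sub>F k in sequentially. 1 \<le> x k \<and> x k \<le> 2 \<and> x k ^ k \<le> 2" for x
  proof (rule Lim_null_comparison)
    show "\<forall>\<^sub>F k in sequentially. norm (a ^ k * poly (Q k) (x k)) \<le> C * (a ^ k * (1 / b ^ k))"
      using that
    proof eventually_elim
      case (elim k)
      have "norm (a ^ k * poly (Q k) (x k)) \<le> a ^ k * (C / b ^ k)"
        unfolding real_norm_def abs_mult using elim a by (intro mult_mono C(2)) auto
      thus ?case by (simp add: mult_ac)
    qed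
    show "(\<lambda>k. C * (a ^ k * (1 / b ^ k))) \<longlonglongrightarrow> 0"
      by (rule tendsto_mult_right_zero[OF tendsto_ratio])
  qed
  have l1: "(\<lambda>k. a ^ k * poly (S k) 1) \<longlonglongrightarrow> poly s1 1"
  proof -
    have "(\<lambda>k. poly s1 1 + a ^ k * poly (Q k) 1) \<longlonglongrightarrow> poly s1 1 + 0"
      by (intro tendsto_add tendsto_const Q0) auto
    thus ?thesis using a by (simp add: S_eval distrib_left)
  qed
  have l2: "(\<lambda>k. a ^ k * poly (S k) (y k)) \<longlonglongrightarrow> - poly s1 1"
  proof -
    have "(\<lambda>k. - 2 * \<delta> * poly s0 (y k) + y k ^ k * poly s1 (y k) + a ^ k * poly (Q k) (y k))
       \<longlonglongrightarrow> - 2 * \<delta> * poly s0 1 + 1 * poly s1 1 + 0"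
      using ev ygt by (intro tendsto_intros y1 yk Q0) (auto elim!: eventually_mono simp: less_imp_le)
    moreover have "a ^ k * poly (S k) (y k) = - 2 * \<delta> * poly s0 (y k) + y k ^ k * poly s1 (y k) + a ^ k * poly (Q k) (y k)" for k
    proof -
      have "a ^ k * (1 - y k) = - 2 * \<delta>" using a by (simp add: y_def)
      moreover have "a ^ k * (y k ^ k / a ^ k) = y k ^ k" using a by simp
      ultimately show ?thesis unfolding S_eval distrib_left mult.assoc[symmetric] by (simp only:)
    qed
    ultimately show ?thesis by (simp add: s11)
  qed
  have "(\<lambda>k. (a ^ k * poly (S k) 1) * (a ^ k * poly (S k) (y k))) \<longlonglongrightarrow> poly s1 1 * (- poly s1 1)"
    by (intro tendsto_mult l1 l2)
  moreover have "poly s1 1 * (- poly s1 1) < 0"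
  proof -
    have "poly s1 1 \<noteq> 0" using s11 s01 delta_pos by simp
    hence "0 < poly s1 1 * poly s1 1" by (metis not_real_square_gt_zero)
    thus ?thesis by simp
  qed
  ultimately have "\<forall>\<^sub>F k in sequentially. (a ^ k * poly (S k) 1) * (a ^ k * poly (S k) (y k)) < 0"
    by (rule order_tendstoD(2))
  thus ?thesis
  proof eventually_elim
    case (elim k)
    have "(a ^ k * a ^ k) * (poly (S k) 1 * poly (S k) (y k)) < 0" using elim by (simp add: mult_ac)
    moreover have "a ^ k * a ^ k > 0" using a by simp
    ultimately have "poly (S k) 1 * poly (S k) (y k) < 0"
      by (simp add: mult_less_0_iff)
    from poly_IVT[OF ygt this] show ?case by (auto simp: is_root_def y_def)
  qed
qed

text \<open>Meaningful only for large \<open>k\<close>; all statements about it hold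
  eventually.\<close>

definition \<zeta> :: "nat \<Rightarrow> real" where "\<zeta> k = (SOME x. is_root k x)"

lemma eventually_zeta:
  "\<forall>\<^sub>F k in sequentially. is_root k (\<zeta> k) \<and> \<zeta> k ^ k \<le> 2 \<and> \<zeta> k \<le> 2"
proof -
  have d2: "2 * \<delta> > 0" using delta_pos by simp
  have "\<forall>\<^sub>F k in sequentially. (1 + 2 * \<delta> / a ^ k) ^ k < 2" "\<forall>\<^sub>F k in sequentially. 1 + 2 * \<delta> / a ^ k < 2"
    using order_tendstoD(2)[OF tendsto_shifted_power(1)[OF d2], of 2]
      order_tendstoD(2)[OF tendsto_shifted_power(2)[OF d2], of 2] by simp_all
  with eventually_root show ?thesis
  proof eventually_elim
    case (elim k)
    have r: "is_root k (\<zeta> k)" using elim(1) unfolding \<zeta>_def by (rule someI_ex)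
    hence z: "1 < \<zeta> k" "\<zeta> k < 1 + 2 * \<delta> / a ^ k" by (auto simp: is_root_def)
    hence "\<zeta> k ^ k \<le> (1 + 2 * \<delta> / a ^ k) ^ k" by (intro power_mono) auto
    with r z elim show ?case by auto
  qed
qed

lemma power_diff_1_le:
  fixes x :: real assumes "1 \<le> x" "x ^ k \<le> M"
  shows "x ^ k - 1 \<le> M * real k * (x - 1)"
proof -
  have "x ^ k - 1 = (x - 1) * (\<Sum>i<k. x ^ i)" by (rule power_diff_1_eq)
  also have "\<dots> \<le> (x - 1) * (\<Sum>i<k. M)"
  proof (intro mult_left_mono sum_mono)
    fix i assume "i \<in> {..<k}"
    hence "x ^ i \<le> x ^ k" using assms by (intro power_increasing) auto
    with assms show "x ^ i \<le> M" by linarith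
  qed (use assms in auto)
  finally show ?thesis by (simp add: mult_ac)
qed

text \<open>The equation for the zero is compared with its linearization
  \<open>poly s0 1 * \<eta> = poly s1 1 / a ^ k\<close>. Replacing \<open>\<zeta> k ^ k\<close> by 1
  costs about \<open>k * \<eta>\<close>, the source of the factor \<open>k + 1\<close>. All
  second-order terms are \<open>O(1 / a ^ (2 * k))\<close>, and \<open>b \<le> a\<^sup>2\<close>
  lets \<open>1 / b ^ k\<close> absorb them.\<close>

lemma zeta_estimate:
  "\<exists>C>0. \<forall>\<^sub>F k in sequentially. \<bar>\<zeta> k - 1 - \<delta> / a ^ k\<bar> \<le> C * (real k + 1) / b ^ k"
proof -
  obtain C where C: "C \<ge> 0" "\<And>k x. 1 \<le> x \<Longrightarrow> x \<le> 2 \<Longrightarrow> x ^ k \<le> 2 \<Longrightarrow> \<bar>poly (Q k) x\<bar> \<le> C / b ^ k"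
    using decaying_real[OF Q] by metis
  obtain L where L: "L > 0" "\<And>x. 1 \<le> x \<Longrightarrow> x \<le> 2 \<Longrightarrow> \<bar>poly s0 x - poly s0 1\<bar> \<le> L * (x - 1)"
    using poly_Lipschitz_1[of s0] by metis
  obtain M where M: "M > 0" "\<And>x. 1 \<le> x \<Longrightarrow> x \<le> 2 \<Longrightarrow> \<bar>poly s1 x - poly s1 1\<bar> \<le> M * (x - 1)"
      "\<And>x. 1 \<le> x \<Longrightarrow> x \<le> 2 \<Longrightarrow> \<bar>poly s1 x\<bar> \<le> M"
    using poly_Lipschitz_1[of s1] by metis
  have bpos: "b > 0" using a ab by simp
  define D where "D = (L * (2 * \<delta>)\<^sup>2 + (4 * \<delta> * M + 2 * \<delta> * M) + C) / \<bar>poly s0 1\<bar>"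
  have "\<forall>\<^sub>F k in sequentially. \<bar>\<zeta> k - 1 - \<delta> / a ^ k\<bar> \<le> (D + 1) * (real k + 1) / b ^ k"
    using eventually_zeta
  proof eventually_elim
    case (elim k)
    define \<eta> where "\<eta> = \<zeta> k - 1"
    define A where "A = 1 / a ^ k"
    have Apos: "A > 0" using a by (simp add: A_def)
    have z: "1 \<le> \<zeta> k" "\<zeta> k \<le> 2" "\<zeta> k ^ k \<le> 2" and root: "poly (S k) (\<zeta> k) = 0"
      and \<eta>: "0 < \<eta>" "\<eta> \<le> 2 * \<delta> * A"
      using elim by (auto simp: is_root_def \<eta>_def A_def)
    have AB: "A * A \<le> 1 / b ^ k"
    proof -
      have "b ^ k \<le> (a\<^sup>2) ^ k" using ba bpos by (intro power_mono) auto
      hence "b ^ k \<le> a ^ k * a ^ k" by (simp add: power2_eq_square power_mult_distrib)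
      thus ?thesis unfolding A_def using a bpos by (simp add: frac_le)
    qed
    have mono1: "x \<le> x * (real k + 1)" if "0 \<le> x" for x :: real
      using that by (simp add: algebra_simps)
    have "\<eta> * poly s0 (\<zeta> k) = A * (\<zeta> k ^ k * poly s1 (\<zeta> k)) + poly (Q k) (\<zeta> k)"
      using root unfolding S_eval \<eta>_def A_def by (simp add: algebra_simps)
    \<comment> \<open>Subtracting \<open>poly s0 1 * \<delta> * A = poly s1 1 * A\<close> leaves
      only differences between values at \<open>\<zeta> k\<close> and at 1, and the term with
      \<open>Q\<close>.\<close>
    hence "poly s0 1 * (\<eta> - \<delta> * A) = - (\<eta> * (poly s0 (\<zeta> k) - poly s0 1))
        + A * ((\<zeta> k ^ k - 1) * poly s1 (\<zeta> k) + (poly s1 (\<zeta> k) - poly s1 1)) + poly (Q k) (\<zeta> k)"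
      unfolding s11 by (simp add: algebra_simps)
    moreover have "\<bar>- p + A * (q + t) + s\<bar> \<le> \<bar>p\<bar> + A * (\<bar>q\<bar> + \<bar>t\<bar>) + \<bar>s\<bar>" for p q t s :: real
    proof -
      have "\<bar>A * (q + t)\<bar> \<le> A * (\<bar>q\<bar> + \<bar>t\<bar>)" unfolding abs_mult using Apos by (intro mult_mono) auto
      thus ?thesis by linarith
    qed
    ultimately have "\<bar>poly s0 1 * (\<eta> - \<delta> * A)\<bar> \<le> \<bar>\<eta> * (poly s0 (\<zeta> k) - poly s0 1)\<bar>
        + A * (\<bar>(\<zeta> k ^ k - 1) * poly s1 (\<zeta> k)\<bar> + \<bar>poly s1 (\<zeta> k) - poly s1 1\<bar>) + \<bar>poly (Q k) (\<zeta> k)\<bar>"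
      by (simp only:)
    also have "\<dots> \<le> \<eta> * (L * \<eta>) + A * ((2 * real k * \<eta>) * M + M * \<eta>) + C / b ^ k"
    proof (intro add_mono mult_left_mono)
      show "\<bar>\<eta> * (poly s0 (\<zeta> k) - poly s0 1)\<bar> \<le> \<eta> * (L * \<eta>)"
        using L(2)[OF z(1,2)] \<eta> by (simp add: abs_mult \<eta>_def)
      have "0 \<le> \<zeta> k ^ k - 1" using z(1) by (simp add: one_le_power)
      moreover have "\<zeta> k ^ k - 1 \<le> 2 * real k * \<eta>" using power_diff_1_le[OF z(1,3)] by (simp add: \<eta>_def)
      ultimately show "\<bar>(\<zeta> k ^ k - 1) * poly s1 (\<zeta> k)\<bar> \<le> (2 * real k * \<eta>) * M"
        unfolding abs_mult using M(3)[OF z(1,2)] \<eta> by (intro mult_mono) auto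
      show "\<bar>poly s1 (\<zeta> k) - poly s1 1\<bar> \<le> M * \<eta>" using M(2)[OF z(1,2)] by (simp add: \<eta>_def)
      show "\<bar>poly (Q k) (\<zeta> k)\<bar> \<le> C / b ^ k" using C(2)[OF z] .
    qed (use Apos in auto)
    also have "\<dots> \<le> (2 * \<delta> * A) * (L * (2 * \<delta> * A)) + A * ((2 * real k * (2 * \<delta> * A)) * M + M * (2 * \<delta> * A)) + C / b ^ k"
      using \<eta> Apos L(1) M(1) delta_pos by (intro add_mono mult_mono mult_left_mono mult_right_mono mult_nonneg_nonneg) auto
    also have "\<dots> = (L * (2 * \<delta>)\<^sup>2 + (4 * real k * \<delta> * M + 2 * \<delta> * M)) * (A * A) + C * (1 / b ^ k)"
      by (simp add: algebra_simps power2_eq_square)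
    also have "(L * (2 * \<delta>)\<^sup>2 + (4 * real k * \<delta> * M + 2 * \<delta> * M)) * (A * A) + C * (1 / b ^ k)
      \<le> (L * (2 * \<delta>)\<^sup>2 * (real k + 1) + (4 * \<delta> * M * (real k + 1) + 2 * \<delta> * M * (real k + 1))) * (1 / b ^ k) + C * (real k + 1) * (1 / b ^ k)"
    proof (rule add_mono[OF mult_mono[OF _ AB] mult_right_mono])
      have "L * (2 * \<delta>)\<^sup>2 \<le> L * (2 * \<delta>)\<^sup>2 * (real k + 1)" "2 * \<delta> * M \<le> 2 * \<delta> * M * (real k + 1)"
        using L(1) M(1) delta_pos by (auto intro!: mono1)
      moreover have "4 * real k * \<delta> * M \<le> 4 * \<delta> * M * (real k + 1)" using M(1) delta_pos by (simp add: algebra_simps)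
      ultimately show "L * (2 * \<delta>)\<^sup>2 + (4 * real k * \<delta> * M + 2 * \<delta> * M)
        \<le> L * (2 * \<delta>)\<^sup>2 * (real k + 1) + (4 * \<delta> * M * (real k + 1) + 2 * \<delta> * M * (real k + 1))"
        by linarith
      show "C \<le> C * (real k + 1)" using C(1) by (rule mono1)
    qed (use L(1) M(1) C(1) delta_pos bpos Apos in auto)
    also have "\<dots> = (L * (2 * \<delta>)\<^sup>2 + (4 * \<delta> * M + 2 * \<delta> * M) + C) * (real k + 1) / b ^ k"
      by (simp add: algebra_simps add_divide_distrib)
    finally have "\<bar>poly s0 1\<bar> * \<bar>\<eta> - \<delta> * A\<bar> \<le> (L * (2 * \<delta>)\<^sup>2 + (4 * \<delta> * M + 2 * \<delta> * M) + C) * (real k + 1) / b ^ k"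
      by (simp add: abs_mult)
    hence "\<bar>\<eta> - \<delta> * A\<bar> \<le> ((L * (2 * \<delta>)\<^sup>2 + (4 * \<delta> * M + 2 * \<delta> * M) + C) * (real k + 1) / b ^ k) / \<bar>poly s0 1\<bar>"
      using s01 by (subst pos_le_divide_eq) (simp_all add: mult.commute)
    also have "\<dots> = D * (real k + 1) / b ^ k"
      unfolding D_def by (simp add: mult.commute)
    also have "\<dots> \<le> (D + 1) * (real k + 1) / b ^ k"
      using bpos by (intro divide_right_mono mult_right_mono) auto
    finally show ?case by (simp add: \<eta>_def A_def)
  qed
  moreover have "D + 1 > 0"
    unfolding D_def using L(1) M(1) C(1) delta_pos by (intro add_nonneg_pos divide_nonneg_nonneg add_nonneg_nonneg) auto
  ultimately show ?thesis by blast
qed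

end

section \<open>The cofactor of the dominant factor and the coefficient estimate\<close>

context perturbed_pole
begin

text \<open>
  The cofactor \<open>T\<close> is \<open>-x\<close> times the difference quotient of \<open>S k\<close> at its zero \<open>x\<close>, and the difference
  quotient of \<open>(1 - z) s\<^sub>0(z)\<close> is \<open>-s\<^sub>0(z)\<close> up to \<open>O(x - 1)\<close>. This replaces Rouche's theorem: \<open>T\<close> has no zeros
  where \<open>s\<^sub>0\<close> has none.
\<close>

lemma cofactor_estimate:
  assumes root: "is_root k x" and S: "S k = [:1, - 1 / x:] * T" and r: "1 < r" "x \<le> r"
    and D: "\<And>z. cmod z \<le> r \<Longrightarrow> cmod (cpoly (pderiv s0) z) \<le> D"
    and E': "\<And>z. cmod z \<le> r \<Longrightarrow> cmod (cpoly (pderiv (E k)) z) \<le> e"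
  shows "cmod z \<le> r \<Longrightarrow> cmod (cpoly T z - of_real x * cpoly s0 z) \<le> x * (D * (x - 1) + e)"
    and "\<bar>poly T x - x * poly s0 x\<bar> \<le> x * (D * (x - 1) + \<bar>poly (pderiv (E k)) x\<bar>)"
proof -
  have x: "1 < x" and S0: "poly (S k) x = 0" using root by (auto simp: is_root_def)
  have D0: "D \<ge> 0" using D[of 0] r by (intro order_trans[OF norm_ge_zero D[of 0]]) auto
  \<comment> \<open>At the zero itself the difference quotient is a derivative. This case is kept
    separate because the derivative of \<open>E k\<close> at \<open>x\<close> is of order
    \<open>k / a ^ k\<close>, much smaller than its bound \<open>e\<close> on the disc, and the
    value of \<open>T\<close> at \<open>x\<close> is needed with that precision.\<close>
  have "poly (pderiv (S k)) x = - (poly T x / x)"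
  proof -
    have "pderiv [:1, - 1 / x:] = [:- 1 / x:]" by (simp add: pderiv_pCons)
    thus ?thesis unfolding S pderiv_mult using x by simp
  qed
  moreover have "poly (pderiv (S k)) x = - poly s0 x + (1 - x) * poly (pderiv s0) x + poly (pderiv (E k)) x"
  proof -
    have "pderiv [:1, - 1 :: real:] = [:- 1:]" by (simp add: pderiv_pCons)
    thus ?thesis unfolding S_def pderiv_add pderiv_mult by (simp add: algebra_simps)
  qed
  ultimately have "poly T x / x = poly s0 x + (x - 1) * poly (pderiv s0) x - poly (pderiv (E k)) x"
    by (simp add: algebra_simps)
  hence T: "poly T x - x * poly s0 x = x * ((x - 1) * poly (pderiv s0) x - poly (pderiv (E k)) x)"
    using x by (simp add: field_simps)
  have "\<bar>poly (pderiv s0) x\<bar> \<le> D" using D[of "of_real x"] x r by simp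
  hence "(x - 1) * \<bar>poly (pderiv s0) x\<bar> \<le> (x - 1) * D" using x by (intro mult_left_mono) auto
  hence "\<bar>(x - 1) * poly (pderiv s0) x - poly (pderiv (E k)) x\<bar> \<le> D * (x - 1) + \<bar>poly (pderiv (E k)) x\<bar>"
    using x by (intro order_trans[OF abs_triangle_ineq4] add_mono) (auto simp: abs_mult mult.commute)
  thus real: "\<bar>poly T x - x * poly s0 x\<bar> \<le> x * (D * (x - 1) + \<bar>poly (pderiv (E k)) x\<bar>)"
    unfolding T abs_mult using x by (intro mult_mono) auto
  assume z: "cmod z \<le> r"
  show "cmod (cpoly T z - of_real x * cpoly s0 z) \<le> x * (D * (x - 1) + e)"
  proof (cases "z = of_real x")
    case True
    have "\<bar>poly (pderiv (E k)) x\<bar> \<le> e" using E'[of "of_real x"] x r by simp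
    hence "x * (D * (x - 1) + \<bar>poly (pderiv (E k)) x\<bar>) \<le> x * (D * (x - 1) + e)" using x by (intro mult_left_mono) auto
    with real have "cmod (of_real (poly T x - x * poly s0 x)) \<le> x * (D * (x - 1) + e)" by (simp only: norm_of_real)
    thus ?thesis by (simp add: True)
  next
    case False
    have Lip: "cmod (cpoly p z - cpoly p (of_real x)) \<le> B * cmod (z - of_real x)"
      if "\<And>z. cmod z \<le> r \<Longrightarrow> cmod (cpoly (pderiv p) z) \<le> B" for p B
      by (rule field_differentiable_bound[OF convex_cball[of 0 r] has_field_derivative_cpoly])
         (use that z x r in auto)
    have Sz: "(1 - z / of_real x) * cpoly T z = (1 - z) * cpoly s0 z + cpoly (E k) z"
    proof -
      have "cpoly (S k) z = (1 - z / of_real x) * cpoly T z" unfolding S cpoly_mult by simp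
      moreover have "cpoly (S k) z = (1 - z) * cpoly s0 z + cpoly (E k) z" unfolding S_def cpoly_add cpoly_mult by simp
      ultimately show ?thesis by simp
    qed
    have Sx: "(1 - of_real x) * cpoly s0 (of_real x) + cpoly (E k) (of_real x) = 0"
    proof -
      have "(1 - x) * poly s0 x + poly (E k) x = 0" using S0 unfolding S_def poly_add poly_mult by simp
      hence "of_real ((1 - x) * poly s0 x + poly (E k) x) = (0::complex)" by (simp only: of_real_0)
      thus ?thesis by simp
    qed
    have xz: "(1 - z / of_real x) * of_real x = of_real x - z" using x by (simp add: field_simps)
    \<comment> \<open>Subtracting the equation \<open>Sx\<close> leaves differences between values
      at \<open>z\<close> and at \<open>x\<close>. By the Lipschitz bounds they contain a factor
      \<open>cmod (z - of_real x)\<close>, which cancels against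
      \<open>1 - z / of_real x\<close>.\<close>
    have "(1 - z / of_real x) * (cpoly T z - of_real x * cpoly s0 z)
        = (1 - of_real x) * (cpoly s0 z - cpoly s0 (of_real x)) + (cpoly (E k) z - cpoly (E k) (of_real x))"
    proof -
      have "(1 - z / of_real x) * (cpoly T z - of_real x * cpoly s0 z)
         = (1 - z) * cpoly s0 z + cpoly (E k) z - (of_real x - z) * cpoly s0 z"
        unfolding right_diff_distrib Sz mult.assoc[symmetric] xz ..
      also have "\<dots> = (1 - z) * cpoly s0 z + cpoly (E k) z - (of_real x - z) * cpoly s0 z
         - ((1 - of_real x) * cpoly s0 (of_real x) + cpoly (E k) (of_real x))"
        unfolding Sx by simp
      finally show ?thesis by (simp add: algebra_simps)
    qed
    hence "cmod (1 - z / of_real x) * cmod (cpoly T z - of_real x * cpoly s0 z)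
        \<le> cmod (1 - of_real x) * cmod (cpoly s0 z - cpoly s0 (of_real x)) + cmod (cpoly (E k) z - cpoly (E k) (of_real x))"
      unfolding norm_mult[symmetric] by (simp only: norm_triangle_ineq)
    also have "cmod (1 - of_real x) = x - 1"
    proof -
      have "1 - of_real x = complex_of_real (1 - x)" by simp
      thus ?thesis using x by (simp only: norm_of_real)
    qed
    also have "(x - 1) * cmod (cpoly s0 z - cpoly s0 (of_real x)) + cmod (cpoly (E k) z - cpoly (E k) (of_real x))
       \<le> (x - 1) * (D * cmod (z - of_real x)) + e * cmod (z - of_real x)"
      using x by (intro add_mono mult_left_mono Lip D E') auto
    also have "\<dots> = (D * (x - 1) + e) * cmod (z - of_real x)" by (simp add: algebra_simps)
    also have "cmod (z - of_real x) = x * cmod (1 - z / of_real x)"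
    proof -
      have "z - of_real x = - (of_real x * (1 - z / of_real x))" using xz by (simp add: mult.commute)
      thus ?thesis using x by (simp only: norm_minus_cancel norm_mult norm_of_real)
    qed
    finally have "cmod (1 - z / of_real x) * cmod (cpoly T z - of_real x * cpoly s0 z)
       \<le> cmod (1 - z / of_real x) * (x * (D * (x - 1) + e))"
      by (simp only: mult_ac)
    moreover have "cmod (1 - z / of_real x) > 0" using False x by (simp add: field_simps)
    ultimately show ?thesis by simp
  qed
qed

lemma tendsto_decay:
  assumes "1 < r" "r < a"
  shows "(\<lambda>k. C * (1 / a ^ k) + D * (real k + 1) * (r / a) ^ k) \<longlonglongrightarrow> 0"
proof -
  define q where "q = r / a"
  have q: "0 < q" "q < 1" using assms a by (auto simp: q_def)
  have "(\<lambda>k. C * (1 / a ^ k) + D * (real k + 1) * q ^ k) \<longlonglongrightarrow> C * 0 + D * 0"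
  proof (intro tendsto_add tendsto_mult_left)
    show "(\<lambda>k. 1 / a ^ k) \<longlonglongrightarrow> 0" using a by real_asymp
    have "(\<lambda>k. (real k + 1) * q ^ k) \<longlonglongrightarrow> 0" using q by real_asymp
    thus "(\<lambda>k. D * (real k + 1) * q ^ k) \<longlonglongrightarrow> D * 0" unfolding mult.assoc by (rule tendsto_mult_left)
  qed
  thus ?thesis by (simp add: q_def)
qed

text \<open>Minus the residue of \<open>G_lim\<close> at 1, and therefore the limit of its Taylor
  coefficients.\<close>

definition g where "g = poly r0 1 / poly s0 1"

lemma quotient_difference_le:
  fixes x y s t :: real
  assumes "\<bar>x - s\<bar> \<le> e" "\<bar>y - t\<bar> \<le> f" "\<bar>y\<bar> \<ge> n" "n > 0" "t \<noteq> 0"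
  shows "\<bar>x / y - s / t\<bar> \<le> (e * \<bar>t\<bar> + \<bar>s\<bar> * f) / (n * \<bar>t\<bar>)"
proof -
  have y: "y \<noteq> 0" using assms by auto
  have "x / y - s / t = ((x - s) * t - s * (y - t)) / (y * t)"
    using y assms(5) by (simp add: field_simps)
  hence "\<bar>x / y - s / t\<bar> = \<bar>(x - s) * t - s * (y - t)\<bar> / (\<bar>y\<bar> * \<bar>t\<bar>)"
    by (simp add: abs_mult)
  also have "\<dots> \<le> (e * \<bar>t\<bar> + \<bar>s\<bar> * f) / (n * \<bar>t\<bar>)"
  proof (intro frac_le mult_right_mono)
    have "\<bar>(x - s) * t - s * (y - t)\<bar> \<le> \<bar>x - s\<bar> * \<bar>t\<bar> + \<bar>s\<bar> * \<bar>y - t\<bar>"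
      unfolding abs_mult[symmetric] by (rule abs_triangle_ineq4)
    also have "\<dots> \<le> e * \<bar>t\<bar> + \<bar>s\<bar> * f" using assms by (intro add_mono mult_left_mono mult_right_mono) auto
    finally show "\<bar>(x - s) * t - s * (y - t)\<bar> \<le> e * \<bar>t\<bar> + \<bar>s\<bar> * f" .
    have "0 \<le> e" "0 \<le> f" using assms(1,2) by linarith+
    thus "0 \<le> e * \<bar>t\<bar> + \<bar>s\<bar> * f" by simp
  qed (use assms in auto)
  finally show ?thesis .
qed

text \<open>\<open>dominant_pole_coefficient\<close> is applied for each large \<open>k\<close>,
  with \<open>h\<close> the quotient of \<open>R k\<close> and the cofactor at the zero, which does
  not depend on \<open>l\<close>. The coarse bound for the cofactor keeps it away from 0 on the
  disc; the fine one at the zero brings \<open>h\<close> close to \<open>g\<close>.\<close>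

theorem coefficient_estimate:
  fixes w :: "nat \<Rightarrow> nat \<Rightarrow> real"
  assumes gf: "\<And>k. Abs_fps (\<lambda>l. w l k) * fps_of_poly (S k) = fps_of_poly (R k)"
  obtains C q where "C > 0" "0 < q" "q < 1"
    "\<forall>\<^sub>F k in sequentially. \<exists>h. \<bar>h - g\<bar> \<le> C * (real k + 1) / a ^ k \<and> (\<forall>l. \<bar>w l k - h / \<zeta> k ^ l\<bar> \<le> C * q ^ l)"
proof -
  obtain r m0 where r: "1 < r" "r < a" and m0: "m0 > 0" "\<And>z. cmod z \<le> r \<Longrightarrow> m0 \<le> cmod (cpoly s0 z)"
    by (rule exists_radius) blast
  obtain D where D: "D > 0" "\<And>z. cmod z \<le> r \<Longrightarrow> cmod (cpoly (pderiv s0) z) \<le> D"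
    using cpoly_bounded[of r "pderiv s0"] by blast
  obtain Mr where Mr: "Mr > 0" "\<And>z. cmod z \<le> r \<Longrightarrow> cmod (cpoly r0 z) \<le> Mr"
    using cpoly_bounded[of r r0] by blast
  obtain C1 where C1: "C1 \<ge> 0" "\<And>k z. cmod z \<le> r \<Longrightarrow> cmod (cpoly (pderiv (E k)) z) \<le> C1 * (real k + 1) * (r / a) ^ k"
    using decaying_E r unfolding decaying_def by (meson less_imp_le)
  obtain C2 where C2: "C2 \<ge> 0" "\<And>k x. 1 \<le> x \<Longrightarrow> x \<le> 2 \<Longrightarrow> x ^ k \<le> 2 \<Longrightarrow> \<bar>poly (pderiv (E k)) x\<bar> \<le> C2 * (real k + 1) / a ^ k"
    using decaying_real[OF decaying_E] by metis
  obtain C3 where C3: "C3 \<ge> 0" "\<And>k z. cmod z \<le> r \<Longrightarrow> cmod (cpoly (P k) z) \<le> C3 * (r / a) ^ k"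
    using P r unfolding decaying_def by (meson less_imp_le)
  obtain C4 where C4: "C4 \<ge> 0" "\<And>k x. 1 \<le> x \<Longrightarrow> x \<le> 2 \<Longrightarrow> x ^ k \<le> 2 \<Longrightarrow> \<bar>poly (P k) x\<bar> \<le> C4 / a ^ k"
    using decaying_real[OF P] by metis
  obtain Lr where Lr: "Lr > 0" "\<And>x. 1 \<le> x \<Longrightarrow> x \<le> 2 \<Longrightarrow> \<bar>poly r0 x - poly r0 1\<bar> \<le> Lr * (x - 1)"
    using poly_Lipschitz_1[of r0] by metis
  obtain Ls where Ls: "Ls > 0" "\<And>x. 1 \<le> x \<Longrightarrow> x \<le> 2 \<Longrightarrow> \<bar>poly s0 x - poly s0 1\<bar> \<le> Ls * (x - 1)"
      "\<And>x. 1 \<le> x \<Longrightarrow> x \<le> 2 \<Longrightarrow> \<bar>poly s0 x\<bar> \<le> Ls"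
    using poly_Lipschitz_1[of s0] by metis
  \<comment> \<open>The numerator is at most \<open>Mr + C3\<close> on the disc, and
    \<open>m0 / 2\<close> will be the lower bound \<open>Tlow\<close> for the cofactor.\<close>
  define B where "B = (Mr + C3) / (m0 / 2)"
  have B: "B > 0" using Mr C3 m0 by (simp add: B_def add_pos_nonneg)
  define eR where "eR = Lr * (2 * \<delta>) + C4"
  define eT where "eT = 2 * (D * (2 * \<delta>) + C2) + 2 * \<delta> * Ls + Ls * (2 * \<delta>)"
  define C5 where "C5 = (eR * \<bar>poly s0 1\<bar> + \<bar>poly r0 1\<bar> * eT) / (m0 / 2 * \<bar>poly s0 1\<bar>)"
  define C6 where "C6 = B * (2 * r / (r - 1))"
  have C6: "C6 > 0" using B r by (simp add: C6_def)
  \<comment> \<open>Multiplied by \<open>x \<le> 2\<close>, the quarter leaves a deviation of at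
    most \<open>m0 / 2\<close> from \<open>x * s0\<close>, whose modulus is at least
    \<open>m0\<close>.\<close>
  have "\<forall>\<^sub>F k in sequentially. (D * (2 * \<delta>)) * (1 / a ^ k) + C1 * (real k + 1) * (r / a) ^ k < m0 / 4"
    by (rule order_tendstoD(2)[OF tendsto_decay[OF r]]) (use m0 in simp)
  moreover have "\<forall>\<^sub>F k in sequentially. 1 + 2 * \<delta> / a ^ k < (1 + r) / 2"
    using order_tendstoD(2)[OF tendsto_shifted_power(2)[of "2 * \<delta>"], of "(1 + r) / 2"] delta_pos r by simp
  ultimately have ev: "\<forall>\<^sub>F k in sequentially. \<exists>h. \<bar>h - g\<bar> \<le> C5 * (real k + 1) / a ^ k \<and> (\<forall>l. \<bar>w l k - h / \<zeta> k ^ l\<bar> \<le> C6 * (1 / r) ^ l)"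
    using eventually_zeta
  proof eventually_elim
    case (elim k)
    define x where "x = \<zeta> k"
    have root: "is_root k x" and x: "1 < x" "x \<le> 2" "x ^ k \<le> 2" and \<eta>: "x - 1 \<le> 2 * \<delta> * (1 / a ^ k)"
      and xr: "x < (1 + r) / 2"
      using elim by (auto simp: x_def is_root_def)
    have x1: "1 \<le> x" using x by simp
    have xlt: "x < r" using xr r by (simp add: field_simps)
    hence xr': "x \<le> r" by simp
    \<comment> \<open>The linear factor is normalized to constant term 1, so the factor
      \<open>- x\<close> passes to the cofactor.\<close>
    have "[:- x, 1:] dvd S k" using root by (simp add: is_root_def poly_eq_0_iff_dvd)
    then obtain U where "S k = [:- x, 1:] * U" by (rule dvdE)
    moreover have "[:- x, 1:] = smult (- x) [:1, - 1 / x:]" using x by simp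
    ultimately have S: "S k = [:1, - 1 / x:] * smult (- x) U" by (simp only: mult_smult_left mult_smult_right)
    define T where "T = smult (- x) U"
    note S = S[folded T_def]
    note ce = cofactor_estimate[OF root S r(1) xr' D(2) C1(2)]
    define \<epsilon> where "\<epsilon> = (real k + 1) * (1 / a ^ k)"
    have apos: "1 / a ^ k > 0" using a by simp
    have "1 * (1 / a ^ k) \<le> \<epsilon>" unfolding \<epsilon>_def using apos by (intro mult_right_mono) auto
    hence \<epsilon>1: "1 / a ^ k \<le> \<epsilon>" by simp
    have \<epsilon>0: "\<epsilon> \<ge> 0" using \<epsilon>1 apos by linarith
    have \<eta>\<epsilon>: "x - 1 \<le> 2 * \<delta> * \<epsilon>" using \<eta> \<epsilon>1 delta_pos by (meson mult_left_mono order_trans less_imp_le zero_less_mult_iff zero_less_numeral)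
    have Tlow: "m0 / 2 \<le> cmod (cpoly T z)" if z: "cmod z \<le> r" for z
    proof -
      have "D * (x - 1) \<le> D * (2 * \<delta> * (1 / a ^ k))" using D(1) \<eta> by (intro mult_left_mono) auto
      hence "D * (x - 1) + C1 * (real k + 1) * (r / a) ^ k \<le> m0 / 4" using elim(1) unfolding mult.assoc[of D] by linarith
      hence "x * (D * (x - 1) + C1 * (real k + 1) * (r / a) ^ k) \<le> 2 * (m0 / 4)"
        using x m0 D(1) C1(1) r a by (intro mult_mono) auto
      hence "cmod (cpoly T z - of_real x * cpoly s0 z) \<le> m0 / 2" using ce(1)[OF _ _ z] by simp
      moreover have "1 * m0 \<le> x * cmod (cpoly s0 z)" using x m0 z by (intro mult_mono) auto
      hence "m0 \<le> cmod (of_real x * cpoly s0 z)" using x by (simp add: norm_mult)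
      moreover have "cmod (of_real x * cpoly s0 z) \<le> cmod (cpoly T z) + cmod (cpoly T z - of_real x * cpoly s0 z)"
        using norm_triangle_sub[of "of_real x * cpoly s0 z" "cpoly T z"] by (simp only: norm_minus_commute)
      ultimately show ?thesis by linarith
    qed
    have Tnz: "cpoly T z \<noteq> 0" if z: "cmod z \<le> r" for z
      using Tlow[OF z] m0 by auto
    have RB: "cmod (cpoly (R k) z / cpoly T z) \<le> B" if z: "cmod z \<le> r" for z
    proof -
      have "cmod (cpoly (R k) z) \<le> cmod (cpoly r0 z) + cmod (cpoly (P k) z)"
        unfolding R_def cpoly_add by (rule norm_triangle_ineq)
      also have "\<dots> \<le> Mr + C3 * (r / a) ^ k" using Mr(2)[OF z] C3(2)[OF z] by (rule add_mono)
      also have "C3 * (r / a) ^ k \<le> C3 * 1" using C3(1) r a by (intro mult_left_mono power_le_one) auto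
      finally have "cmod (cpoly (R k) z) \<le> Mr + C3" by simp
      thus ?thesis unfolding norm_divide B_def using Tlow[OF z] m0 Mr C3(1) by (intro frac_le) auto
    qed
    define h where "h = poly (R k) x / poly T x"
    have eq: "Abs_fps (\<lambda>l. w l k) * fps_of_poly ([:1, - 1 / x:] * T) = fps_of_poly (R k)"
      using gf[of k] unfolding S .
    have coef: "\<bar>w l k - h / x ^ l\<bar> \<le> C6 * (1 / r) ^ l" for l
    proof -
      have "\<bar>w l k * x ^ l - h\<bar> \<le> B * (x / r) ^ l / (1 - x / r)"
        unfolding h_def by (rule dominant_pole_coefficient[OF eq _ _ Tnz RB]) (use x xr r in auto)
      moreover have "1 - x / r \<ge> (r - 1) / (2 * r)"
      proof -
        have "x / r \<le> ((1 + r) / 2) / r" using xr r by (intro divide_right_mono) auto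
        also have "\<dots> = 1 - (r - 1) / (2 * r)" using r by (simp add: field_simps)
        finally show ?thesis by linarith
      qed
      moreover have "(r - 1) / (2 * r) > 0" using r by simp
      ultimately have "\<bar>w l k * x ^ l - h\<bar> \<le> B * (x / r) ^ l / ((r - 1) / (2 * r))"
        using B r x xlt by (elim order_trans) (intro divide_left_mono mult_pos_pos, auto)
      also have "\<dots> = C6 * (1 / r) ^ l * x ^ l" by (simp add: C6_def power_divide mult_ac)
      finally have "\<bar>w l k * x ^ l - h\<bar> / x ^ l \<le> C6 * (1 / r) ^ l"
        using x by (simp add: pos_divide_le_eq)
      moreover have "w l k - h / x ^ l = (w l k * x ^ l - h) / x ^ l" using x by (simp add: field_simps)
      ultimately show ?thesis using x by simp
    qed
    have Rx: "\<bar>poly (R k) x - poly r0 1\<bar> \<le> eR * \<epsilon>"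
    proof -
      have "\<bar>poly (R k) x - poly r0 1\<bar> \<le> \<bar>poly r0 x - poly r0 1\<bar> + \<bar>poly (P k) x\<bar>" by (simp add: R_def)
      also have "\<dots> \<le> Lr * (x - 1) + C4 * (1 / a ^ k)"
        using Lr(2)[OF x1 x(2)] C4(2)[OF x1 x(2,3)] by (intro add_mono) auto
      also have "\<dots> \<le> Lr * (2 * \<delta> * \<epsilon>) + C4 * \<epsilon>"
        using Lr(1) C4(1) \<eta>\<epsilon> \<epsilon>1 by (intro add_mono mult_left_mono) auto
      finally show ?thesis by (simp add: eR_def algebra_simps)
    qed
    have Tx: "\<bar>poly T x - poly s0 1\<bar> \<le> eT * \<epsilon>"
    proof -
      have "\<bar>poly T x - poly s0 1\<bar> \<le> \<bar>poly T x - x * poly s0 x\<bar> + (\<bar>(x - 1) * poly s0 x\<bar> + \<bar>poly s0 x - poly s0 1\<bar>)"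
        by (simp add: algebra_simps)
      also have "\<dots> \<le> x * (D * (x - 1) + C2 * (real k + 1) / a ^ k) + ((x - 1) * Ls + Ls * (x - 1))"
      proof (intro add_mono)
        show "\<bar>poly T x - x * poly s0 x\<bar> \<le> x * (D * (x - 1) + C2 * (real k + 1) / a ^ k)"
          using C2(2)[OF x1 x(2,3)] x by (intro order_trans[OF ce(2)] mult_left_mono) auto
        show "\<bar>(x - 1) * poly s0 x\<bar> \<le> (x - 1) * Ls"
          unfolding abs_mult using Ls(3)[OF x1 x(2)] x by (intro mult_mono) auto
      qed (rule Ls(2)[OF x1 x(2)])
      also have "\<dots> \<le> 2 * (D * (2 * \<delta> * \<epsilon>) + C2 * \<epsilon>) + ((2 * \<delta> * \<epsilon>) * Ls + Ls * (2 * \<delta> * \<epsilon>))"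
      proof (intro add_mono mult_mono)
        show "C2 * (real k + 1) / a ^ k \<le> C2 * \<epsilon>" by (simp add: \<epsilon>_def)
      qed (use x \<eta>\<epsilon> D(1) Ls(1) C2(1) a \<epsilon>0 delta_pos in auto)
      also have "\<dots> = eT * \<epsilon>" by (simp add: eT_def algebra_simps)
      finally show ?thesis .
    qed
    have "\<bar>h - g\<bar> \<le> (eR * \<epsilon> * \<bar>poly s0 1\<bar> + \<bar>poly r0 1\<bar> * (eT * \<epsilon>)) / (m0 / 2 * \<bar>poly s0 1\<bar>)"
      unfolding h_def g_def
      using Tlow[of "of_real x"] x xr' m0 s01 by (intro quotient_difference_le[OF Rx Tx]) auto
    also have "\<dots> = C5 * \<epsilon>" by (simp add: C5_def distrib_right distrib_left mult_ac)
    finally have "\<bar>h - g\<bar> \<le> C5 * (real k + 1) / a ^ k" by (simp add: \<epsilon>_def)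
    with coef show ?case unfolding x_def by blast
  qed
  show ?thesis
  proof (rule that[of "\<bar>C5\<bar> + C6" "1 / r"])
    show "\<forall>\<^sub>F k in sequentially. \<exists>h. \<bar>h - g\<bar> \<le> (\<bar>C5\<bar> + C6) * (real k + 1) / a ^ k \<and> (\<forall>l. \<bar>w l k - h / \<zeta> k ^ l\<bar> \<le> (\<bar>C5\<bar> + C6) * (1 / r) ^ l)"
      using ev
    proof eventually_elim
      case (elim k)
      have "C5 * (real k + 1) / a ^ k \<le> (\<bar>C5\<bar> + C6) * (real k + 1) / a ^ k"
        using C6 a by (intro divide_right_mono mult_right_mono) auto
      moreover have "C6 * (1 / r) ^ l \<le> (\<bar>C5\<bar> + C6) * (1 / r) ^ l" for l
        using r by (intro mult_right_mono) auto
      ultimately show ?case using elim by (meson order_trans)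
    qed
  qed (use C6 r in auto)
qed

text \<open>The unperturbed case of the same argument: the pole is exactly 1 and the cofactor is
  \<open>s0\<close>.\<close>

lemma limit_coefficient_estimate:
  fixes w :: "nat \<Rightarrow> real"
  assumes gf: "Abs_fps w * fps_of_poly ([:1, -1:] * s0) = fps_of_poly r0"
  obtains C q where "C > 0" "0 < q" "q < 1" "\<And>l. \<bar>w l - g\<bar> \<le> C * q ^ l"
proof -
  obtain r m0 where r: "1 < r" "r < a" and m0: "m0 > 0" "\<And>z. cmod z \<le> r \<Longrightarrow> m0 \<le> cmod (cpoly s0 z)"
    by (rule exists_radius) blast
  obtain Mr where Mr: "Mr > 0" "\<And>z. cmod z \<le> r \<Longrightarrow> cmod (cpoly r0 z) \<le> Mr"
    using cpoly_bounded[of r r0] by blast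
  define C where "C = (Mr / m0) / (1 - 1 / r)"
  have "\<bar>w l - g\<bar> \<le> C * (1 / r) ^ l" for l
  proof -
    have "\<bar>w l * 1 ^ l - poly r0 1 / poly s0 1\<bar> \<le> (Mr / m0) * (1 / r) ^ l / (1 - 1 / r)"
    proof (rule dominant_pole_coefficient)
      show "cmod (cpoly r0 z / cpoly s0 z) \<le> Mr / m0" if "cmod z \<le> r" for z
        unfolding norm_divide using Mr m0 that by (intro frac_le) (auto intro: less_imp_le)
      show "cpoly s0 z \<noteq> 0" if "cmod z \<le> r" for z using m0 that by force
    qed (use gf r in auto)
    thus ?thesis by (simp add: g_def C_def)
  qed
  thus ?thesis using r Mr m0 by (intro that[of C "1 / r"]) (auto simp: C_def)
qed

end

text \<open>The Lipschitz constant on the half-line from \<open>m\<close> is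
  \<open>exp (- m)\<close>; keeping this factor is what later makes the error summable over small
  \<open>k\<close>.\<close>

lemma abs_exp_diff_le:
  fixes u v m :: real
  assumes "m \<le> u" "m \<le> v"
  shows "\<bar>exp (- u) - exp (- v)\<bar> \<le> \<bar>u - v\<bar> * exp (- m)"
proof -
  have aux: "exp (- x) - exp (- y) \<le> (y - x) * exp (- m)" if "m \<le> x" "x \<le> y" for x y
  proof -
    have "1 - (y - x) \<le> exp (x - y)" using exp_ge_add_one_self[of "x - y"] by linarith
    hence "exp (- x) * (1 - exp (x - y)) \<le> exp (- m) * (y - x)"
      using that by (intro mult_mono) auto
    moreover have "exp (- x) * exp (x - y) = exp (- y)" by (simp add: exp_add[symmetric])
    ultimately show ?thesis by (simp add: algebra_simps)
  qed
  show ?thesis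
  proof (cases "u \<le> v")
    case True
    hence "exp (- v) \<le> exp (- u)" by simp
    thus ?thesis using aux[OF assms(1) True] True by simp
  next
    case False
    hence vu: "v \<le> u" by simp
    hence "exp (- u) \<le> exp (- v)" by simp
    thus ?thesis using aux[OF assms(2) vu] vu by simp
  qed
qed

section \<open>Asymptotics of the coefficients\<close>

locale perturbed_coeffs = perturbed_pole +
  fixes w :: "nat \<Rightarrow> nat \<Rightarrow> real" and v :: "nat \<Rightarrow> real"
  assumes gf: "\<And>k. Abs_fps (\<lambda>l. w l k) * fps_of_poly (S k) = fps_of_poly (R k)"
    and gfv: "Abs_fps v * fps_of_poly ([:1, -1:] * s0) = fps_of_poly r0"
    and w_nonneg: "\<And>l k. w l k \<ge> 0"
    and w_mono: "\<And>l. mono (w l)"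
begin

text \<open>\<open>P k\<close> and \<open>E k\<close> have no terms below degree \<open>k\<close>.
  So the difference of the two series, multiplied by \<open>(1 - z) * s0\<close>, vanishes to order
  \<open>k\<close>, and the nonzero constant term of that factor passes this on to the
  difference.\<close>

lemma v_eq_w:
  assumes "l < k"
  shows "v l = w l k"
proof -
  define D where "D = fps_of_poly ([:1, -1:] * s0)"
  define U where "U = Abs_fps (\<lambda>l. w l k) - Abs_fps v"
  have E0: "poly.coeff (E k) n = 0" and P0: "poly.coeff (P k) n = 0" if "n < k" for n
    using decaying_E P that unfolding decaying_def by blast+
  have D0: "fps_nth D 0 \<noteq> 0"
  proof -
    have "cpoly s0 (of_real 0) \<noteq> 0" by (rule s0_nz) simp
    hence "poly.coeff s0 0 \<noteq> 0" unfolding cpoly_of_real by (simp add: poly_0_coeff_0)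
    thus ?thesis by (simp add: D_def coeff_mult_0)
  qed
  have UD: "U * D = fps_of_poly (P k) - Abs_fps (\<lambda>l. w l k) * fps_of_poly (E k)"
  proof -
    have "Abs_fps (\<lambda>l. w l k) * (D + fps_of_poly (E k)) = fps_of_poly r0 + fps_of_poly (P k)"
      using gf[of k] unfolding S_def R_def fps_of_poly_add D_def .
    thus ?thesis using gfv unfolding U_def D_def[symmetric] by (simp add: algebra_simps)
  qed
  have UD0: "fps_nth (U * D) n = 0" if "n < k" for n
  proof -
    have "fps_nth (Abs_fps (\<lambda>l. w l k) * fps_of_poly (E k)) n = 0"
      unfolding fps_mult_nth using that by (intro sum.neutral) (auto intro!: E0)
    thus ?thesis unfolding UD using P0[OF that] by simp
  qed
  have "fps_nth U n = 0" if "n < k" for n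
    using that
  proof (induction n rule: less_induct)
    case (less n)
    have "0 = (\<Sum>i=0..n. fps_nth U i * fps_nth D (n - i))"
      using UD0[OF less.prems] by (simp add: fps_mult_nth)
    also have "\<dots> = (\<Sum>i\<in>{n}. fps_nth U i * fps_nth D (n - i))"
      using less by (intro sum.mono_neutral_right) auto
    finally show ?case using D0 by simp
  qed
  from this[OF assms] show ?thesis by (simp add: U_def)
qed

lemma v_nonneg: "v l \<ge> 0"
  using w_nonneg[of l "Suc l"] v_eq_w[of l "Suc l"] by simp

lemma tendsto_v: "v \<longlonglongrightarrow> g"
proof -
  obtain C q where C: "C > 0" "0 < q" "q < 1" "\<And>l. \<bar>v l - g\<bar> \<le> C * q ^ l"
    by (rule limit_coefficient_estimate[OF gfv]) blast
  have "(\<lambda>l. v l - g) \<longlonglongrightarrow> 0"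
  proof (rule Lim_null_comparison)
    show "\<forall>\<^sub>F l in sequentially. norm (v l - g) \<le> C * q ^ l" using C by simp
    show "(\<lambda>l. C * q ^ l) \<longlonglongrightarrow> 0" using C by (intro tendsto_mult_right_zero LIMSEQ_power_zero) auto
  qed
  thus ?thesis by (simp add: LIM_zero_iff)
qed

text \<open>No sign of \<open>r0\<close> or \<open>s0\<close> at 1 is assumed; it comes from the
  nonnegativity of the coefficients, whose limit is \<open>g\<close>.\<close>

lemma g_pos: "g > 0"
proof -
  have "g \<ge> 0" using v_nonneg by (intro LIMSEQ_le_const[OF tendsto_v]) auto
  moreover have "g \<noteq> 0" using r0_1 s01 by (simp add: g_def)
  ultimately show ?thesis by simp
qed

lemma eventually_v: "\<forall>\<^sub>F l in sequentially. v l > g / 2"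
  using order_tendstoD(1)[OF tendsto_v, of "g / 2"] g_pos by simp

text \<open>The term \<open>l / b ^ k\<close> comes from the error of \<open>\<zeta> k\<close>
  raised to the power \<open>l\<close>, the term \<open>1 / a ^ k\<close> from \<open>h - g\<close>,
  each with a factor \<open>k + 1\<close>. The exponential is what remains of
  \<open>1 / \<zeta> k ^ l\<close>.\<close>

definition err :: "real \<Rightarrow> nat \<Rightarrow> nat \<Rightarrow> real" where
  "err c l k = (real k + 1) * (real l / b ^ k + 1 / a ^ k) * exp (- c * real l / a ^ k)"

lemma b_pos: "b > 0" using a ab by simp

lemma err_nonneg: "err c l k \<ge> 0"
  unfolding err_def using a b_pos by simp

text \<open>Write \<open>1 / \<zeta> k ^ l\<close> as \<open>exp (- u)\<close> with
  \<open>u = l * ln (1 + \<eta>)\<close> and compare \<open>u\<close> with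
  \<open>t = \<delta> * l / a ^ k\<close>.\<close>

lemma coefficient_exp_estimate:
  obtains C c q where "C > 0" "c > 0" "0 < q" "q < 1"
    "\<forall>\<^sub>F k in sequentially. \<forall>l. \<bar>w l k - g * exp (- \<delta> * real l / a ^ k)\<bar> \<le> C * err c l k + C * q ^ l"
proof -
  obtain C1 q where C1: "C1 > 0" "0 < q" "q < 1"
    and ev1: "\<forall>\<^sub>F k in sequentially. \<exists>h. \<bar>h - g\<bar> \<le> C1 * (real k + 1) / a ^ k \<and> (\<forall>l. \<bar>w l k - h / \<zeta> k ^ l\<bar> \<le> C1 * q ^ l)"
    by (rule coefficient_estimate[OF gf]) blast
  obtain C2 where C2: "C2 > 0" and ev2: "\<forall>\<^sub>F k in sequentially. \<bar>\<zeta> k - 1 - \<delta> / a ^ k\<bar> \<le> C2 * (real k + 1) / b ^ k"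
    using zeta_estimate by blast
  have "(\<lambda>k. C2 * (real k + 1) / b ^ k * a ^ k) \<longlonglongrightarrow> 0"
    using a ab C2 by real_asymp
  hence ev3: "\<forall>\<^sub>F k in sequentially. C2 * (real k + 1) / b ^ k * a ^ k < \<delta> / 2"
    using delta_pos by (intro order_tendstoD(2)) auto
  have "(\<lambda>k. 2 * \<delta> / a ^ k) \<longlonglongrightarrow> 0" using a by real_asymp
  hence ev4: "\<forall>\<^sub>F k in sequentially. 2 * \<delta> / a ^ k < 1 / 2" by (intro order_tendstoD(2)) auto
  define C3 where "C3 = 4 * \<delta>\<^sup>2 + C2"
  define C where "C = C1 + g * C3"
  have C: "C > 0" "C1 \<le> C" "g * C3 \<le> C" using C1 C2 g_pos by (auto simp: C_def C3_def add_pos_nonneg)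
  \<comment> \<open>One half is lost in \<open>\<eta> \<ge> \<delta> / 2 / a ^ k\<close>, the other
    in \<open>ln (1 + \<eta>) \<ge> \<eta> - \<eta>\<^sup>2 \<ge> \<eta> / 2\<close>.\<close>
  define c where "c = \<delta> / 4"
  show ?thesis
  proof (rule that[OF C(1) _ C1(2,3)])
    show "c > 0" using delta_pos by (simp add: c_def)
    show "\<forall>\<^sub>F k in sequentially. \<forall>l. \<bar>w l k - g * exp (- \<delta> * real l / a ^ k)\<bar> \<le> C * err c l k + C * q ^ l"
      using ev1 ev2 ev3 ev4 eventually_zeta
    proof (eventually_elim, intro allI)
      case (elim k)
      fix l
      obtain h where h: "\<bar>h - g\<bar> \<le> C1 * (real k + 1) / a ^ k" "\<bar>w l k - h / \<zeta> k ^ l\<bar> \<le> C1 * q ^ l"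
        using elim(1) by blast
      define \<eta> where "\<eta> = \<zeta> k - 1"
      have ak: "a ^ k > 0" and bk: "b ^ k > 0" using a b_pos by simp_all
      have \<eta>: "0 < \<eta>" "\<eta> < 2 * \<delta> / a ^ k" "\<eta> < 1 / 2" using elim by (auto simp: \<eta>_def is_root_def)
      have d: "\<bar>\<eta> - \<delta> / a ^ k\<bar> \<le> C2 * (real k + 1) / b ^ k" using elim(2) by (simp add: \<eta>_def)
      have "C2 * (real k + 1) / b ^ k < \<delta> / 2 / a ^ k" using elim(3) ak by (simp add: pos_less_divide_eq mult_ac)
      hence \<eta>low: "\<eta> \<ge> \<delta> / 2 / a ^ k" using d by (simp add: abs_le_iff)
      define u where "u = real l * ln (1 + \<eta>)"
      define t where "t = \<delta> * real l / a ^ k"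
      have z: "1 / \<zeta> k ^ l = exp (- u)"
      proof -
        have "\<zeta> k = exp (ln (1 + \<eta>))" using \<eta> by (simp add: \<eta>_def)
        hence "\<zeta> k ^ l = exp u" by (simp add: u_def exp_of_nat_mult[symmetric])
        thus ?thesis by (simp add: exp_minus field_simps)
      qed
      have ln1: "\<eta> - \<eta>\<^sup>2 \<le> ln (1 + \<eta>)" "ln (1 + \<eta>) \<le> \<eta>"
        using \<eta> ln_one_plus_pos_lower_bound[of \<eta>] ln_add_one_self_le_self[of \<eta>] by auto
      have "\<eta>\<^sup>2 \<le> \<eta> * (1 / 2)" unfolding power2_eq_square using \<eta> by (intro mult_left_mono) auto
      hence ln2: "\<delta> / 4 / a ^ k \<le> ln (1 + \<eta>)" using ln1 \<eta>low by (simp add: field_simps)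
      have mu: "c * real l / a ^ k \<le> u"
        using mult_left_mono[OF ln2, of "real l"] by (simp add: u_def c_def mult_ac)
      have mt: "c * real l / a ^ k \<le> t"
        unfolding t_def c_def using delta_pos ak by (intro divide_right_mono mult_right_mono) auto
      have AB: "1 / a ^ k * (1 / a ^ k) \<le> 1 / b ^ k"
      proof -
        have "b ^ k \<le> (a\<^sup>2) ^ k" using ba b_pos by (intro power_mono) auto
        hence "b ^ k \<le> a ^ k * a ^ k" by (simp add: power2_eq_square power_mult_distrib)
        thus ?thesis using ak bk by (simp add: frac_le)
      qed
      have "\<eta>\<^sup>2 \<le> (2 * \<delta> / a ^ k)\<^sup>2" using \<eta> by (intro power_mono) auto
      also have "\<dots> = 4 * \<delta>\<^sup>2 * (1 / a ^ k * (1 / a ^ k))" by (simp add: power2_eq_square)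
      also have "\<dots> \<le> 4 * \<delta>\<^sup>2 * (1 / b ^ k)" using AB by (intro mult_left_mono) auto
      also have "\<dots> \<le> 4 * \<delta>\<^sup>2 * ((real k + 1) / b ^ k)"
        using bk by (intro mult_left_mono divide_right_mono) auto
      finally have "\<bar>ln (1 + \<eta>) - \<delta> / a ^ k\<bar> \<le> 4 * \<delta>\<^sup>2 * ((real k + 1) / b ^ k) + C2 * (real k + 1) / b ^ k"
        using ln1 d by linarith
      also have "\<dots> = C3 * (real k + 1) / b ^ k" by (simp add: C3_def algebra_simps add_divide_distrib)
      finally have "real l * \<bar>ln (1 + \<eta>) - \<delta> / a ^ k\<bar> \<le> real l * (C3 * (real k + 1) / b ^ k)"
        by (intro mult_left_mono) auto
      moreover have "u - t = real l * (ln (1 + \<eta>) - \<delta> / a ^ k)" by (simp add: u_def t_def algebra_simps)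
      ultimately have ut: "\<bar>u - t\<bar> \<le> C3 * ((real k + 1) * (real l / b ^ k))"
        by (simp add: abs_mult mult_ac)
      define X where "X = exp (- c * real l / a ^ k)"
      have X: "exp (- (c * real l / a ^ k)) = X" by (simp add: X_def)
      have "exp (- u) \<le> X" using mu unfolding X[symmetric] by simp
      hence p1: "\<bar>h - g\<bar> * exp (- u) \<le> C1 * (real k + 1) / a ^ k * X"
        using h(1) C1(1) ak by (intro mult_mono) auto
      have "\<bar>exp (- u) - exp (- t)\<bar> \<le> \<bar>u - t\<bar> * X" using abs_exp_diff_le[OF mu mt] unfolding X .
      also have "\<dots> \<le> C3 * ((real k + 1) * (real l / b ^ k)) * X" using ut by (intro mult_right_mono) (auto simp: X_def)
      finally have p2: "g * \<bar>exp (- u) - exp (- t)\<bar> \<le> g * (C3 * ((real k + 1) * (real l / b ^ k)) * X)"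
        using g_pos by (intro mult_left_mono) auto
      \<comment> \<open>Three sources of error: the other singularities, the amplitude and the
        position of the pole.\<close>
      have "w l k - g * exp (- t) = (w l k - h * exp (- u)) + (h - g) * exp (- u) + g * (exp (- u) - exp (- t))"
        by (simp add: algebra_simps)
      hence "\<bar>w l k - g * exp (- t)\<bar> \<le> \<bar>w l k - h * exp (- u)\<bar> + \<bar>h - g\<bar> * exp (- u) + g * \<bar>exp (- u) - exp (- t)\<bar>"
    proof -
      assume "w l k - g * exp (- t) = (w l k - h * exp (- u)) + (h - g) * exp (- u) + g * (exp (- u) - exp (- t))"
      hence "\<bar>w l k - g * exp (- t)\<bar> \<le> \<bar>w l k - h * exp (- u)\<bar> + \<bar>(h - g) * exp (- u)\<bar> + \<bar>g * (exp (- u) - exp (- t))\<bar>"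
        by linarith
      thus ?thesis using g_pos by (simp only: abs_mult) simp
    qed
      also have "\<bar>w l k - h * exp (- u)\<bar> \<le> C1 * q ^ l"
        using h(2) unfolding z[symmetric] by simp
      also have "C1 * q ^ l + \<bar>h - g\<bar> * exp (- u) + g * \<bar>exp (- u) - exp (- t)\<bar>
         \<le> C * q ^ l + C * ((real k + 1) * (1 / a ^ k) * X) + C * ((real k + 1) * (real l / b ^ k) * X)"
      proof (intro add_mono)
        show "C1 * q ^ l \<le> C * q ^ l" using C C1 by (intro mult_right_mono) auto
        have "C1 * ((real k + 1) * (1 / a ^ k) * X) \<le> C * ((real k + 1) * (1 / a ^ k) * X)"
          using C ak by (intro mult_right_mono) (auto simp: X_def)
        with p1 show "\<bar>h - g\<bar> * exp (- u) \<le> C * ((real k + 1) * (1 / a ^ k) * X)" by simp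
        have "(g * C3) * ((real k + 1) * (real l / b ^ k) * X) \<le> C * ((real k + 1) * (real l / b ^ k) * X)"
          using C bk by (intro mult_right_mono) (auto simp: X_def)
        with p2 show "g * \<bar>exp (- u) - exp (- t)\<bar> \<le> C * ((real k + 1) * (real l / b ^ k) * X)" by (simp add: mult_ac)
      qed
      also have "\<dots> = C * err c l k + C * q ^ l"
        by (simp add: err_def X_def algebra_simps)
      finally show "\<bar>w l k - g * exp (- \<delta> * real l / a ^ k)\<bar> \<le> C * err c l k + C * q ^ l"
        by (simp add: t_def)
    qed
  qed
qed

text \<open>Replacing \<open>g\<close> by \<open>v l\<close> costs an exponentially small term, and
  \<open>v l > g / 2\<close> makes the division harmless. The bound is uniform in all
  \<open>l \<ge> l1\<close> and \<open>k \<ge> k1\<close>.\<close>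

theorem ratio_estimate:
  obtains C c q k1 l1 where "C > 0" "c > 0" "0 < q" "q < 1"
    "\<And>l k. l \<ge> l1 \<Longrightarrow> k \<ge> k1 \<Longrightarrow> \<bar>w l k / v l - exp (- \<delta> * real l / a ^ k)\<bar> \<le> C * err c l k + C * q ^ l"
    "\<And>l. l \<ge> l1 \<Longrightarrow> v l > 0"
proof -
  obtain C1 c q1 where C1: "C1 > 0" "c > 0" "0 < q1" "q1 < 1"
    and ev: "\<forall>\<^sub>F k in sequentially. \<forall>l. \<bar>w l k - g * exp (- \<delta> * real l / a ^ k)\<bar> \<le> C1 * err c l k + C1 * q1 ^ l"
    by (rule coefficient_exp_estimate) blast
  obtain C2 q2 where C2: "C2 > 0" "0 < q2" "q2 < 1" "\<And>l. \<bar>v l - g\<bar> \<le> C2 * q2 ^ l"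
    by (rule limit_coefficient_estimate[OF gfv]) blast
  obtain k1 where k1: "\<And>k l. k \<ge> k1 \<Longrightarrow> \<bar>w l k - g * exp (- \<delta> * real l / a ^ k)\<bar> \<le> C1 * err c l k + C1 * q1 ^ l"
    using ev unfolding eventually_sequentially by blast
  obtain l1 where l1: "\<And>l. l \<ge> l1 \<Longrightarrow> v l > g / 2"
    using eventually_v unfolding eventually_sequentially by blast
  define q where "q = max q1 q2"
  define C where "C = (C1 + C2) / (g / 2)"
  have C: "C > 0" using C1 C2 g_pos by (simp add: C_def)
  show ?thesis
  proof (rule that[of C c q l1 k1])
    fix l assume "l \<ge> l1" thus "v l > 0" using l1[of l] g_pos by simp
  next
    fix l k assume l: "l \<ge> l1" and k: "k \<ge> k1"
    let ?e = "exp (- \<delta> * real l / a ^ k)"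
    have vl: "v l > g / 2" "g / 2 > 0" using l1[OF l] g_pos by auto
    have "?e \<le> 1" using delta_pos a by simp
    hence "\<bar>g - v l\<bar> * ?e \<le> C2 * q2 ^ l * 1" using C2(1,2) C2(4)[of l] by (intro mult_mono) auto
    hence "\<bar>(g - v l) * ?e\<bar> \<le> C2 * q2 ^ l" by (simp add: abs_mult)
    moreover have "w l k - v l * ?e = (w l k - g * ?e) + (g - v l) * ?e" by (simp add: algebra_simps)
    ultimately have "\<bar>w l k - v l * ?e\<bar> \<le> C1 * err c l k + C1 * q1 ^ l + C2 * q2 ^ l"
      using k1[OF k, of l] by linarith
    also have "\<dots> \<le> C1 * err c l k + C2 * err c l k + C1 * q ^ l + C2 * q ^ l"
      using C1 C2 err_nonneg[of c l k] unfolding q_def by (intro add_mono mult_left_mono power_mono) (auto intro: add_increasing2)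
    also have "\<dots> = (C1 + C2) * (err c l k + q ^ l)" by (simp add: algebra_simps)
    finally have *: "\<bar>w l k - v l * ?e\<bar> \<le> (C1 + C2) * (err c l k + q ^ l)" .
    have "w l k / v l - ?e = (w l k - v l * ?e) / v l" using vl by (simp add: field_simps)
    hence "\<bar>w l k / v l - ?e\<bar> = \<bar>w l k - v l * ?e\<bar> / v l" using vl by simp
    also have "\<dots> \<le> (C1 + C2) * (err c l k + q ^ l) / (g / 2)"
      using * vl by (intro frac_le) auto
    also have "\<dots> = C * (err c l k + q ^ l)" by (simp add: C_def)
    finally show "\<bar>w l k / v l - ?e\<bar> \<le> C * err c l k + C * q ^ l" by (simp add: distrib_left)
  qed (use C C1 C2 in \<open>auto simp: q_def\<close>)
qed

text \<open>Defined so that \<open>b = a powr (1 + \<rho>)\<close>.\<close>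

definition \<rho> where "\<rho> = ln b / ln a - 1"

lemma rho_bounds: "0 < \<rho>" "\<rho> \<le> 1"
proof -
  have "ln a > 0" using a by simp
  moreover have "ln a < ln b" using a ab by simp
  ultimately show "0 < \<rho>" by (simp add: \<rho>_def)
  have "ln b \<le> ln (a\<^sup>2)" using ba b_pos a by (subst ln_le_cancel_iff) auto
  also have "\<dots> = 2 * ln a" using a by (simp add: ln_realpow)
  finally show "\<rho> \<le> 1" using \<open>ln a > 0\<close> by (simp add: \<rho>_def divide_le_eq)
qed

lemma b_eq: "b = a powr (1 + \<rho>)"
  using a b_pos by (simp add: \<rho>_def powr_def)

text \<open>With \<open>y = l / a ^ k\<close>, the term \<open>l / b ^ k\<close> is
  \<open>l powr (- \<rho>) * y powr (1 + \<rho>)\<close>, and \<open>1 / a ^ k\<close> is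
  \<open>y / l\<close>, at most \<open>l powr (- \<rho>) * y\<close> because
  \<open>\<rho> \<le> 1\<close>. The exponential tames \<open>y\<close> and its square for large
  \<open>y\<close>, so that \<open>min 1 y\<close> is left.\<close>

lemma err_le:
  assumes c: "c > 0" and l: "l \<ge> 1"
  shows "err c l k \<le> (2 + 3 / c + 2 / c\<^sup>2) * ((real k + 1) * real l powr (- \<rho>) * min 1 (real l / a ^ k))"
proof -
  define y where "y = real l / a ^ k"
  have ak: "a ^ k > 0" using a by simp
  have y: "y > 0" using l ak by (simp add: y_def)
  define X where "X = exp (- (c * y))"
  have X: "X > 0" "X \<le> 1" using c y by (auto simp: X_def)
  have bk: "b ^ k = (a ^ k) powr (1 + \<rho>)"
  proof -
    have "b ^ k = (a powr (1 + \<rho>)) ^ k" by (rule arg_cong[OF b_eq])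
    thus ?thesis using a by (simp add: powr_power powr_realpow[symmetric] powr_powr mult.commute)
  qed
  have "real l / b ^ k = real l powr (- \<rho>) * y powr (1 + \<rho>)"
    unfolding bk y_def using l ak by (simp add: powr_divide powr_add powr_minus field_simps)
  moreover have "1 / a ^ k = real l powr (- 1) * y" using l by (simp add: y_def powr_minus field_simps)
  moreover have "real l powr (- 1) \<le> real l powr (- \<rho>)" using l rho_bounds by (intro powr_mono) auto
  hence "real l powr (- 1) * y \<le> real l powr (- \<rho>) * y" using y by (intro mult_right_mono) auto
  moreover have "y powr (1 + \<rho>) \<le> y + y\<^sup>2"
  proof (cases "y \<le> 1")
    case True
    have "y powr (1 + \<rho>) \<le> y powr 1" using True y rho_bounds by (intro powr_mono') auto
    thus ?thesis using y by (simp add: add_increasing2)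
  next
    case False
    have "y powr (1 + \<rho>) \<le> y powr 2" using False y rho_bounds by (intro powr_mono) auto
    thus ?thesis using y by simp
  qed
  hence "real l powr (- \<rho>) * y powr (1 + \<rho>) \<le> real l powr (- \<rho>) * (y + y\<^sup>2)"
    by (intro mult_left_mono) auto
  ultimately have 1: "real l / b ^ k + 1 / a ^ k \<le> real l powr (- \<rho>) * (2 * y + y\<^sup>2)"
    by (simp add: algebra_simps)
  have e1: "c * y * X \<le> 1"
  proof -
    have "c * y \<le> exp (c * y)" using exp_ge_add_one_self[of "c * y"] by linarith
    hence "c * y * X \<le> exp (c * y) * X" using X by (intro mult_right_mono) auto
    thus ?thesis by (simp add: X_def exp_minus)
  qed
  have e2: "(c * y)\<^sup>2 * X \<le> 2"
  proof -
    have "1 + c * y + (c * y)\<^sup>2 / 2 \<le> exp (c * y)" using c y by (intro exp_lower_Taylor_quadratic) auto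
    moreover have "0 < c * y" using c y by simp
    ultimately have "(c * y)\<^sup>2 \<le> 2 * exp (c * y)" by linarith
    hence "(c * y)\<^sup>2 * X \<le> 2 * exp (c * y) * X" using X by (intro mult_right_mono) auto
    also have "\<dots> = 2" by (simp add: X_def exp_minus)
    finally show ?thesis .
  qed
  have yX: "y * X \<le> 1 / c" using e1 c by (simp add: field_simps)
  have y2X: "y\<^sup>2 * X \<le> 2 / c\<^sup>2" using e2 c by (simp add: field_simps power_mult_distrib)
  \<comment> \<open>Large enough for both cases below: \<open>2 + 1 / c\<close> suffices if
    \<open>y \<le> 1\<close>, \<open>2 / c + 2 / c\<^sup>2\<close> otherwise.\<close>
  define K where "K = 2 + 3 / c + 2 / c\<^sup>2"
  have c0: "0 \<le> 1 / c" "0 \<le> 2 / c\<^sup>2" using c by auto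
  have K: "K = 2 + 3 * (1 / c) + 2 / c\<^sup>2" by (simp add: K_def)
  have "(2 * y + y\<^sup>2) * X \<le> K * min 1 y"
  proof (cases "y \<le> 1")
    case True
    have "(2 * y + y\<^sup>2) * X = y * (2 * X + y * X)" by (simp add: algebra_simps power2_eq_square)
    also have "2 * X + y * X \<le> K" using X yX c0 unfolding K by linarith
    hence "y * (2 * X + y * X) \<le> y * K" using y by (intro mult_left_mono) auto
    finally show ?thesis using True by (simp add: mult.commute)
  next
    case False
    have "(2 * y + y\<^sup>2) * X = 2 * (y * X) + y\<^sup>2 * X" by (simp add: algebra_simps)
    also have "\<dots> \<le> 2 * (1 / c) + 2 / c\<^sup>2" using yX y2X by (intro add_mono mult_left_mono) auto
    also have "\<dots> \<le> K" using c0 unfolding K by linarith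
    finally show ?thesis using False by simp
  qed
  have "err c l k = (real k + 1) * ((real l / b ^ k + 1 / a ^ k) * X)"
    by (simp add: err_def X_def y_def)
  also have "\<dots> \<le> (real k + 1) * (real l powr (- \<rho>) * (2 * y + y\<^sup>2) * X)"
    using 1 X by (intro mult_left_mono mult_right_mono) auto
  also have "\<dots> = (real k + 1) * (real l powr (- \<rho>) * ((2 * y + y\<^sup>2) * X))" by simp
  also have "\<dots> \<le> (real k + 1) * (real l powr (- \<rho>) * (K * min 1 y))"
    using \<open>(2 * y + y\<^sup>2) * X \<le> K * min 1 y\<close> by (intro mult_left_mono) auto
  finally show ?thesis by (simp add: K_def y_def mult_ac)
qed

end

section \<open>Summation of the error over k\<close>

context perturbed_coeffs
begin

text \<open>The sum is split at \<open>k = 2 * log a l\<close>. Below, there are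
  \<open>O(log l)\<close> terms of size \<open>O((log l)\<^sup>2)\<close>. Above,
  \<open>a ^ k\<close> exceeds the square of \<open>l\<close>, so \<open>l / a ^ k\<close> is at
  most \<open>q ^ k\<close> with \<open>q = 1 / sqrt a\<close>, and the series converges.\<close>

lemma sum_min_le:
  obtains C where "C > 0"
    "\<And>l. l \<ge> 2 \<Longrightarrow> (\<Sum>k\<le>l. (real k + 1)\<^sup>2 * min 1 (real l / a ^ k)) \<le> C * ln (real l) ^ 3"
proof -
  define q where "q = 1 / sqrt a"
  have q: "0 < q" "q < 1" using a by (auto simp: q_def)
  have sq: "a = (1 / q)\<^sup>2" using a by (simp add: q_def)
  \<comment> \<open>Half of the geometric decay absorbs the polynomial weight, the other half gives
    the convergent majorant.\<close>
  define p where "p = sqrt q"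
  have p: "0 < p" "p < 1" "q = p * p" using q by (auto simp: p_def)
  have "(\<lambda>k. (real k + 1)\<^sup>2 * p ^ k) \<longlonglongrightarrow> 0" using p(1,2) by real_asymp
  hence "\<forall>\<^sub>F k in sequentially. (real k + 1)\<^sup>2 * p ^ k < 1" by (intro order_tendstoD(2)) auto
  hence "\<forall>\<^sub>F k in sequentially. norm ((real k + 1)\<^sup>2 * q ^ k) \<le> p ^ k"
  proof eventually_elim
    case (elim k)
    have "(real k + 1)\<^sup>2 * q ^ k = ((real k + 1)\<^sup>2 * p ^ k) * p ^ k"
      unfolding p(3) power_mult_distrib by simp
    also have "\<dots> \<le> 1 * p ^ k" using elim p by (intro mult_right_mono) auto
    finally show ?case using q by simp
  qed
  hence summ: "summable (\<lambda>k. (real k + 1)\<^sup>2 * q ^ k)"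
    by (rule summable_comparison_test_ev) (use p in \<open>simp add: summable_geometric\<close>)
  define S where "S = suminf (\<lambda>k. (real k + 1)\<^sup>2 * q ^ k)"
  have lna: "ln a > 0" using a by simp
  define D where "D = 2 / ln a + 2"
  have D: "D > 0" using lna by (simp add: D_def add_pos_pos)
  have S0: "S \<ge> 0" unfolding S_def using q by (intro suminf_nonneg summ) auto
  show ?thesis
  proof (rule that[of "D ^ 3 + 8 * S"])
    show "D ^ 3 + 8 * S > 0" using D S0 by (simp add: add_pos_nonneg)
    fix l :: nat assume l: "l \<ge> 2"
    define t where "t = 2 * ln (real l) / ln a"
    have "ln 2 \<le> ln (real l)" using l by simp
    hence ll: "1 / 2 \<le> ln (real l)" using ln2_ge_two_thirds by linarith
    hence t0: "t \<ge> 0" using lna by (simp add: t_def)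
    have t1: "t + 1 \<le> D * ln (real l)" using ll by (simp add: t_def D_def distrib_right)
    have pt: "(real k + 1)\<^sup>2 * min 1 (real l / a ^ k) \<le> (if real k \<le> t then (t + 1)\<^sup>2 else 0) + (real k + 1)\<^sup>2 * q ^ k" for k
    proof (cases "real k \<le> t")
      case True
      have "(real k + 1)\<^sup>2 * min 1 (real l / a ^ k) \<le> (t + 1)\<^sup>2 * 1"
        using True a by (intro mult_mono power_mono) auto
      moreover have "0 \<le> (real k + 1)\<^sup>2 * q ^ k" using q by simp
      ultimately show ?thesis using True by simp
    next
      case False
      hence "2 * ln (real l) \<le> real k * ln a" using lna by (simp add: t_def field_simps)
      hence "ln ((real l)\<^sup>2) \<le> ln (a ^ k)" using l a by (simp add: ln_realpow)
      hence "(real l)\<^sup>2 \<le> a ^ k" using l a by (subst (asm) ln_le_cancel_iff) auto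
      also have "\<dots> = ((1 / q) ^ k)\<^sup>2" by (subst sq) (simp add: power_mult[symmetric] mult.commute)
      finally have le: "real l \<le> (1 / q) ^ k" by (rule power2_le_imp_le) (use q in simp)
      have ak: "a ^ k = (1 / q) ^ k * (1 / q) ^ k" by (subst sq) (simp add: power2_eq_square power_divide power_mult_distrib)
      have "real l / a ^ k \<le> (1 / q) ^ k / a ^ k" using le a by (intro divide_right_mono) auto
      also have "\<dots> = q ^ k" unfolding ak using q by (simp add: power_divide)
      finally have "min 1 (real l / a ^ k) \<le> q ^ k" by simp
      hence "(real k + 1)\<^sup>2 * min 1 (real l / a ^ k) \<le> (real k + 1)\<^sup>2 * q ^ k" by (intro mult_left_mono) auto
      thus ?thesis using False by simp
    qed
    have "(\<Sum>k\<le>l. (real k + 1)\<^sup>2 * min 1 (real l / a ^ k))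
       \<le> (\<Sum>k\<le>l. (if real k \<le> t then (t + 1)\<^sup>2 else 0)) + (\<Sum>k\<le>l. (real k + 1)\<^sup>2 * q ^ k)"
      unfolding sum.distrib[symmetric] by (intro sum_mono pt)
    also have "(\<Sum>k\<le>l. (real k + 1)\<^sup>2 * q ^ k) \<le> S"
      unfolding S_def using q by (intro sum_le_suminf summ) auto
    also have "(\<Sum>k\<le>l. (if real k \<le> t then (t + 1)\<^sup>2 else 0)) = real (card {k \<in> {..l}. real k \<le> t}) * (t + 1)\<^sup>2"
      by (simp add: sum.inter_filter[symmetric])
    also have "\<dots> \<le> (t + 1) * (t + 1)\<^sup>2"
    proof (intro mult_right_mono)
      have "card {k \<in> {..l}. real k \<le> t} \<le> card {..nat \<lfloor>t\<rfloor>}"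
        by (intro card_mono) (auto simp: le_nat_floor)
      hence "real (card {k \<in> {..l}. real k \<le> t}) \<le> real (nat \<lfloor>t\<rfloor>) + 1" by simp
      also have "real (nat \<lfloor>t\<rfloor>) \<le> t" using t0 by simp
      finally show "real (card {k \<in> {..l}. real k \<le> t}) \<le> t + 1" by simp
    qed simp
    also have "(t + 1) * (t + 1)\<^sup>2 + S \<le> (D * ln (real l)) ^ 3 + S"
    proof -
      have "(t + 1) ^ 3 \<le> (D * ln (real l)) ^ 3" using t1 t0 by (intro power_mono) auto
      thus ?thesis by (simp add: power3_eq_cube power2_eq_square)
    qed
    \<comment> \<open>For \<open>l \<ge> 2\<close> the logarithm is at least \<open>1 / 2\<close>,
      so a constant is absorbed by eight times its cube.\<close>
    also have "S \<le> S * (8 * ln (real l) ^ 3)"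
    proof -
      have "(1 / 2) ^ 3 \<le> ln (real l) ^ 3" using ll by (intro power_mono) auto
      hence "1 \<le> 8 * ln (real l) ^ 3" by (simp add: power3_eq_cube)
      from mult_left_mono[OF this S0] show ?thesis by simp
    qed
    finally show "(\<Sum>k\<le>l. (real k + 1)\<^sup>2 * min 1 (real l / a ^ k)) \<le> (D ^ 3 + 8 * S) * ln (real l) ^ 3"
      by (simp add: power_mult_distrib algebra_simps)
  qed
qed

text \<open>The weight \<open>2 * k + 1\<close> and the factor \<open>k + 1\<close> in
  \<open>err\<close> produce the square in \<open>sum_min_le\<close>. The terms \<open>q ^ l\<close>
  add up to at most a multiple of \<open>(l + 1)\<^sup>2 * q ^ l\<close>, and the indices below
  \<open>k1\<close> contribute boundedly many terms.\<close>

theorem sums_error: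
  obtains C where "C > 0"
    "\<forall>\<^sub>F l in sequentially. (\<Sum>k\<le>l. (2 * real k + 1) * \<bar>w l k / v l - exp (- \<delta> * real l / a ^ k)\<bar>)
        \<le> C * (ln (real l) ^ 3 * real l powr (- \<rho>))"
proof -
  obtain C c q k1 l1 where C: "C > 0" "c > 0" "0 < q" "q < 1"
    and rat: "\<And>l k. l \<ge> l1 \<Longrightarrow> k \<ge> k1 \<Longrightarrow> \<bar>w l k / v l - exp (- \<delta> * real l / a ^ k)\<bar> \<le> C * err c l k + C * q ^ l"
    and vpos: "\<And>l. l \<ge> l1 \<Longrightarrow> v l > 0"
    by (rule ratio_estimate) blast
  obtain D where D: "D > 0" "\<And>l. l \<ge> 2 \<Longrightarrow> (\<Sum>k\<le>l. (real k + 1)\<^sup>2 * min 1 (real l / a ^ k)) \<le> D * ln (real l) ^ 3"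
    by (rule sum_min_le) blast
  define K where "K = 2 + 3 / c + 2 / c\<^sup>2"
  have K: "K > 0" using C by (simp add: K_def add_pos_nonneg)
  \<comment> \<open>The main term at the fixed index \<open>k1\<close> is
    \<open>exp (- d * l)\<close>.\<close>
  define d where "d = \<delta> / a ^ k1"
  have d: "d > 0" using delta_pos a by (simp add: d_def)
  have "(\<lambda>l. real l * exp (- d * real l)) \<longlonglongrightarrow> 0" using d by real_asymp
  hence ev1: "\<forall>\<^sub>F l in sequentially. real l * exp (- d * real l) < 1" by (intro order_tendstoD(2)) auto
  have "(\<lambda>l. real l * (((real l + 1)\<^sup>2 + (real k1)\<^sup>2) * q ^ l)) \<longlonglongrightarrow> 0" using C(3,4) by real_asymp
  hence ev2: "\<forall>\<^sub>F l in sequentially. real l * (((real l + 1)\<^sup>2 + (real k1)\<^sup>2) * q ^ l) < 1" by (intro order_tendstoD(2)) auto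
  define A where "A = (real k1)\<^sup>2 + (real k1)\<^sup>2 * (C * K * (real k1 + 1)) + C"
  define B where "B = 8 * A + 2 * C * K * D"
  have A0: "A > 0" using C K by (simp add: A_def add_nonneg_pos)
  have "B > 0" using A0 C K D by (simp add: B_def add_pos_pos)
  moreover have "\<forall>\<^sub>F l in sequentially. (\<Sum>k\<le>l. (2 * real k + 1) * \<bar>w l k / v l - exp (- \<delta> * real l / a ^ k)\<bar>)
        \<le> B * (ln (real l) ^ 3 * real l powr (- \<rho>))"
    using ev1 ev2 eventually_ge_at_top[of l1] eventually_ge_at_top[of 2]
  proof eventually_elim
    case (elim l)
    hence l: "l \<ge> l1" "l \<ge> 2" "l \<ge> 1" by auto
    define L where "L = real l powr (- \<rho>)"
    have L0: "L > 0" using l by (simp add: L_def)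
    have small: "x \<le> L" if "real l * x < 1" for x
    proof -
      have "x \<le> 1 / real l" using that l by (simp add: field_simps)
      also have "\<dots> = real l powr (- 1)" using l by (simp add: powr_minus divide_inverse)
      also have "\<dots> \<le> L" unfolding L_def using l rho_bounds by (intro powr_mono) auto
      finally show ?thesis .
    qed
    define G where "G k = exp (- \<delta> * real l / a ^ k)" for k
    define F where "F k = w l k / v l" for k
    have vl: "v l > 0" by (rule vpos[OF l(1)])
    have er: "err c l k \<le> K * ((real k + 1) * L * min 1 (real l / a ^ k))" for k
      using err_le[OF C(2) l(3)] unfolding K_def L_def .
    have er1: "err c l k \<le> K * (real k + 1) * L" for k
    proof -
      have "K * ((real k + 1) * L * min 1 (real l / a ^ k)) \<le> K * ((real k + 1) * L * 1)"
        using K L0 by (intro mult_left_mono) auto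
      with er[of k] show ?thesis by simp
    qed
    have G1: "G k1 \<le> L" using small[of "G k1"] elim(1) by (simp add: G_def d_def)
    have bound: "\<bar>F k - G k\<bar> \<le> (if k < k1 then G k1 + C * err c l k1 + C * q ^ l else 0) + (C * err c l k + C * q ^ l)" for k
    proof (cases "k < k1")
      case False
      thus ?thesis using rat[OF l(1), of k] by (simp add: F_def G_def)
    next
      case True
      \<comment> \<open>The estimate fails for small \<open>k\<close>, but there \<open>F\<close> is below its exponentially small value at \<open>k1\<close>.\<close>
      have "w l k \<le> w l k1" using True by (intro monoD[OF w_mono]) simp
      hence "F k \<le> F k1" using vl by (simp add: F_def divide_right_mono)
      also have "\<dots> \<le> G k1 + C * err c l k1 + C * q ^ l" using rat[OF l(1), of k1] unfolding F_def G_def by (simp add: abs_le_iff)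
      finally have 1: "F k \<le> G k1 + C * err c l k1 + C * q ^ l" .
      have "a ^ k \<le> a ^ k1" using True a by (intro power_increasing) auto
      hence "\<delta> * real l / a ^ k1 \<le> \<delta> * real l / a ^ k" using delta_pos a by (intro divide_left_mono) auto
      hence 2: "G k \<le> G k1" by (simp add: G_def)
      have "0 \<le> F k" "0 \<le> G k" using w_nonneg vl by (simp_all add: F_def G_def)
      moreover have "0 \<le> C * err c l k + C * q ^ l" "0 \<le> C * err c l k1 + C * q ^ l" using C err_nonneg by auto
      ultimately show ?thesis using 1 2 True by simp
    qed
    have "(\<Sum>k\<le>l. (2 * real k + 1) * \<bar>F k - G k\<bar>)
       \<le> (\<Sum>k\<le>l. (2 * real k + 1) * ((if k < k1 then G k1 + C * err c l k1 + C * q ^ l else 0) + (C * err c l k + C * q ^ l)))"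
      by (intro sum_mono mult_left_mono bound) auto
    also have "\<dots> = (\<Sum>k\<le>l. (if k < k1 then (2 * real k + 1) * (G k1 + C * err c l k1 + C * q ^ l) else 0))
         + (\<Sum>k\<le>l. (2 * real k + 1) * (C * err c l k)) + (\<Sum>k\<le>l. 2 * real k + 1) * (C * q ^ l)"
    proof -
      have "(2 * real k + 1) * ((if k < k1 then x else 0) + (y + z))
          = (if k < k1 then (2 * real k + 1) * x else 0) + (2 * real k + 1) * y + (2 * real k + 1) * z" for k x y z
        by (simp add: distrib_left)
      hence "(\<Sum>k\<le>l. (2 * real k + 1) * ((if k < k1 then G k1 + C * err c l k1 + C * q ^ l else 0) + (C * err c l k + C * q ^ l)))
         = (\<Sum>k\<le>l. (if k < k1 then (2 * real k + 1) * (G k1 + C * err c l k1 + C * q ^ l) else 0)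
             + (2 * real k + 1) * (C * err c l k) + (2 * real k + 1) * (C * q ^ l))"
        by (simp only:)
      thus ?thesis unfolding sum.distrib[of _ "\<lambda>k. (2 * real k + 1) * (C * q ^ l)"] sum.distrib[of _ "\<lambda>k. (2 * real k + 1) * (C * err c l k)"]
        sum_distrib_right[symmetric] .
    qed
    also have "(\<Sum>k\<le>l. 2 * real k + 1) = (real l + 1)\<^sup>2"
      by (induction l) (auto simp: power2_eq_square algebra_simps)
    also have "(\<Sum>k\<le>l. (if k < k1 then (2 * real k + 1) * (G k1 + C * err c l k1 + C * q ^ l) else 0))
       \<le> (real k1)\<^sup>2 * (L + C * (K * (real k1 + 1) * L) + C * q ^ l)"
    proof -
      have nn: "0 \<le> G k1 + C * err c l k1 + C * q ^ l" using C err_nonneg[of c l k1] by (simp add: G_def)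
      have "(\<Sum>k\<le>l. (if k < k1 then (2 * real k + 1) * (G k1 + C * err c l k1 + C * q ^ l) else 0))
         = (\<Sum>k\<in>{..l} \<inter> {..<k1}. (2 * real k + 1) * (G k1 + C * err c l k1 + C * q ^ l))"
        by (simp add: sum.inter_restrict)
      also have "\<dots> \<le> (\<Sum>k\<in>{..<k1}. (2 * real k + 1) * (G k1 + C * err c l k1 + C * q ^ l))"
        using nn by (intro sum_mono2) auto
      also have "\<dots> = (real k1)\<^sup>2 * (G k1 + C * err c l k1 + C * q ^ l)"
      proof -
        have "(\<Sum>k<n. 2 * real k + 1) = (real n)\<^sup>2" for n
          by (induction n) (auto simp: power2_eq_square algebra_simps)
        thus ?thesis by (simp only: sum_distrib_right[symmetric])
      qed
      also have "\<dots> \<le> (real k1)\<^sup>2 * (L + C * (K * (real k1 + 1) * L) + C * q ^ l)"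
        using G1 er1[of k1] C by (intro mult_left_mono add_mono) auto
      finally show ?thesis .
    qed
    also have "(\<Sum>k\<le>l. (2 * real k + 1) * (C * err c l k)) \<le> 2 * C * K * L * (D * ln (real l) ^ 3)"
    proof -
      have "(\<Sum>k\<le>l. (2 * real k + 1) * (C * err c l k))
          \<le> (\<Sum>k\<le>l. (2 * (real k + 1)) * (C * (K * ((real k + 1) * L * min 1 (real l / a ^ k)))))"
        using C err_nonneg er by (intro sum_mono mult_mono mult_left_mono) auto
      also have "\<dots> = 2 * C * K * L * (\<Sum>k\<le>l. (real k + 1)\<^sup>2 * min 1 (real l / a ^ k))"
        unfolding sum_distrib_left by (intro sum.cong refl) (simp add: power2_eq_square algebra_simps)
      also have "\<dots> \<le> 2 * C * K * L * (D * ln (real l) ^ 3)"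
        using D(2)[OF l(2)] C K L0 by (intro mult_left_mono) auto
      finally show ?thesis .
    qed
    also have "(real k1)\<^sup>2 * (L + C * (K * (real k1 + 1) * L) + C * q ^ l) + 2 * C * K * L * (D * ln (real l) ^ 3) + (real l + 1)\<^sup>2 * (C * q ^ l)
       = L * ((real k1)\<^sup>2 + (real k1)\<^sup>2 * (C * K * (real k1 + 1))) + C * (((real l + 1)\<^sup>2 + (real k1)\<^sup>2) * q ^ l) + 2 * C * K * D * (ln (real l) ^ 3 * L)"
      by (simp add: algebra_simps)
    also have "C * (((real l + 1)\<^sup>2 + (real k1)\<^sup>2) * q ^ l) \<le> C * L"
      using small[OF elim(2)] C by (intro mult_left_mono) auto
    also have "L * ((real k1)\<^sup>2 + (real k1)\<^sup>2 * (C * K * (real k1 + 1))) + C * L + 2 * C * K * D * (ln (real l) ^ 3 * L)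
        = A * L * 1 + 2 * C * K * D * (ln (real l) ^ 3 * L)"
      by (simp add: A_def algebra_simps)
    also have "A * L * 1 \<le> A * L * (8 * ln (real l) ^ 3)"
    proof (intro mult_left_mono)
      have "ln 2 \<le> ln (real l)" using l by simp
      hence ll: "1 / 2 \<le> ln (real l)" using ln2_ge_two_thirds by linarith
      have "(1 / 2) ^ 3 \<le> ln (real l) ^ 3" using ll by (intro power_mono) auto
      thus "1 \<le> 8 * ln (real l) ^ 3" by (simp add: power3_eq_cube)
    qed (use A0 L0 in auto)
    also have "A * L * (8 * ln (real l) ^ 3) + 2 * C * K * D * (ln (real l) ^ 3 * L) = B * (ln (real l) ^ 3 * L)"
      by (simp add: B_def algebra_simps)
    finally show ?case by (simp add: F_def G_def L_def)
  qed
  ultimately show ?thesis by (rule that)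
qed

text \<open>An absolute error tending to 0 suffices, because within bounded distance of
  \<open>log a l\<close> the exponential stays away from 0.\<close>

theorem ratio_asymp_equiv:
  fixes \<kappa> :: "nat \<Rightarrow> nat"
  assumes \<kappa>: "(\<lambda>l. real (\<kappa> l) - log a (real l)) \<in> O(\<lambda>_. 1)"
  shows "(\<lambda>l. w l (\<kappa> l) / v l) \<sim>[sequentially] (\<lambda>l. exp (- \<delta> * real l / a ^ \<kappa> l))"
proof -
  obtain C c q k1 l1 where C: "C > 0" "c > 0" "0 < q" "q < 1"
    and rat: "\<And>l k. l \<ge> l1 \<Longrightarrow> k \<ge> k1 \<Longrightarrow> \<bar>w l k / v l - exp (- \<delta> * real l / a ^ k)\<bar> \<le> C * err c l k + C * q ^ l"
    by (rule ratio_estimate) blast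
  obtain B where B: "B > 0" "\<forall>\<^sub>F l in sequentially. \<bar>real (\<kappa> l) - log a (real l)\<bar> \<le> B"
    using landau_o.bigE[OF \<kappa>] by auto
  define K where "K = 2 + 3 / c + 2 / c\<^sup>2"
  have K: "K > 0" using C by (simp add: K_def add_pos_nonneg)
  \<comment> \<open>Lower bound for the main term: \<open>\<kappa> l \<ge> log a l - B\<close> gives
    \<open>l / a ^ \<kappa> l \<le> a powr B\<close>.\<close>
  define \<gamma> where "\<gamma> = exp (- \<delta> * a powr B)"
  have lim: "(\<lambda>l. (C * (K * ((log a (real l) + B + 1) * real l powr (- \<rho>))) + C * q ^ l) / \<gamma>) \<longlonglongrightarrow> 0"
  proof -
    have "(\<lambda>l. (log a (real l) + B + 1) * real l powr (- \<rho>)) \<longlonglongrightarrow> 0"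
      using a rho_bounds(1) by real_asymp
    moreover have "(\<lambda>l. q ^ l) \<longlonglongrightarrow> 0" using C by (intro LIMSEQ_power_zero) auto
    ultimately have "(\<lambda>l. (C * (K * ((log a (real l) + B + 1) * real l powr (- \<rho>))) + C * q ^ l) / \<gamma>) \<longlonglongrightarrow> (C * (K * 0) + C * 0) / \<gamma>"
      by (intro tendsto_intros) (use C in \<open>auto simp: \<gamma>_def\<close>)
    thus ?thesis by simp
  qed
  have "filterlim (\<lambda>l. log a (real l) - B) at_top sequentially" using a by real_asymp
  hence ev: "\<forall>\<^sub>F l in sequentially. log a (real l) - B \<ge> real k1" by (simp add: filterlim_at_top)
  have "(\<lambda>l. w l (\<kappa> l) / v l / exp (- \<delta> * real l / a ^ \<kappa> l) - 1) \<longlonglongrightarrow> 0"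
  proof (rule Lim_null_comparison[OF _ lim])
    show "\<forall>\<^sub>F l in sequentially. norm (w l (\<kappa> l) / v l / exp (- \<delta> * real l / a ^ \<kappa> l) - 1)
       \<le> (C * (K * ((log a (real l) + B + 1) * real l powr (- \<rho>))) + C * q ^ l) / \<gamma>"
      using B(2) ev eventually_ge_at_top[of l1] eventually_ge_at_top[of 1]
    proof eventually_elim
      case (elim l)
      let ?G = "exp (- \<delta> * real l / a ^ \<kappa> l)"
      have kk: "\<kappa> l \<ge> k1" "real (\<kappa> l) \<le> log a (real l) + B" "log a (real l) - B \<le> real (\<kappa> l)" using elim(1,2) by auto
      have "real l = a powr (log a (real l))" using elim(4) a by simp
      also have "\<dots> \<le> a powr (B + real (\<kappa> l))" using kk a by (intro powr_mono) auto
      also have "\<dots> = a powr B * a ^ \<kappa> l" using a by (simp add: powr_add powr_realpow)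
      finally have "real l / a ^ \<kappa> l \<le> a powr B" using a by (simp add: pos_divide_le_eq)
      hence "\<delta> * (real l / a ^ \<kappa> l) \<le> \<delta> * a powr B" using delta_pos by (intro mult_left_mono) auto
      hence G: "?G \<ge> \<gamma>" by (simp add: \<gamma>_def)
      have g0: "\<gamma> > 0" by (simp add: \<gamma>_def)
      have "\<bar>w l (\<kappa> l) / v l - ?G\<bar> \<le> C * err c l (\<kappa> l) + C * q ^ l" using rat[OF elim(3) kk(1)] .
      also have "err c l (\<kappa> l) \<le> K * ((real (\<kappa> l) + 1) * real l powr (- \<rho>) * min 1 (real l / a ^ \<kappa> l))"
        using err_le[OF C(2) elim(4)] unfolding K_def .
      also have "\<dots> \<le> K * ((log a (real l) + B + 1) * real l powr (- \<rho>) * 1)"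
        using K kk a by (intro mult_left_mono mult_mono mult_right_mono) auto
      finally have *: "\<bar>w l (\<kappa> l) / v l - ?G\<bar> \<le> C * (K * ((log a (real l) + B + 1) * real l powr (- \<rho>))) + C * q ^ l"
        using C by simp
      have "w l (\<kappa> l) / v l / ?G - 1 = (w l (\<kappa> l) / v l - ?G) / ?G" by (simp add: diff_divide_distrib)
      hence "norm (w l (\<kappa> l) / v l / ?G - 1) = \<bar>w l (\<kappa> l) / v l - ?G\<bar> / ?G" by simp
      also have "\<dots> \<le> (C * (K * ((log a (real l) + B + 1) * real l powr (- \<rho>))) + C * q ^ l) / \<gamma>"
        using * G g0 by (intro frac_le) auto
      finally show ?case .
    qed
  qed
  hence "(\<lambda>l. w l (\<kappa> l) / v l / exp (- \<delta> * real l / a ^ \<kappa> l)) \<longlonglongrightarrow> 1"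
    by (subst (asm) LIM_zero_iff)
  thus ?thesis by (intro asymp_equivI') simp
qed

end

section \<open>Moments and weak convergence\<close>

text \<open>The hypothesis \<open>F1\<close> bounds the variable by \<open>n + 1\<close> almost
  surely, so clamping does not change it and the tail sums of \<open>sum_indicator_less_int\<close>
  are exact.\<close>

lemma rv_with_cdf_moments:
  assumes rv: "rv_with_cdf M X F" and F1: "F (Suc n) = 1"
  shows "integrable M (\<lambda>\<omega>. real (X \<omega>))" "integrable M (\<lambda>\<omega>. (real (X \<omega>))\<^sup>2)"
    and "prob_space.expectation M (\<lambda>\<omega>. real (X \<omega>)) = (\<Sum>k\<le>n. 1 - F k)"
    and "prob_space.expectation M (\<lambda>\<omega>. (real (X \<omega>))\<^sup>2) = (\<Sum>k\<le>n. (2 * real k + 1) * (1 - F k))"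
proof -
  interpret prob_space M using rv unfolding rv_with_cdf_def by blast
  have [measurable]: "X \<in> M \<rightarrow>\<^sub>M count_space UNIV"
    and F: "\<And>k. prob {\<omega> \<in> space M. X \<omega> \<le> k} = F k"
    using rv unfolding rv_with_cdf_def by blast+
  have "AE \<omega> in M. \<omega> \<in> {\<omega> \<in> space M. X \<omega> \<le> Suc n}"
    using F[of "Suc n"] F1 by (intro AE_prob_1) simp
  hence le: "AE \<omega> in M. X \<omega> \<le> Suc n" by eventually_elim simp
  show "integrable M (\<lambda>\<omega>. real (X \<omega>))"
    by (rule integrable_const_bound[of _ "real (Suc n)"]) (use le in \<open>auto elim!: eventually_mono simp del: of_nat_Suc\<close>)
  show "integrable M (\<lambda>\<omega>. (real (X \<omega>))\<^sup>2)"
    by (rule integrable_const_bound[of _ "(real (Suc n))\<^sup>2"])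
       (use le in \<open>auto elim!: eventually_mono intro!: power_mono simp del: of_nat_Suc\<close>)
  let ?A = "\<lambda>k. {\<omega> \<in> space M. k < X \<omega>}"
  have prob: "prob (?A k) = 1 - F k" for k
  proof -
    have "?A k = space M - {\<omega> \<in> space M. X \<omega> \<le> k}" by auto
    thus ?thesis using F[of k] by (simp add: prob_compl)
  qed
  have ind: "(if int k < int (X \<omega>) then 1 else 0) = indicat_real (?A k) \<omega>" if "\<omega> \<in> space M" for k \<omega>
    using that by (simp add: indicator_def)
  have int: "integrable M (indicat_real (?A k))" for k
    by (rule integrable_const_bound[of _ 1]) auto
  have E: "(LINT \<omega>|M. indicat_real (?A k) \<omega>) = 1 - F k" for k
    using prob[of k] by (simp add: Int_absorb1[of _ "space M"])
  have clamp: "AE \<omega> in M. real (X \<omega>) = of_int (min (max (int (X \<omega>)) 0) (int n + 1))"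
    using le by eventually_elim auto
  have "expectation (\<lambda>\<omega>. real (X \<omega>)) = expectation (\<lambda>\<omega>. \<Sum>k\<le>n. indicat_real (?A k) \<omega>)"
  proof (rule integral_cong_AE)
    show "AE \<omega> in M. real (X \<omega>) = (\<Sum>k\<le>n. indicat_real (?A k) \<omega>)"
      using clamp AE_space
    proof eventually_elim
      case (elim \<omega>)
      show ?case using sum_indicator_less_int(1)[of "int (X \<omega>)" n] elim(1) by (simp only: ind[OF elim(2)])
    qed
  qed measurable
  also have "\<dots> = (\<Sum>k\<le>n. 1 - F k)"
    unfolding E[symmetric] by (rule Bochner_Integration.integral_sum) (rule int)
  finally show "expectation (\<lambda>\<omega>. real (X \<omega>)) = (\<Sum>k\<le>n. 1 - F k)" .
  have "expectation (\<lambda>\<omega>. (real (X \<omega>))\<^sup>2) = expectation (\<lambda>\<omega>. \<Sum>k\<le>n. (2 * real k + 1) * indicat_real (?A k) \<omega>)"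
  proof (rule integral_cong_AE)
    show "AE \<omega> in M. (real (X \<omega>))\<^sup>2 = (\<Sum>k\<le>n. (2 * real k + 1) * indicat_real (?A k) \<omega>)"
      using clamp AE_space
    proof eventually_elim
      case (elim \<omega>)
      show ?case using sum_indicator_less_int(2)[of "int (X \<omega>)" n] elim(1) by (simp only: ind[OF elim(2)])
    qed
  qed measurable
  also have "\<dots> = (\<Sum>k\<le>n. (2 * real k + 1) * (1 - F k))"
    unfolding E[symmetric] integral_mult_right_zero[symmetric]
    by (rule Bochner_Integration.integral_sum) (intro integrable_mult_right int)
  finally show "expectation (\<lambda>\<omega>. (real (X \<omega>))\<^sup>2) = (\<Sum>k\<le>n. (2 * real k + 1) * (1 - F k))" .
qed

text \<open>The successive differences of \<open>F\<close> are nonnegative and telescope to 1.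
  Random variables as required in the theorem therefore exist.\<close>

lemma exists_pmf_with_cdf:
  fixes F :: "nat \<Rightarrow> real"
  assumes F0: "\<And>k. F k \<ge> 0" and mono: "mono F" and F1: "\<And>k. k > n \<Longrightarrow> F k = 1"
  shows "\<exists>p :: nat pmf. rv_with_cdf (measure_pmf p) id F"
proof -
  define f where "f k = (case k of 0 \<Rightarrow> F 0 | Suc j \<Rightarrow> F (Suc j) - F j)" for k
  have f0: "f k \<ge> 0" for k
    using F0 monoD[OF mono, of "k - 1" k] by (auto simp: f_def split: nat.splits)
  have tel: "(\<Sum>i\<le>k. f i) = F k" for k
    by (induction k) (auto simp: f_def)
  have "(\<integral>\<^sup>+k. ennreal (f k) \<partial>count_space UNIV) = (\<Sum>k\<le>Suc n. ennreal (f k))"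
    by (rule nn_integral_count_space') (auto simp: f_def F1 split: nat.splits)
  also have "\<dots> = ennreal (\<Sum>k\<le>Suc n. f k)" using f0 by (intro sum_ennreal)
  also have "\<dots> = 1" unfolding tel using F1[of "Suc n"] by simp
  finally have nn: "(\<integral>\<^sup>+k. ennreal (f k) \<partial>count_space UNIV) = 1" .
  define p where "p = embed_pmf f"
  have pmf: "pmf p k = f k" for k unfolding p_def by (rule pmf_embed_pmf[OF f0 nn])
  have "measure (measure_pmf p) {\<omega> \<in> space (measure_pmf p). id \<omega> \<le> k} = F k" for k
  proof -
    have "{\<omega> \<in> space (measure_pmf p). id \<omega> \<le> k} = {..k}" by auto
    thus ?thesis by (simp add: measure_measure_pmf_finite pmf tel)
  qed
  hence "rv_with_cdf (measure_pmf p) id F"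
    unfolding rv_with_cdf_def using prob_space_measure_pmf by auto
  thus ?thesis by blast
qed

lemma (in discretized_Gumbel) abs_Re_Psi0_le: "\<bar>Re (Psi0 a u)\<bar> \<le> 1 / 2"
proof -
  have "\<bar>LINT y|std_exp. saw (u + T y)\<bar> \<le> (LINT y|std_exp. \<bar>saw (u + T y)\<bar>)"
    by (rule integral_abs_bound)
  also have "\<dots> \<le> (LINT y|std_exp. 1 / 2)"
    using integrable_saw_T abs_saw_le by (intro integral_mono) auto
  finally show ?thesis using std_exp.prob_space by (simp add: expectation_saw)
qed

section \<open>The limit function and the moments\<close>

context perturbed_coeffs
begin

lemma G_lim_tendsto:
  assumes z: "cmod z < a" "z \<noteq> 1" "cpoly s0 z \<noteq> 0"
  shows "(\<lambda>k. cpoly (R k) z / cpoly (S k) z) \<longlonglongrightarrow> G_lim r0 s0 z"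
proof -
  have lim0: "(\<lambda>k. cpoly (F k) z) \<longlonglongrightarrow> 0" if F: "decaying a a F" for F
  proof -
    define r where "r = max 1 (cmod z)"
    have r: "1 \<le> r" "r < a" "cmod z \<le> r" using z a by (auto simp: r_def)
    have "\<exists>C\<ge>0. \<forall>k z. cmod z \<le> r \<longrightarrow> cmod (cpoly (F k) z) \<le> C * (r / a) ^ k \<and>
        cmod (cpoly (pderiv (F k)) z) \<le> C * (real k + 1) * (r / a) ^ k"
      using F r(1,2) unfolding decaying_def by simp
    then obtain C where C: "\<And>k. cmod (cpoly (F k) z) \<le> C * (r / a) ^ k"
      using r(3) by blast
    have "(\<lambda>k. C * (r / a) ^ k) \<longlonglongrightarrow> 0"
      using r by (intro tendsto_mult_right_zero LIMSEQ_power_zero) simp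
    thus ?thesis by (rule Lim_null_comparison[rotated]) (use C in simp)
  qed
  have "(\<lambda>k. (cpoly r0 z + cpoly (P k) z) / ((1 - z) * cpoly s0 z + cpoly (E k) z))
      \<longlonglongrightarrow> (cpoly r0 z + 0) / ((1 - z) * cpoly s0 z + 0)"
    using z by (intro tendsto_intros lim0 P decaying_E) auto
  moreover have "cpoly (S k) z = (1 - z) * cpoly s0 z + cpoly (E k) z" for k
    unfolding S_def cpoly_add cpoly_mult by simp
  ultimately show ?thesis by (simp add: G_lim_def R_def)
qed

lemma G_lim_sums:
  assumes z: "cmod z < 1"
  shows "(\<lambda>l. of_real (v l) * z ^ l) sums G_lim r0 s0 z"
proof -
  let ?T = "[:1, -1:] * s0"
  let ?f = "\<lambda>z. cpoly r0 z / cpoly ?T z"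
  have "cpoly s0 (of_real 0) \<noteq> 0" by (rule s0_nz) simp
  hence "poly.coeff s0 0 \<noteq> 0" unfolding cpoly_of_real by (simp add: poly_0_coeff_0)
  hence T0: "poly.coeff ?T 0 \<noteq> 0" by (simp add: coeff_mult_0)
  have cT: "cpoly ?T z = (1 - z) * cpoly s0 z" for z
    unfolding cpoly_mult by simp
  have coeff: "complex_of_real (v n) = (deriv ^^ n) ?f 0 / fact n" for n
    using fps_poly_quotient_coefficient[OF gfv T0, of n] by simp
  have "?f holomorphic_on ball 0 1"
    using s0_nz unfolding cT by (intro holomorphic_intros) auto
  from holomorphic_power_series[OF this, of z] z
  show ?thesis unfolding coeff[symmetric] by (simp only: cT G_lim_def mem_ball_0 diff_zero)
qed

definition F :: "nat \<Rightarrow> nat \<Rightarrow> real" where "F l k = w l k / v l"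

lemma F_eq_1: "v l \<noteq> 0 \<Longrightarrow> k > l \<Longrightarrow> F l k = 1"
  using v_eq_w[of l k] by (simp add: F_def)

lemma cdf_pmf:
  assumes "v l \<noteq> 0"
  shows "\<exists>p :: nat pmf. rv_with_cdf (measure_pmf p) id (F l)"
proof (rule exists_pmf_with_cdf)
  have vl: "v l > 0" using v_nonneg[of l] assms by simp
  show "mono (F l)" unfolding F_def using w_mono vl by (auto simp: mono_def divide_right_mono)
  show "F l k \<ge> 0" for k using w_nonneg v_nonneg by (simp add: F_def)
  show "F l k = 1" if "k > l" for k using F_eq_1[OF assms that] .
qed

text \<open>The sums for \<open>X_l\<close> are compared with those for the exponentials by
  \<open>sums_error\<close>, and these with the discretized Gumbel moments by
  \<open>moment_sums\<close> for \<open>x = \<delta> * l\<close> and \<open>n = l\<close>. The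
  result is an error \<open>O(L)\<close> with only the cube of the logarithm; the larger power in
  the statement follows from \<open>\<rho> > 0\<close>.\<close>

lemma moments_asymptotics:
  fixes M :: "nat \<Rightarrow> 'b measure"
  assumes v0: "\<And>l. l \<ge> l0 \<Longrightarrow> v l \<noteq> 0" and rv: "\<And>l. l \<ge> l0 \<Longrightarrow> rv_with_cdf (M l) (X l) (F l)"
  defines "u \<equiv> (\<lambda>l. log a (real l) + log a \<delta>)"
  defines "mean \<equiv> (\<lambda>l. prob_space.expectation (M l) (\<lambda>\<omega>. real (X l \<omega>)))"
  defines "var \<equiv> (\<lambda>l. prob_space.variance (M l) (\<lambda>\<omega>. real (X l \<omega>)))"
  shows "(\<lambda>l. mean l - discretized_Gumbel.meanX a (u l)) \<in> O(\<lambda>l. ln (real l) powr (\<rho> + 3) / real l powr \<rho>)"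
    and "(\<lambda>l. var l - discretized_Gumbel.varX a (u l)) \<in> O(\<lambda>l. ln (real l) powr (\<rho> + 4) / real l powr \<rho>)"
proof -
  interpret D: discretized_Gumbel a by unfold_locales (rule a)
  obtain C1 where C1: "C1 > 0"
    "\<And>x n. x > 0 \<Longrightarrow> 2 * log a x \<le> real n \<Longrightarrow>
        \<bar>(\<Sum>k\<le>n. 1 - exp (- x / a ^ k)) - D.meanX (log a x)\<bar> \<le> C1 * (1 / x + 1 / (real n + 1))"
    "\<And>x n. x > 0 \<Longrightarrow> 2 * log a x \<le> real n \<Longrightarrow>
        \<bar>(\<Sum>k\<le>n. (2 * real k + 1) * (1 - exp (- x / a ^ k))) - (D.varX (log a x) + (D.meanX (log a x))\<^sup>2)\<bar> \<le> C1 * (1 / x + 1 / (real n + 1))"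
    by (rule D.moment_sums) blast
  obtain C2 where C2: "C2 > 0" and ev: "\<forall>\<^sub>F l in sequentially. (\<Sum>k\<le>l. (2 * real k + 1) * \<bar>w l k / v l - exp (- \<delta> * real l / a ^ k)\<bar>)
        \<le> C2 * (ln (real l) ^ 3 * real l powr (- \<rho>))"
    by (rule sums_error) blast
  define C where "C = C1 * (1 / \<delta> + 1) + C2"
  have C: "C > 0" using C1 C2 delta_pos by (simp add: C_def add_pos_pos)
  define L where "L l = ln (real l) ^ 3 * real l powr (- \<rho>)" for l :: nat
  \<comment> \<open>Provides the hypothesis \<open>2 * log a x \<le> n\<close> of
    \<open>moment_sums\<close>.\<close>
  have "filterlim (\<lambda>l. real l - 2 * (log a (real l) + log a \<delta>)) at_top sequentially"
    using a by real_asymp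
  hence ev2: "\<forall>\<^sub>F l in sequentially. 0 \<le> real l - 2 * (log a (real l) + log a \<delta>)" unfolding filterlim_at_top by blast
  have evm: "\<forall>\<^sub>F l in sequentially. \<bar>mean l - D.meanX (u l)\<bar> \<le> C * L l
      \<and> \<bar>prob_space.expectation (M l) (\<lambda>\<omega>. (real (X l \<omega>))\<^sup>2) - (D.varX (u l) + (D.meanX (u l))\<^sup>2)\<bar> \<le> C * L l"
    using ev ev2 eventually_ge_at_top[of l0] eventually_ge_at_top[of 3]
  proof eventually_elim
    case (elim l)
    have l: "l \<ge> 3" "real l > 0" using elim by auto
    have x: "\<delta> * real l > 0" using delta_pos l by simp
    have lx: "log a (\<delta> * real l) = u l" using delta_pos l a by (simp add: u_def log_mult add.commute)
    have n: "2 * log a (\<delta> * real l) \<le> real l" using elim(2) unfolding lx u_def by simp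
    have ex: "exp (- (\<delta> * real l) / a ^ k) = exp (- \<delta> * real l / a ^ k)" for k by simp
    \<comment> \<open>The cut is at \<open>n = l\<close>, as the value 1 of \<open>F l\<close> is
      guaranteed from \<open>l + 1\<close> on.\<close>
    note mom = rv_with_cdf_moments[OF rv[OF elim(3)] F_eq_1[OF v0[OF elim(3)]], of l, OF lessI]
    have "exp 1 \<le> (3::real)" using e_less_272 by simp
    hence "exp 1 \<le> real l" using l by linarith
    hence ln1: "1 \<le> ln (real l)" using l by (subst ln_ge_iff) auto
    \<comment> \<open>The cutting errors are of order \<open>1 / l\<close> and are absorbed because
      \<open>\<rho> \<le> 1\<close> and, for \<open>l \<ge> 3\<close>,
      \<open>ln l \<ge> 1\<close>.\<close>
    have Lge: "real l powr (- 1) \<le> L l"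
    proof -
      have "real l powr (- 1) \<le> real l powr (- \<rho>)" using l rho_bounds by (intro powr_mono) auto
      also have "\<dots> = 1 * real l powr (- \<rho>)" by simp
      also have "\<dots> \<le> ln (real l) ^ 3 * real l powr (- \<rho>)" using ln1 by (intro mult_right_mono one_le_power) auto
      finally show ?thesis by (simp add: L_def)
    qed
    have small: "C1 * (1 / (\<delta> * real l) + 1 / (real l + 1)) \<le> C1 * (1 / \<delta> + 1) * L l"
    proof -
      have "1 / (\<delta> * real l) + 1 / (real l + 1) \<le> 1 / \<delta> * real l powr (- 1) + 1 * real l powr (- 1)"
        using l by (intro add_mono) (auto simp: powr_minus field_simps)
      also have "\<dots> = (1 / \<delta> + 1) * real l powr (- 1)" by (simp only: distrib_right)
      also have "\<dots> \<le> (1 / \<delta> + 1) * L l" using Lge delta_pos by (intro mult_left_mono) auto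
      finally show ?thesis using C1(1) by (simp add: mult.assoc mult_left_mono)
    qed
    have s1: "\<bar>(\<Sum>k\<le>l. 1 - F l k) - (\<Sum>k\<le>l. 1 - exp (- \<delta> * real l / a ^ k))\<bar> \<le> C2 * L l"
    proof -
      have "(\<Sum>k\<le>l. 1 - F l k) - (\<Sum>k\<le>l. 1 - exp (- \<delta> * real l / a ^ k)) = (\<Sum>k\<le>l. exp (- \<delta> * real l / a ^ k) - F l k)"
        by (simp add: sum_subtractf[symmetric])
      also have "\<bar>\<dots>\<bar> \<le> (\<Sum>k\<le>l. \<bar>exp (- \<delta> * real l / a ^ k) - F l k\<bar>)" by (rule sum_abs)
      also have "\<dots> \<le> (\<Sum>k\<le>l. (2 * real k + 1) * \<bar>w l k / v l - exp (- \<delta> * real l / a ^ k)\<bar>)"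
      proof (intro sum_mono)
        fix k
        have "x \<le> (2 * real k + 1) * x" if "0 \<le> x" for x :: real using that by (simp add: algebra_simps)
        thus "\<bar>exp (- \<delta> * real l / a ^ k) - F l k\<bar> \<le> (2 * real k + 1) * \<bar>w l k / v l - exp (- \<delta> * real l / a ^ k)\<bar>"
          unfolding F_def by (subst abs_minus_commute) simp
      qed
      also have "\<dots> \<le> C2 * L l" using elim(1) by (simp add: L_def)
      finally show ?thesis .
    qed
    have s2: "\<bar>(\<Sum>k\<le>l. (2 * real k + 1) * (1 - F l k)) - (\<Sum>k\<le>l. (2 * real k + 1) * (1 - exp (- \<delta> * real l / a ^ k)))\<bar> \<le> C2 * L l"
    proof -
      have "(\<Sum>k\<le>l. (2 * real k + 1) * (1 - F l k)) - (\<Sum>k\<le>l. (2 * real k + 1) * (1 - exp (- \<delta> * real l / a ^ k)))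
         = (\<Sum>k\<le>l. (2 * real k + 1) * (exp (- \<delta> * real l / a ^ k) - F l k))"
        unfolding sum_subtractf[symmetric] by (intro sum.cong refl) (simp add: algebra_simps)
      also have "\<bar>\<dots>\<bar> \<le> (\<Sum>k\<le>l. \<bar>(2 * real k + 1) * (exp (- \<delta> * real l / a ^ k) - F l k)\<bar>)" by (rule sum_abs)
      also have "\<dots> = (\<Sum>k\<le>l. (2 * real k + 1) * \<bar>w l k / v l - exp (- \<delta> * real l / a ^ k)\<bar>)"
        unfolding F_def by (intro sum.cong refl) (simp add: abs_mult abs_minus_commute)
      also have "\<dots> \<le> C2 * L l" using elim(1) by (simp add: L_def)
      finally show ?thesis .
    qed
    show ?case
    proof
      show "\<bar>mean l - D.meanX (u l)\<bar> \<le> C * L l"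
        using C1(2)[OF x n] small s1 unfolding mean_def mom(3) lx ex C_def distrib_right by linarith
      show "\<bar>prob_space.expectation (M l) (\<lambda>\<omega>. (real (X l \<omega>))\<^sup>2) - (D.varX (u l) + (D.meanX (u l))\<^sup>2)\<bar> \<le> C * L l"
        using C1(3)[OF x n] small s2 unfolding mom(4) lx ex C_def distrib_right by linarith
    qed
  qed
  have Lb: "L \<in> O(\<lambda>l. ln (real l) powr (\<rho> + 3) / real l powr \<rho>)"
    unfolding L_def using rho_bounds by real_asymp
  have CL: "x \<le> C * \<bar>L l\<bar>" if "x \<le> C * L l" for x l
    using C by (intro order_trans[OF that] mult_left_mono) auto
  have mO: "(\<lambda>l. mean l - D.meanX (u l)) \<in> O(L)"
    using evm by (intro bigoI[of _ C]) (auto elim!: eventually_mono intro: CL)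
  show "(\<lambda>l. mean l - D.meanX (u l)) \<in> O(\<lambda>l. ln (real l) powr (\<rho> + 3) / real l powr \<rho>)"
    by (rule landau_o.big_trans[OF mO Lb])
  have sO: "(\<lambda>l. prob_space.expectation (M l) (\<lambda>\<omega>. (real (X l \<omega>))\<^sup>2) - (D.varX (u l) + (D.meanX (u l))\<^sup>2)) \<in> O(L)"
    using evm by (intro bigoI[of _ C]) (auto elim!: eventually_mono intro: CL)
  have uO: "(\<lambda>l. D.meanX (u l)) \<in> O(\<lambda>l. ln (real l))"
  proof -
    have 1: "(\<lambda>l. u l + euler_mascheroni / ln a + 1 / 2) \<in> O(\<lambda>l. ln (real l))"
      unfolding u_def using a by real_asymp
    have 2: "(\<lambda>l. Re (Psi0 a (u l))) \<in> O(\<lambda>_. 1)"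
      using D.abs_Re_Psi0_le by (intro bigoI[of _ "1/2"]) auto
    have 3: "(\<lambda>_::nat. 1 :: real) \<in> O(\<lambda>l. ln (real l))" by real_asymp
    have "(\<lambda>l. (u l + euler_mascheroni / ln a + 1 / 2) + Re (Psi0 a (u l))) \<in> O(\<lambda>l. ln (real l))"
      by (rule sum_in_bigo(1)[OF 1 landau_o.big_trans[OF 2 3]])
    thus ?thesis by (simp add: D.meanX_def)
  qed
  have LL: "(\<lambda>l. ln (real l) * L l) \<in> O(\<lambda>l. ln (real l) powr (\<rho> + 4) / real l powr \<rho>)"
    "L \<in> O(\<lambda>l. ln (real l) powr (\<rho> + 4) / real l powr \<rho>)"
    "(\<lambda>l. L l * L l) \<in> O(\<lambda>l. ln (real l) powr (\<rho> + 4) / real l powr \<rho>)"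
    unfolding L_def using rho_bounds by real_asymp+
  \<comment> \<open>The difference of the variances, with the square of \<open>mean l\<close>
    expanded around \<open>D.meanX (u l)\<close>. The mixed term is the largest, of order
    \<open>ln l * L l\<close>.\<close>
  have var_big: "(\<lambda>l. (prob_space.expectation (M l) (\<lambda>\<omega>. (real (X l \<omega>))\<^sup>2) - (D.varX (u l) + (D.meanX (u l))\<^sup>2))
       - 2 * (D.meanX (u l) * (mean l - D.meanX (u l))) - (mean l - D.meanX (u l)) * (mean l - D.meanX (u l)))
     \<in> O(\<lambda>l. ln (real l) powr (\<rho> + 4) / real l powr \<rho>)" (is "?d \<in> _")
  proof (rule sum_in_bigo(2)[OF sum_in_bigo(2)[OF landau_o.big_trans[OF sO LL(2)]]])
    show "(\<lambda>l. 2 * (D.meanX (u l) * (mean l - D.meanX (u l)))) \<in> O(\<lambda>l. ln (real l) powr (\<rho> + 4) / real l powr \<rho>)"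
      by (rule landau_o.big.cmult_in_iff[THEN iffD2, OF _ landau_o.big_trans[OF landau_o.big.mult[OF uO mO] LL(1)]]) simp
  qed (rule landau_o.big_trans[OF landau_o.big.mult[OF mO mO] LL(3)])
  have "\<forall>\<^sub>F l in sequentially. ?d l = var l - D.varX (u l)"
    using eventually_ge_at_top[of l0]
  proof eventually_elim
    case (elim l)
    interpret pl: prob_space "M l" using rv[OF elim] unfolding rv_with_cdf_def by blast
    note mom = rv_with_cdf_moments[OF rv[OF elim] F_eq_1[OF v0[OF elim]], of l, OF lessI]
    have "var l = prob_space.expectation (M l) (\<lambda>\<omega>. (real (X l \<omega>))\<^sup>2) - (mean l)\<^sup>2"
      unfolding var_def mean_def by (rule pl.variance_eq[OF mom(1,2)])
    thus ?case by (simp add: power2_eq_square algebra_simps)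
  qed
  from this and var_big show "(\<lambda>l. var l - D.varX (u l)) \<in> O(\<lambda>l. ln (real l) powr (\<rho> + 4) / real l powr \<rho>)"
    by (rule landau_o.big.in_cong[THEN iffD1])
qed

end

section \<open>The limit law along subsequences\<close>

context perturbed_coeffs
begin

text \<open>At the index \<open>\<lfloor>x + log a l\<rfloor>\<close> the quotient
  \<open>l / a ^ k\<close> is \<open>a\<close> to the power
  \<open>frac (log a l) - \<lfloor>x + frac (log a l)\<rfloor>\<close>; here \<open>t\<close>
  replaces the fractional part. The limit \<open>t\<close> may equal 1, and then the function is the
  same as for \<open>t = 0\<close>.\<close>

definition limit_cdf :: "real \<Rightarrow> real \<Rightarrow> real" where
  "limit_cdf t x = exp (- \<delta> * a powr (t - of_int \<lfloor>x + t\<rfloor>))"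

lemma limit_cdf_mono:
  assumes "x \<le> y"
  shows "limit_cdf t x \<le> limit_cdf t y"
proof -
  have "real_of_int \<lfloor>x + t\<rfloor> \<le> of_int \<lfloor>y + t\<rfloor>" using assms by (simp add: floor_mono)
  hence "a powr (t - of_int \<lfloor>y + t\<rfloor>) \<le> a powr (t - of_int \<lfloor>x + t\<rfloor>)" using a by (intro powr_mono) auto
  hence "\<delta> * a powr (t - of_int \<lfloor>y + t\<rfloor>) \<le> \<delta> * a powr (t - of_int \<lfloor>x + t\<rfloor>)" using delta_pos by (intro mult_left_mono) auto
  thus ?thesis by (simp add: limit_cdf_def)
qed

lemma limit_cdf_right_continuous: "continuous (at_right x) (limit_cdf t)"
proof -
  have "\<forall>\<^sub>F y in at_right x. y \<in> {x<..<of_int \<lfloor>x + t\<rfloor> + 1 - t}"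
    by (rule eventually_at_right_real) linarith
  hence "\<forall>\<^sub>F y in at_right x. limit_cdf t y = limit_cdf t x"
  proof eventually_elim
    case (elim y)
    have "\<lfloor>y + t\<rfloor> = \<lfloor>x + t\<rfloor>"
    proof (rule floor_unique)
      have "of_int \<lfloor>x + t\<rfloor> \<le> x + t" by simp
      also have "\<dots> \<le> y + t" using elim by simp
      finally show "of_int \<lfloor>x + t\<rfloor> \<le> y + t" .
      show "y + t < of_int \<lfloor>x + t\<rfloor> + 1" using elim by simp
    qed
    thus ?case by (simp add: limit_cdf_def)
  qed
  thus ?thesis unfolding continuous_within by (rule tendsto_eventually)
qed

lemma limit_cdf_at_bot: "(limit_cdf t \<longlongrightarrow> 0) at_bot"
proof (rule tendsto_sandwich)
  show "\<forall>\<^sub>F x in at_bot. 0 \<le> limit_cdf t x" by (simp add: limit_cdf_def)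
  show "\<forall>\<^sub>F x in at_bot. limit_cdf t x \<le> exp (- \<delta> * a powr (- x))"
  proof (intro always_eventually allI)
    fix x
    have "a powr (- x) \<le> a powr (t - of_int \<lfloor>x + t\<rfloor>)" using a by (intro powr_mono) linarith+
    hence "\<delta> * a powr (- x) \<le> \<delta> * a powr (t - of_int \<lfloor>x + t\<rfloor>)" using delta_pos by (intro mult_left_mono) auto
    thus "limit_cdf t x \<le> exp (- \<delta> * a powr (- x))" by (simp add: limit_cdf_def)
  qed
  show "((\<lambda>x. exp (- \<delta> * a powr (- x))) \<longlongrightarrow> 0) at_bot" using a delta_pos by real_asymp
qed simp

lemma limit_cdf_at_top: "(limit_cdf t \<longlongrightarrow> 1) at_top"
proof (rule tendsto_sandwich)
  show "\<forall>\<^sub>F x in at_top. limit_cdf t x \<le> 1" using delta_pos by (simp add: limit_cdf_def)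
  show "\<forall>\<^sub>F x in at_top. exp (- \<delta> * a powr (1 - x)) \<le> limit_cdf t x"
  proof (intro always_eventually allI)
    fix x
    have "a powr (t - of_int \<lfloor>x + t\<rfloor>) \<le> a powr (1 - x)" using a by (intro powr_mono) linarith+
    hence "\<delta> * a powr (t - of_int \<lfloor>x + t\<rfloor>) \<le> \<delta> * a powr (1 - x)" using delta_pos by (intro mult_left_mono) auto
    thus "exp (- \<delta> * a powr (1 - x)) \<le> limit_cdf t x" by (simp add: limit_cdf_def)
  qed
  show "((\<lambda>x. exp (- \<delta> * a powr (1 - x))) \<longlongrightarrow> 1) at_top" using a delta_pos by real_asymp
qed simp

text \<open>Where \<open>x + t\<close> is an integer the floor jumps, and the left limit has the
  exponent of the preceding integer. Weak convergence only concerns continuity points, and at these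
  the floor is locally constant.\<close>

lemma limit_cdf_jump:
  assumes "isCont (limit_cdf t) x"
  shows "x + t \<notin> \<int>"
proof
  assume xt: "x + t \<in> \<int>"
  define n where "n = \<lfloor>x + t\<rfloor>"
  have n: "x + t = of_int n" using xt by (auto elim!: Ints_cases simp: n_def)
  have "(limit_cdf t \<longlongrightarrow> limit_cdf t x) (at_left x)"
    using assms by (auto simp: isCont_def intro: tendsto_mono[OF at_le])
  moreover have "(limit_cdf t \<longlongrightarrow> exp (- \<delta> * a powr (t - of_int (n - 1)))) (at_left x)"
  proof (rule tendsto_eventually)
    have "\<forall>\<^sub>F y in at_left x. y \<in> {x - 1<..<x}" by (rule eventually_at_left_real) simp
    thus "\<forall>\<^sub>F y in at_left x. limit_cdf t y = exp (- \<delta> * a powr (t - of_int (n - 1)))"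
    proof eventually_elim
      case (elim y)
      have "\<lfloor>y + t\<rfloor> = n - 1" by (rule floor_unique) (use elim n in auto)
      thus ?case by (simp add: limit_cdf_def)
    qed
  qed
  ultimately have "limit_cdf t x = exp (- \<delta> * a powr (t - of_int (n - 1)))"
    by (rule tendsto_unique[rotated]) simp
  hence "a powr (t - of_int n) = a powr (t - of_int (n - 1))"
    using delta_pos by (simp add: limit_cdf_def n)
  thus False using a by (simp add: powr_inj)
qed

lemma weak_convergence:
  fixes M :: "nat \<Rightarrow> 'b measure"
  assumes v0: "\<And>l. l \<ge> l0 \<Longrightarrow> v l \<noteq> 0" and rv: "\<And>l. l \<ge> l0 \<Longrightarrow> rv_with_cdf (M l) (X l) (F l)"
    and \<sigma>: "strict_mono \<sigma>" and conv: "convergent (\<lambda>n. frac (log a (real (\<sigma> n))))"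
  shows "\<exists>\<mu>. real_distribution \<mu> \<and>
           weak_conv_m (\<lambda>n. distr (M (\<sigma> n)) borel (\<lambda>\<omega>. real (X (\<sigma> n) \<omega>) - log a (real (\<sigma> n)))) \<mu>"
proof -
  obtain t where t: "(\<lambda>n. frac (log a (real (\<sigma> n)))) \<longlonglongrightarrow> t" using conv by (auto simp: convergent_def)
  define \<mu> where "\<mu> = interval_measure (limit_cdf t)"
  have dist: "real_distribution \<mu>"
    unfolding \<mu>_def
    by (rule real_distribution_interval_measure[OF limit_cdf_mono limit_cdf_right_continuous limit_cdf_at_bot limit_cdf_at_top])
  have cdf\<mu>: "cdf \<mu> = limit_cdf t"
    unfolding \<mu>_def
    by (rule cdf_interval_measure[OF limit_cdf_mono limit_cdf_right_continuous limit_cdf_at_bot])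
  have "(\<lambda>n. cdf (distr (M (\<sigma> n)) borel (\<lambda>\<omega>. real (X (\<sigma> n) \<omega>) - log a (real (\<sigma> n)))) x) \<longlonglongrightarrow> limit_cdf t x"
    if x: "isCont (limit_cdf t) x" for x
  proof -
    have xt: "x + t \<notin> \<int>" by (rule limit_cdf_jump[OF x])
    \<comment> \<open>As \<open>X_l\<close> is an integer, \<open>X_l - log a l \<le> x\<close>
      means that \<open>X_l\<close> is at most this floor. The conversion by \<open>nat\<close> is
      harmless once \<open>x + log a l\<close> is nonnegative.\<close>
    define \<kappa> where "\<kappa> l = nat \<lfloor>x + log a (real l)\<rfloor>" for l :: nat
    have \<sigma>lim: "filterlim \<sigma> sequentially sequentially" by (rule filterlim_subseq[OF \<sigma>])
    have "filterlim (\<lambda>l. x + log a (real l)) at_top sequentially" using a by real_asymp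
    hence pos: "\<forall>\<^sub>F l in sequentially. 0 \<le> x + log a (real l)" unfolding filterlim_at_top by blast
    have "\<forall>\<^sub>F l in sequentially. norm (real (\<kappa> l) - log a (real l)) \<le> (\<bar>x\<bar> + 1) * norm (1::real)"
      using pos
    proof eventually_elim
      case (elim l)
      hence "real (\<kappa> l) = of_int \<lfloor>x + log a (real l)\<rfloor>" by (simp add: \<kappa>_def)
      hence "\<bar>real (\<kappa> l) - log a (real l)\<bar> \<le> \<bar>x\<bar> + 1" by linarith
      thus ?case by simp
    qed
    hence "(\<lambda>l. real (\<kappa> l) - log a (real l)) \<in> O(\<lambda>_. 1)" by (rule bigoI)
    note rae = ratio_asymp_equiv[OF this]
    have eq: "(\<lambda>n. F (\<sigma> n) (\<kappa> (\<sigma> n))) \<sim>[sequentially] (\<lambda>n. exp (- \<delta> * real (\<sigma> n) / a ^ \<kappa> (\<sigma> n)))"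
      unfolding F_def by (rule asymp_equiv_compose'[OF rae \<sigma>lim])
    have "\<lfloor>x + t\<rfloor> < x + t" using xt by (metis Ints_of_int floor_correct less_eq_real_def)
    \<comment> \<open>Since \<open>x + t\<close> is not an integer, points close enough to it have
      the same floor.\<close>
    have near: "\<forall>\<^sub>F n in sequentially. \<lfloor>x + frac (log a (real (\<sigma> n)))\<rfloor> = \<lfloor>x + t\<rfloor>"
    proof -
      have "(\<lambda>n. x + frac (log a (real (\<sigma> n)))) \<longlonglongrightarrow> x + t" by (intro tendsto_intros t)
      from order_tendstoD(1)[OF this \<open>\<lfloor>x + t\<rfloor> < x + t\<close>] order_tendstoD(2)[OF this, of "of_int \<lfloor>x + t\<rfloor> + 1"]
      have "\<forall>\<^sub>F n in sequentially. of_int \<lfloor>x + t\<rfloor> < x + frac (log a (real (\<sigma> n)))"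
        "\<forall>\<^sub>F n in sequentially. x + frac (log a (real (\<sigma> n))) < of_int \<lfloor>x + t\<rfloor> + 1" by simp_all
      thus ?thesis by eventually_elim (intro floor_unique, auto)
    qed
    have ev\<sigma>: "\<forall>\<^sub>F n in sequentially. 0 \<le> x + log a (real (\<sigma> n))"
      "\<forall>\<^sub>F n in sequentially. l0 \<le> \<sigma> n" "\<forall>\<^sub>F n in sequentially. 1 \<le> \<sigma> n"
      using eventually_compose_filterlim[OF pos \<sigma>lim] eventually_compose_filterlim[OF eventually_ge_at_top[of l0] \<sigma>lim]
        eventually_compose_filterlim[OF eventually_ge_at_top[of 1] \<sigma>lim] by auto
    have lim: "(\<lambda>n. exp (- \<delta> * a powr (frac (log a (real (\<sigma> n))) - of_int \<lfloor>x + t\<rfloor>))) \<longlonglongrightarrow> limit_cdf t x"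
      unfolding limit_cdf_def using a by (intro tendsto_intros t) auto
    have ev: "\<forall>\<^sub>F n in sequentially. exp (- \<delta> * real (\<sigma> n) / a ^ \<kappa> (\<sigma> n)) = exp (- \<delta> * a powr (frac (log a (real (\<sigma> n))) - of_int \<lfloor>x + t\<rfloor>))"
      using near ev\<sigma>
    proof eventually_elim
      case (elim n)
      define L where "L = log a (real (\<sigma> n))"
      have L: "L = frac L + of_int \<lfloor>L\<rfloor>" by (simp add: frac_def)
      have fl: "\<lfloor>x + L\<rfloor> = \<lfloor>x + t\<rfloor> + \<lfloor>L\<rfloor>"
      proof -
        have "\<lfloor>x + L\<rfloor> = \<lfloor>(x + frac L) + of_int \<lfloor>L\<rfloor>\<rfloor>" by (simp add: frac_def)
        also have "\<dots> = \<lfloor>x + frac L\<rfloor> + \<lfloor>L\<rfloor>" by (rule floor_add_int[symmetric])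
        finally show ?thesis using elim(1) by (simp add: L_def)
      qed
      have "real (\<kappa> (\<sigma> n)) = of_int \<lfloor>x + L\<rfloor>" using elim(2) by (simp add: \<kappa>_def L_def)
      moreover have "a ^ \<kappa> (\<sigma> n) = a powr real (\<kappa> (\<sigma> n))" using a by (simp add: powr_realpow)
      moreover have "real (\<sigma> n) = a powr L" using elim(4) a by (simp add: L_def)
      ultimately have "real (\<sigma> n) / a ^ \<kappa> (\<sigma> n) = a powr (L - of_int \<lfloor>x + L\<rfloor>)" by (simp add: powr_diff)
      also have "L - of_int \<lfloor>x + L\<rfloor> = frac L - of_int \<lfloor>x + t\<rfloor>" unfolding fl by (simp add: frac_def)
      finally show ?case by (simp add: L_def flip: times_divide_eq_right)
    qed
    have "(\<lambda>n. exp (- \<delta> * real (\<sigma> n) / a ^ \<kappa> (\<sigma> n))) \<longlonglongrightarrow> limit_cdf t x"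
      by (rule tendsto_cong[THEN iffD2, OF ev lim])
    hence limF: "(\<lambda>n. F (\<sigma> n) (\<kappa> (\<sigma> n))) \<longlonglongrightarrow> limit_cdf t x"
      by (rule asymp_equiv_tendsto_transfer[OF asymp_equiv_symI[OF eq]])
    have "\<forall>\<^sub>F n in sequentially. cdf (distr (M (\<sigma> n)) borel (\<lambda>\<omega>. real (X (\<sigma> n) \<omega>) - log a (real (\<sigma> n)))) x = F (\<sigma> n) (\<kappa> (\<sigma> n))"
      using ev\<sigma>
    proof eventually_elim
      case (elim n)
      define L where "L = log a (real (\<sigma> n))"
      have [measurable]: "X (\<sigma> n) \<in> M (\<sigma> n) \<rightarrow>\<^sub>M count_space UNIV"
        and Fn: "\<And>k. measure (M (\<sigma> n)) {\<omega> \<in> space (M (\<sigma> n)). X (\<sigma> n) \<omega> \<le> k} = F (\<sigma> n) k"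
        using rv[OF elim(2)] unfolding rv_with_cdf_def by blast+
      have "cdf (distr (M (\<sigma> n)) borel (\<lambda>\<omega>. real (X (\<sigma> n) \<omega>) - L)) x
         = measure (M (\<sigma> n)) ((\<lambda>\<omega>. real (X (\<sigma> n) \<omega>) - L) -` {..x} \<inter> space (M (\<sigma> n)))"
        unfolding cdf_def by (rule measure_distr) measurable
      also have "(\<lambda>\<omega>. real (X (\<sigma> n) \<omega>) - L) -` {..x} \<inter> space (M (\<sigma> n)) = {\<omega> \<in> space (M (\<sigma> n)). X (\<sigma> n) \<omega> \<le> \<kappa> (\<sigma> n)}"
      proof -
        have "real m - L \<le> x \<longleftrightarrow> m \<le> \<kappa> (\<sigma> n)" for m
        proof -
          have "real m - L \<le> x \<longleftrightarrow> of_int (int m) \<le> x + L" by auto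
          also have "\<dots> \<longleftrightarrow> int m \<le> \<lfloor>x + L\<rfloor>" by (rule le_floor_iff[symmetric])
          also have "\<dots> \<longleftrightarrow> m \<le> \<kappa> (\<sigma> n)" using elim(1) by (auto simp: \<kappa>_def L_def le_nat_iff)
          finally show ?thesis .
        qed
        thus ?thesis by auto
      qed
      finally show ?case unfolding L_def Fn .
    qed
    from tendsto_cong[THEN iffD2, OF this limF] show ?thesis .
  qed
  hence "weak_conv_m (\<lambda>n. distr (M (\<sigma> n)) borel (\<lambda>\<omega>. real (X (\<sigma> n) \<omega>) - log a (real (\<sigma> n)))) \<mu>"
    unfolding weak_conv_m_def weak_conv_def cdf\<mu> by blast
  with dist show ?thesis by blast
qed

end

theorem theorem3:
  fixes w :: "nat \<Rightarrow> nat \<Rightarrow> real"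
    and m :: nat
    and a :: "nat \<Rightarrow> real"
    and r0 s0 s1 :: "real poly"
    and r1 s2 :: mpoly
  assumes w_nonneg: "\<And>l k. w l k \<ge> 0"
    and w_mono: "\<And>l. mono (w l)"
    and m: "m \<ge> 2"
    and a1: "1 < a 1"
    and a12: "a 1 < \<bar>a 2\<bar>"
    and a_mono: "\<And>j. 2 \<le> j \<Longrightarrow> j < m \<Longrightarrow> \<bar>a j\<bar> \<le> \<bar>a (Suc j)\<bar>"
    and r1: "r1_admissible m r1"
    and s2: "s2_admissible m s2"
    and S_nz: "\<And>k. S_poly a s0 s1 s2 k \<noteq> 0"
    and gf: "\<And>k. Abs_fps (\<lambda>l. w l k) * fps_of_poly (S_poly a s0 s1 s2 k)
                    = fps_of_poly (R_poly a r0 r1 k)"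
    and r0_1: "poly r0 1 \<noteq> 0"
    and s0_nz: "\<And>z. cmod z \<le> 1 \<Longrightarrow> cpoly s0 z \<noteq> 0"
    and delta_pos: "delta s0 s1 > 0"
  shows
    "(\<forall>z. cmod z < a 1 \<and> z \<noteq> 1 \<and> cpoly s0 z \<noteq> 0 \<longrightarrow>
        (\<lambda>k. cpoly (R_poly a r0 r1 k) z / cpoly (S_poly a s0 s1 s2 k) z)
          \<longlonglongrightarrow> G_lim r0 s0 z)
   \<and> (\<forall>z. cmod z < 1 \<longrightarrow> (\<lambda>l. of_real (w_lim r0 s0 l) * z ^ l) sums G_lim r0 s0 z)
   \<and> (\<forall>l k. k > l \<longrightarrow> w_lim r0 s0 l = w l k)
   \<and> (\<exists>l0. \<forall>l\<ge>l0. w_lim r0 s0 l \<noteq> 0)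
   \<and> (\<forall>l. w_lim r0 s0 l \<noteq> 0 \<longrightarrow>
        (\<exists>p :: nat pmf. rv_with_cdf (measure_pmf p) id (\<lambda>k. w l k / w_lim r0 s0 l)))
   \<and> (\<forall>\<kappa> :: nat \<Rightarrow> nat. (\<lambda>l. real (\<kappa> l) - log (a 1) (real l)) \<in> O(\<lambda>_. 1) \<longrightarrow>
        (\<lambda>l. w l (\<kappa> l) / w_lim r0 s0 l)
          \<sim>[sequentially] (\<lambda>l. exp (- delta s0 s1 * real l / a 1 ^ \<kappa> l)))
   \<and> (\<forall>x. Psi0_term (a 1) x summable_on {n. n \<noteq> 0} \<and> Psi0 (a 1) x \<in> \<real>
          \<and> Psi0 (a 1) (x + 1) = Psi0 (a 1) x)
   \<and> (Psi0 (a 1) has_integral 0) {0..1}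
   \<and> (\<forall>x. Psi1_term (a 1) x summable_on {n. n \<noteq> 0} \<and> Psi1 (a 1) x \<in> \<real>
          \<and> Psi1 (a 1) (x + 1) = Psi1 (a 1) x)
   \<and> (Psi1 (a 1) has_integral 0) {0..1}
   \<and> (\<forall>l0 (M :: nat \<Rightarrow> 'b measure) X.
        (\<forall>l\<ge>l0. w_lim r0 s0 l \<noteq> 0) \<and>
        (\<forall>l\<ge>l0. rv_with_cdf (M l) (X l) (\<lambda>k. w l k / w_lim r0 s0 l)) \<longrightarrow>
        (\<forall>\<sigma> :: nat \<Rightarrow> nat.
            strict_mono \<sigma> \<and> convergent (\<lambda>n. frac (log (a 1) (real (\<sigma> n)))) \<longrightarrow>
            (\<exists>\<mu>. real_distribution \<mu> \<and>
               weak_conv_m (\<lambda>n. distr (M (\<sigma> n)) borel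
                  (\<lambda>\<omega>. real (X (\<sigma> n) \<omega>) - log (a 1) (real (\<sigma> n)))) \<mu>))
      \<and> (\<forall>l\<ge>l0. integrable (M l) (\<lambda>\<omega>. real (X l \<omega>)) \<and>
                integrable (M l) (\<lambda>\<omega>. (real (X l \<omega>))\<^sup>2))
      \<and> (\<lambda>l. prob_space.expectation (M l) (\<lambda>\<omega>. real (X l \<omega>))
            - (log (a 1) (real l) + log (a 1) (delta s0 s1)
               + euler_mascheroni / ln (a 1) + 1 / 2
               + Re (Psi0 (a 1) (log (a 1) (real l) + log (a 1) (delta s0 s1)))))
          \<in> O(\<lambda>l. ln (real l) powr (rho a + 3) / real l powr rho a)
      \<and> (\<lambda>l. prob_space.variance (M l) (\<lambda>\<omega>. real (X l \<omega>))
            - (pi\<^sup>2 / (6 * (ln (a 1))\<^sup>2) + 1 / 12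
               + Re (Psi1 (a 1) (log (a 1) (real l) + log (a 1) (delta s0 s1)))
               - 2 * euler_mascheroni / ln (a 1)
                   * Re (Psi0 (a 1) (log (a 1) (real l) + log (a 1) (delta s0 s1)))
               - (Re (Psi0 (a 1) (log (a 1) (real l) + log (a 1) (delta s0 s1))))\<^sup>2))
          \<in> O(\<lambda>l. ln (real l) powr (rho a + 4) / real l powr rho a))"
proof -
  \<comment> \<open>The rate from \<open>decaying_s2\<close>; its exponent to base
    \<open>a 1\<close> is \<open>1 + rho a\<close>, as verified under \<open>rho\<close>
    below.\<close>
  define b where "b = min \<bar>a 2\<bar> ((a 1)\<^sup>2)"
  let ?P = "\<lambda>k. mpoly_subst (arg_poly a k) r1"
  let ?Q = "\<lambda>k. mpoly_subst (arg_poly a k) s2"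
  have a2j: "\<bar>a 2\<bar> \<le> \<bar>a j\<bar>" if "2 \<le> j" "j \<le> m" for j
    using that
  proof (induction j rule: dec_induct)
    case (step n)
    thus ?case using a_mono[of n] by simp
  qed simp
  have a1j: "a 1 \<le> \<bar>a j\<bar>" if "1 \<le> j" "j \<le> m" for j
    using that a12 a2j[of j] a1 by (cases "j = 1") auto
  have "a 1 < (a 1)\<^sup>2" using a1 by (simp add: power2_eq_square)
  hence b: "a 1 < b" "b \<le> (a 1)\<^sup>2" using a12 by (auto simp: b_def)
  interpret pp: perturbed_pole "a 1" b r0 s0 s1 ?P ?Q
  proof
    show "decaying (a 1) (a 1) ?P" by (rule decaying_r1[where a = a and m = m, OF a1 a1j r1])
    show "decaying (a 1) b ?Q" unfolding b_def by (rule decaying_s2[where a = a and m = m, OF a1 m a12 a2j s2])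
  qed (use a1 b r0_1 s0_nz delta_pos in auto)
  have S: "pp.S k = S_poly a s0 s1 s2 k" for k
  proof -
    have "[:0, 1 / a 1:] ^ k = monom (1 / a 1 ^ k) k"
      by (simp add: monom_Suc[of _ 0, unfolded monom_0, symmetric] monom_pow power_one_over del: One_nat_def)
    thus ?thesis by (simp only: pp.S_def pp.E_def S_poly_def add.assoc)
  qed
  have R: "pp.R k = R_poly a r0 r1 k" for k
    by (simp only: pp.R_def R_poly_def)
  interpret pc: perturbed_coeffs "a 1" b r0 s0 s1 ?P ?Q w "w_lim r0 s0"
  proof
    show "Abs_fps (\<lambda>l. w l k) * fps_of_poly (pp.S k) = fps_of_poly (pp.R k)" for k
      unfolding S R by (rule gf)
    have "cpoly s0 (of_real 0) \<noteq> 0" by (rule s0_nz) simp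
    hence "poly.coeff s0 0 \<noteq> 0" unfolding cpoly_of_real by (simp add: poly_0_coeff_0)
    \<comment> \<open>The quotient of power series in \<open>w_lim\<close> is a true quotient
      because the divisor is invertible.\<close>
    hence "is_unit (fps_of_poly ([:1, -1:] * s0))"
      by (subst fps_is_unit_iff) (simp add: coeff_mult_0)
    hence "fps_of_poly r0 / fps_of_poly ([:1, -1:] * s0) * fps_of_poly ([:1, -1:] * s0) = fps_of_poly r0"
      by (simp add: unit_div_mult_self)
    moreover have "Abs_fps (w_lim r0 s0) = fps_of_poly r0 / fps_of_poly ([:1, -1:] * s0)"
      by (rule fps_ext) (simp only: w_lim_def fps_nth_Abs_fps)
    ultimately show "Abs_fps (w_lim r0 s0) * fps_of_poly ([:1, -1:] * s0) = fps_of_poly r0"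
      by (simp only:)
  qed (use w_nonneg w_mono in auto)
  interpret D: discretized_Gumbel "a 1" by unfold_locales (rule a1)
  have rho: "rho a = pc.\<rho>"
  proof -
    have "ln b = min (ln \<bar>a 2\<bar>) (2 * ln (a 1))"
    proof -
      have "ln ((a 1)\<^sup>2) = 2 * ln (a 1)" using a1 by (simp add: ln_realpow)
      moreover have "ln (min x y) = min (ln x) (ln y)" if "x > 0" "y > 0" for x y :: real
        using that by (simp add: min_def)
      ultimately show ?thesis using a1 a12 by (simp add: b_def del: One_nat_def)
    qed
    thus ?thesis using D.ln_a_pos by (simp add: rho_def pc.\<rho>_def min_def divide_le_eq le_divide_eq del: One_nat_def)
  qed
  have F: "(\<lambda>k. w l k / w_lim r0 s0 l) = pc.F l" for l
    by (simp add: pc.F_def fun_eq_iff)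
  show ?thesis
  proof (intro conjI)
    show "(\<forall>z. cmod z < a 1 \<and> z \<noteq> 1 \<and> cpoly s0 z \<noteq> 0 \<longrightarrow>
        (\<lambda>k. cpoly (R_poly a r0 r1 k) z / cpoly (S_poly a s0 s1 s2 k) z)
          \<longlonglongrightarrow> G_lim r0 s0 z)"
      using pc.G_lim_tendsto unfolding S R by blast
    show "(\<forall>z. cmod z < 1 \<longrightarrow> (\<lambda>l. of_real (w_lim r0 s0 l) * z ^ l) sums G_lim r0 s0 z)"
      using pc.G_lim_sums by blast
    show "(\<forall>l k. k > l \<longrightarrow> w_lim r0 s0 l = w l k)"
      using pc.v_eq_w by blast
    show "(\<exists>l0. \<forall>l\<ge>l0. w_lim r0 s0 l \<noteq> 0)"
      using pc.eventually_v pc.g_pos unfolding eventually_sequentially by (metis half_gt_zero less_irrefl less_trans)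
    show "(\<forall>l. w_lim r0 s0 l \<noteq> 0 \<longrightarrow>
        (\<exists>p :: nat pmf. rv_with_cdf (measure_pmf p) id (\<lambda>k. w l k / w_lim r0 s0 l)))"
      unfolding F using pc.cdf_pmf by blast
    show "(\<forall>\<kappa> :: nat \<Rightarrow> nat. (\<lambda>l. real (\<kappa> l) - log (a 1) (real l)) \<in> O(\<lambda>_. 1) \<longrightarrow>
        (\<lambda>l. w l (\<kappa> l) / w_lim r0 s0 l)
          \<sim>[sequentially] (\<lambda>l. exp (- delta s0 s1 * real l / a 1 ^ \<kappa> l)))"
      using pc.ratio_asymp_equiv by blast
    show "(\<forall>x. Psi0_term (a 1) x summable_on {n. n \<noteq> 0} \<and> Psi0 (a 1) x \<in> \<real>
          \<and> Psi0 (a 1) (x + 1) = Psi0 (a 1) x)"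
      using Psi_facts[OF a1] by blast
    show "(Psi0 (a 1) has_integral 0) {0..1}"
      by (rule Psi_facts[OF a1])
    show "(\<forall>x. Psi1_term (a 1) x summable_on {n. n \<noteq> 0} \<and> Psi1 (a 1) x \<in> \<real>
          \<and> Psi1 (a 1) (x + 1) = Psi1 (a 1) x)"
      using Psi_facts[OF a1] by blast
    show "(Psi1 (a 1) has_integral 0) {0..1}"
      by (rule Psi_facts[OF a1])
    show "(\<forall>l0 (M :: nat \<Rightarrow> 'b measure) X.
        (\<forall>l\<ge>l0. w_lim r0 s0 l \<noteq> 0) \<and>
        (\<forall>l\<ge>l0. rv_with_cdf (M l) (X l) (\<lambda>k. w l k / w_lim r0 s0 l)) \<longrightarrow>
        (\<forall>\<sigma> :: nat \<Rightarrow> nat.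
            strict_mono \<sigma> \<and> convergent (\<lambda>n. frac (log (a 1) (real (\<sigma> n)))) \<longrightarrow>
            (\<exists>\<mu>. real_distribution \<mu> \<and>
               weak_conv_m (\<lambda>n. distr (M (\<sigma> n)) borel
                  (\<lambda>\<omega>. real (X (\<sigma> n) \<omega>) - log (a 1) (real (\<sigma> n)))) \<mu>))
      \<and> (\<forall>l\<ge>l0. integrable (M l) (\<lambda>\<omega>. real (X l \<omega>)) \<and>
                integrable (M l) (\<lambda>\<omega>. (real (X l \<omega>))\<^sup>2))
      \<and> (\<lambda>l. prob_space.expectation (M l) (\<lambda>\<omega>. real (X l \<omega>))
            - (log (a 1) (real l) + log (a 1) (delta s0 s1)
               + euler_mascheroni / ln (a 1) + 1 / 2
               + Re (Psi0 (a 1) (log (a 1) (real l) + log (a 1) (delta s0 s1)))))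
          \<in> O(\<lambda>l. ln (real l) powr (rho a + 3) / real l powr rho a)
      \<and> (\<lambda>l. prob_space.variance (M l) (\<lambda>\<omega>. real (X l \<omega>))
            - (pi\<^sup>2 / (6 * (ln (a 1))\<^sup>2) + 1 / 12
               + Re (Psi1 (a 1) (log (a 1) (real l) + log (a 1) (delta s0 s1)))
               - 2 * euler_mascheroni / ln (a 1)
                   * Re (Psi0 (a 1) (log (a 1) (real l) + log (a 1) (delta s0 s1)))
               - (Re (Psi0 (a 1) (log (a 1) (real l) + log (a 1) (delta s0 s1))))\<^sup>2))
          \<in> O(\<lambda>l. ln (real l) powr (rho a + 4) / real l powr rho a))"
      (is "\<forall>l0 M X. ?pre l0 M X \<longrightarrow> ?concl l0 M X")
    proof (intro allI impI, elim conjE)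
      fix l0 and M :: "nat \<Rightarrow> 'b measure" and X
      assume "\<forall>l\<ge>l0. w_lim r0 s0 l \<noteq> 0" and "\<forall>l\<ge>l0. rv_with_cdf (M l) (X l) (\<lambda>k. w l k / w_lim r0 s0 l)"
      hence v0: "\<And>l. l \<ge> l0 \<Longrightarrow> w_lim r0 s0 l \<noteq> 0" and rv: "\<And>l. l \<ge> l0 \<Longrightarrow> rv_with_cdf (M l) (X l) (pc.F l)"
        unfolding F by blast+
      note mom = rv_with_cdf_moments(1,2)[OF rv pc.F_eq_1[OF v0 lessI]]
      note asy = pc.moments_asymptotics[OF v0 rv, unfolded D.meanX_def D.varX_def]
      show "?concl l0 M X"
        unfolding rho
      proof (intro conjI allI impI)
        fix \<sigma> :: "nat \<Rightarrow> nat"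
        assume "strict_mono \<sigma> \<and> convergent (\<lambda>n. frac (log (a 1) (real (\<sigma> n))))"
        thus "\<exists>\<mu>. real_distribution \<mu> \<and>
               weak_conv_m (\<lambda>n. distr (M (\<sigma> n)) borel
                  (\<lambda>\<omega>. real (X (\<sigma> n) \<omega>) - log (a 1) (real (\<sigma> n)))) \<mu>"
          using pc.weak_convergence[OF v0 rv] by blast
      qed (use mom asy in auto)
    qed
  qed
qed

end
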